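(* Let $V:\mathbb{R}\to[0,+\infty)$ be continuous with $\liminf_{|x|\to+\infty}V(x)>0$ and $V^{-1}(0)=\{0\}$. Assume that $V$ is flat at $0$, i.e. $V(x)=\mathcal{O}(|x|^n)$ near $0$ for all $n\in\mathbb{N}$, and that, for every $n\in\mathbb{N}$, the function $x\mapsto|x|^{-n}V(x)$ is strictly increasing for small positive $x$ and strictly decreasing for small negative $x$ (the size of the neighborhood of $0$ may depend on $n$). Let $P=-h^2\Delta+V$ on $L^2(\mathbb{R})$, and for $h>0$ small enough let $\delta_-=\delta_-(h)<0<\delta_+=\delta_+(h)$ be the unique solutions of $$V(\delta_-)=V(\delta_+)=\frac{h^2}{(\delta_+-\delta_-)^2}.$$ Then, for all $k\in\mathbb{N}^*=\{1,2,\dots\}$, in the limit $h\to0$, $$\lambda_k(P)\sim\frac{\pi^2h^2k^2}{(\delta_+-\delta_-)^2},$$ i.e. the ratio of the two sides tends to $1$ as $h\to 0$.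
   Context: The set $\mathbb{N}$ contains $0$. The operator $P=-h^2\Delta+V$ (with $\Delta=d^2/dx^2$) is the non-negative self-adjoint operator on $L^2(\mathbb{R})$ associated with the quadratic form $u\mapsto h^2\|u'\|^2+\|V^{1/2}u\|^2$ on $\{u\in H^1(\mathbb{R}): V^{1/2}u\in L^2(\mathbb{R})\}$; it depends on the semiclassical parameter $h>0$. For a non-negative self-adjoint operator $T$, $\lambda_k(T)$ denotes its $k$-th eigenvalue (in increasing order, counted with multiplicity), or the bottom of its essential spectrum if $T$ has fewer than $k$ eigenvalues below it (equivalently, the $k$-th max-min value of $T$). Under the stated hypotheses the pair $(\delta_-,\delta_+)$ exists and is unique for all sufficiently small $h>0$. *)

theory Defs
  imports
    "HOL-Analysis.Analysis"
    "HOL-Library.Landau_Symbols"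
    "HOL-Library.Extended_Nat"
begin

text \<open>
  Elements of the complex Hilbert space of square integrable functions on the line are
  represented by Borel functions; two functions that agree almost everywhere represent the
  same element. Every notion below is invariant under this identification.
\<close>

definition L2 :: "(real \<Rightarrow> complex) set" where
  "L2 = {u \<in> borel_measurable lborel. integrable lborel (\<lambda>x. (cmod (u x))\<^sup>2)}"

definition l2_inner :: "(real \<Rightarrow> complex) \<Rightarrow> (real \<Rightarrow> complex) \<Rightarrow> complex" where
  "l2_inner u v = (LINT x|lborel. u x * cnj (v x))"

definition l2_norm :: "(real \<Rightarrow> complex) \<Rightarrow> real" where
  "l2_norm u = sqrt (LINT x|lborel. (cmod (u x))\<^sup>2)"

definition l2_independent :: "nat \<Rightarrow> (nat \<Rightarrow> real \<Rightarrow> complex) \<Rightarrow> bool" where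
  "l2_independent n f \<longleftrightarrow>
     (\<forall>c :: nat \<Rightarrow> complex. (AE x in lborel. (\<Sum>i<n. c i * f i x) = 0) \<longrightarrow> (\<forall>i<n. c i = 0))"

definition has_weak_derivative :: "(real \<Rightarrow> complex) \<Rightarrow> (real \<Rightarrow> complex) \<Rightarrow> bool" where
  "has_weak_derivative u g \<longleftrightarrow> u \<in> L2 \<and> g \<in> L2 \<and>
     (\<forall>\<phi> \<phi>' :: real \<Rightarrow> real.
        (\<forall>x. (\<phi> has_real_derivative \<phi>' x) (at x)) \<and> continuous_on UNIV \<phi>' \<and>
        compact (closure {x. \<phi> x \<noteq> 0}) \<longrightarrow>
        (LINT x|lborel. u x * of_real (\<phi>' x)) = - (LINT x|lborel. g x * of_real (\<phi> x)))"

definition H1 :: "(real \<Rightarrow> complex) set" where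
  "H1 = {u. \<exists>g. has_weak_derivative u g}"

text \<open>The weak derivative is unique up to null sets, which is all that is used of the choice here.\<close>

definition weak_derivative :: "(real \<Rightarrow> complex) \<Rightarrow> real \<Rightarrow> complex" where
  "weak_derivative u = (SOME g. has_weak_derivative u g)"

definition form_domain :: "(real \<Rightarrow> real) \<Rightarrow> (real \<Rightarrow> complex) set" where
  "form_domain V = {u \<in> H1. (\<lambda>x. of_real (sqrt (V x)) * u x) \<in> L2}"

text \<open>
  The sesquilinear form whose diagonal is the quadratic form
  \<open>h\<^sup>2 \<parallel>u'\<parallel>\<^sup>2 + \<parallel>V\<^sup>1\<^sup>/\<^sup>2 u\<parallel>\<^sup>2\<close>.
\<close>

definition schroedinger_form ::
  "real \<Rightarrow> (real \<Rightarrow> real) \<Rightarrow> (real \<Rightarrow> complex) \<Rightarrow> (real \<Rightarrow> complex) \<Rightarrow> complex" where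
  "schroedinger_form h V u v =
     of_real (h\<^sup>2) * l2_inner (weak_derivative u) (weak_derivative v) +
     l2_inner (\<lambda>x. of_real (sqrt (V x)) * u x) (\<lambda>x. of_real (sqrt (V x)) * v x)"

text \<open>
  Unbounded operators are given by their graphs. The operator associated with a closed form \<open>q\<close>
  maps \<open>u\<close> in the form domain to \<open>f\<close> iff \<open>q u v = \<langle>f, v\<rangle>\<close> for all \<open>v\<close> in the form domain; its
  domain consists of those \<open>u\<close> for which such a square integrable \<open>f\<close> exists.
\<close>

type_synonym l2_operator = "((real \<Rightarrow> complex) \<times> (real \<Rightarrow> complex)) set"

definition schroedinger :: "real \<Rightarrow> (real \<Rightarrow> real) \<Rightarrow> l2_operator" where
  "schroedinger h V =
     {(u, f). u \<in> form_domain V \<and> f \<in> L2 \<and>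
              (\<forall>v \<in> form_domain V. schroedinger_form h V u v = l2_inner f v)}"

text \<open>
  The resolvent set: \<open>T - z\<close> is onto and has a bounded inverse (the bound entails injectivity).
\<close>

definition resolvent_set :: "l2_operator \<Rightarrow> complex set" where
  "resolvent_set T =
     {z. (\<forall>f \<in> L2. \<exists>u. (u, \<lambda>x. f x + z * u x) \<in> T) \<and>
         (\<exists>C. \<forall>(u, g) \<in> T. l2_norm u \<le> C * l2_norm (\<lambda>x. g x - z * u x))}"

definition op_spectrum :: "l2_operator \<Rightarrow> complex set" where
  "op_spectrum T = - resolvent_set T"

definition eigenspace :: "l2_operator \<Rightarrow> complex \<Rightarrow> (real \<Rightarrow> complex) set" where
  "eigenspace T z = {u. (u, \<lambda>x. z * u x) \<in> T}"

text \<open>The dimension of the eigenspace; it is positive exactly when \<open>z\<close> is an eigenvalue.\<close>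

definition eig_mult :: "l2_operator \<Rightarrow> complex \<Rightarrow> enat" where
  "eig_mult T z = Sup {enat n | n. \<exists>f. (\<forall>i<n. f i \<in> eigenspace T z) \<and> l2_independent n f}"

definition discrete_spectrum :: "l2_operator \<Rightarrow> complex set" where
  "discrete_spectrum T =
     {z. z isolated_in op_spectrum T \<and> 0 < eig_mult T z \<and> eig_mult T z < \<infinity>}"

definition essential_spectrum :: "l2_operator \<Rightarrow> complex set" where
  "essential_spectrum T = op_spectrum T - discrete_spectrum T"

text \<open>
  The spectrum of a self-adjoint operator is real. The bottom of the essential spectrum
  is \<open>\<infinity>\<close> if the essential spectrum is empty.
\<close>

definition ess_bottom :: "l2_operator \<Rightarrow> ereal" where
  "ess_bottom T = Inf {ereal t | t. complex_of_real t \<in> essential_spectrum T}"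

definition low_eigenvalues :: "l2_operator \<Rightarrow> real set" where
  "low_eigenvalues T = {t. 0 < eig_mult T (of_real t) \<and> ereal t < ess_bottom T}"

text \<open>
  For a non-negative self-adjoint \<open>T\<close> and \<open>t\<close> below the bottom of the essential spectrum, only
  finitely many eigenvalues are at most \<open>t\<close>, so that the following sum is a finite one.
\<close>

definition eig_count :: "l2_operator \<Rightarrow> real \<Rightarrow> enat" where
  "eig_count T t = (\<Sum>s \<in> {s \<in> low_eigenvalues T. s \<le> t}. eig_mult T (of_real s))"

text \<open>
  For \<open>k \<ge> 1\<close>, the \<open>k\<close>-th eigenvalue below the essential spectrum, in increasing order and
  counted with multiplicity, is the least one up to which there are at least \<open>k\<close> of them.
\<close>

definition lambda_k :: "nat \<Rightarrow> l2_operator \<Rightarrow> ereal" where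
  "lambda_k k T =
     (if \<exists>t \<in> low_eigenvalues T. enat k \<le> eig_count T t
      then ereal (LEAST t. t \<in> low_eigenvalues T \<and> enat k \<le> eig_count T t)
      else ess_bottom T)"

definition well_ends :: "(real \<Rightarrow> real) \<Rightarrow> real \<Rightarrow> real \<Rightarrow> real \<Rightarrow> bool" where
  "well_ends V h a b \<longleftrightarrow>
     a < 0 \<and> 0 < b \<and> V a = h\<^sup>2 / (b - a)\<^sup>2 \<and> V b = h\<^sup>2 / (b - a)\<^sup>2"

end

theory Submission
  imports Defs
begin

text \<open>
  Write \<open>L = \<delta>\<^sub>+ - \<delta>\<^sub>-\<close> and \<open>E = h\<^sup>2 / L\<^sup>2\<close>, the common value of \<open>V\<close> at the two ends of the well. Since
  \<open>V x / \<bar>x\<bar> ^ n\<close> is monotone on both sides of \<open>0\<close> for every \<open>n\<close>, the potential is at most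
  \<open>(1 - \<eta>) ^ n * E\<close> inside the well shrunk by the factor \<open>1 - \<eta>\<close>, and larger than any prescribed
  multiple of \<open>E\<close> outside the well stretched by the factor \<open>1 + \<eta>\<close>, as soon as \<open>h\<close> is small
  (\<open>V_inside_well\<close>, \<open>V_outside_well\<close>). So, at the energy scale \<open>E\<close>, the operator looks like a
  Dirichlet Laplacian on an interval of length \<open>L\<close>, whose eigenvalues are \<open>\<pi>\<^sup>2 k\<^sup>2 E\<close>.

  Both halves of the comparison are statements on the quadratic form. From above, the half periods
  of a sine on \<open>k\<close> adjacent subintervals of the shrunk well are orthogonal for the scalar product and
  for the form, and each has energy at most \<open>(1 + \<tau>) \<pi>\<^sup>2 k\<^sup>2 E\<close> (\<open>orthogonal_trials_well\<close>). From below,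
  put \<open>j - 1\<close> equidistant nodes into the stretched well. On each subinterval the form is compared with
  a cosine that does not vanish there (Picone's inequality); what the comparison loses at the two
  ends of the well is paid for by the high potential outside, and what it loses at the nodes is a
  multiple of the squared values of the function there. Hence the form is at least
  \<open>(1 - \<tau>) \<pi>\<^sup>2 j\<^sup>2 E\<close> up to \<open>j - 1\<close> squared linear functionals (\<open>form_ge_modulo_well\<close>).

  For small \<open>\<tau>\<close> the upper bound for \<open>k\<close> lies below the lower bound for \<open>k + 1\<close>, and a form squeezed in
  this way has exactly \<open>k\<close> eigenvalues below the latter bound, all of them at most the upper bound and
  not all of them below the lower bound for \<open>k\<close> (\<open>exact_eigen_system\<close>). The eigenvectors are found by
  minimization: the parallelogram identity together with the lower bound modulo finitely many
  functionals makes a subsequence of any minimizing sequence a Cauchy sequence, so that no compact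
  embedding and no weak convergence are involved. On the orthogonal complement of the eigenvectors
  the form is bounded below by the gap, so that the operator minus \<open>z\<close> is invertible there; therefore
  the spectrum to the left of the gap consists of these eigenvalues, isolated and of finite
  multiplicity, and \<open>lambda_k\<close> is the largest of them (\<open>lambda_k_bounds\<close>).

  The Hilbert space argument is carried out over the reals, with a form given as \<open>\<parallel>snd x\<parallel>\<^sup>2\<close> on a closed
  subspace of a product of two Hilbert spaces: the graph of \<open>u \<mapsto> (h u', V\<^sup>1\<^sup>/\<^sup>2 u)\<close>. As the
  Schroedinger operator commutes with complex conjugation, complex functions enter only as pairs of
  real ones.
\<close>

section \<open>Minimization of closed quadratic forms\<close>

text \<open>
  Used three times for counting: to choose a combination of eigenvectors that is annihilated by
  given functionals, a combination of trial vectors that is orthogonal to given eigenvectors, and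
  a vanishing combination of too many eigenfunctions. The induction eliminates one equation
  together with one unknown.
\<close>

lemma underdetermined_system_nontrivial_solution:
  fixes M :: "'i \<Rightarrow> 'j \<Rightarrow> 'a::field"
  assumes "finite J" "finite I" "card J < card I"
  shows "\<exists>c. (\<exists>i\<in>I. c i \<noteq> 0) \<and> (\<forall>j\<in>J. (\<Sum>i\<in>I. c i * M i j) = 0)"
  using assms
proof (induction J arbitrary: I M rule: finite_induct)
  case empty
  then obtain i where "i \<in> I" by fastforce
  then show ?case by (intro exI[of _ "\<lambda>_. 1"]) auto
next
  case (insert j J)
  show ?case
  proof (cases "\<forall>i\<in>I. M i j = 0")
    case True
    have "card J < card I" using insert by simp
    from insert.IH[OF insert.prems(1) this, of M] obtain c where
      "\<exists>i\<in>I. c i \<noteq> 0" "\<forall>j\<in>J. (\<Sum>i\<in>I. c i * M i j) = 0" by blast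
    with True show ?thesis by (intro exI[of _ c]) simp
  next
    case False
    then obtain p where p: "p \<in> I" "M p j \<noteq> 0" by blast
    define N where "N i j' = M i j' - M i j / M p j * M p j'" for i j'
    have "card J < card (I - {p})" using insert p by simp
    from insert.IH[OF _ this, of N] insert.prems(1) obtain c where
      c: "\<exists>i\<in>I - {p}. c i \<noteq> 0" "\<And>j'. j' \<in> J \<Longrightarrow> (\<Sum>i\<in>I - {p}. c i * N i j') = 0" by blast
    define d where "d = c(p := - (\<Sum>i\<in>I - {p}. c i * M i j) / M p j)"
    have split: "(\<Sum>i\<in>I. d i * M i j') = d p * M p j' + (\<Sum>i\<in>I - {p}. c i * M i j')" for j'
      using insert.prems(1) p(1) by (subst sum.remove[of _ p]) (auto simp: d_def)
    have "(\<Sum>i\<in>I. d i * M i j') = 0" if "j' \<in> J" for j'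
    proof -
      have "(\<Sum>i\<in>I - {p}. c i * M i j') - (\<Sum>i\<in>I - {p}. c i * M i j) / M p j * M p j' = 0"
        using c(2)[OF that]
        by (simp add: N_def algebra_simps sum_subtractf sum_distrib_left sum_distrib_right sum_divide_distrib)
      then show ?thesis unfolding split by (simp add: d_def)
    qed
    moreover have "(\<Sum>i\<in>I. d i * M i j) = 0" unfolding split using p by (simp add: d_def)
    moreover have "\<exists>i\<in>I. d i \<noteq> 0" using c(1) by (auto simp: d_def)
    ultimately show ?thesis by blast
  qed
qed

lemma common_convergent_subsequence:
  fixes Y :: "nat \<Rightarrow> nat \<Rightarrow> real"
  assumes "\<And>j. j < m \<Longrightarrow> bounded (range (Y j))"
  shows "\<exists>r::nat \<Rightarrow> nat. strict_mono r \<and> (\<forall>j<m. convergent (\<lambda>n. Y j (r n)))"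
  using assms
proof (induction m)
  case 0
  show ?case by (intro exI[of _ id]) (auto simp: strict_mono_def)
next
  case (Suc m)
  then obtain r where r: "strict_mono (r::nat\<Rightarrow>nat)" "\<And>j. j < m \<Longrightarrow> convergent (\<lambda>n. Y j (r n))" by auto
  have "bounded (range (\<lambda>n. Y m (r n)))"
    by (rule bounded_subset[OF Suc.prems[of m]]) auto
  from bounded_imp_convergent_subsequence[OF this] obtain l r' where
    r': "strict_mono r'" "(\<lambda>n. Y m (r (r' n))) \<longlonglongrightarrow> l" by (auto simp: o_def)
  have "convergent (\<lambda>n. Y j (r (r' n)))" if "j < Suc m" for j
  proof (cases "j = m")
    case True then show ?thesis using r'(2) by (auto simp: convergent_def)
  next
    case False
    then have "convergent ((\<lambda>n. Y j (r n)) \<circ> r')" using that r(2) r'(1)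
      by (intro convergent_subseq_convergent) auto
    then show ?thesis by (simp add: o_def)
  qed
  moreover have "strict_mono (r \<circ> r')" using r(1) r'(1) by (rule strict_mono_o)
  ultimately show ?case by (intro exI[of _ "r \<circ> r'"]) (simp del: o_apply, simp)
qed

text \<open>
  The first order condition at a minimum: inserting a small multiple of \<open>- \<beta>\<close> for \<open>t\<close> would make the
  expression negative.
\<close>

lemma linear_coefficient_zero:
  fixes \<alpha> \<beta> :: real
  assumes "\<And>t. 0 \<le> t\<^sup>2 * \<alpha> + 2 * t * \<beta>"
  shows "\<beta> = 0"
proof (rule ccontr)
  assume "\<beta> \<noteq> 0"
  define d where "d = 1 / (\<bar>\<alpha>\<bar> + 1)"
  have d: "0 < d" "d * \<bar>\<alpha>\<bar> < 1" by (auto simp: d_def field_simps)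
  have "0 \<le> (- d * \<beta>)\<^sup>2 * \<alpha> + 2 * (- d * \<beta>) * \<beta>" by (rule assms)
  also have "\<dots> = d * \<beta>\<^sup>2 * (d * \<alpha> - 2)" by (simp add: power2_eq_square algebra_simps)
  finally have "0 \<le> d * \<beta>\<^sup>2 * (d * \<alpha> - 2)" .
  moreover have "0 < d * \<beta>\<^sup>2" using d \<open>\<beta> \<noteq> 0\<close> by simp
  ultimately have "0 \<le> d * \<alpha> - 2" by (smt (verit) mult_pos_neg)
  moreover have "d * \<alpha> \<le> d * \<bar>\<alpha>\<bar>" using d by (intro mult_left_mono) auto
  ultimately show False using d by linarith
qed

text \<open>
  A bound on the first components and on the form shifted by any real \<open>a\<close> controls the whole norm of
  the graph, hence closedness of the graph provides the limit.
\<close>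

lemma form_Cauchy_convergent:
  fixes S :: "('a::{real_inner,complete_space} \<times> 'b::{real_inner,complete_space}) set"
  assumes S: "closed S" "\<And>n::nat. X n \<in> S"
    and fst: "\<And>\<epsilon>. \<epsilon> > 0 \<Longrightarrow> \<exists>N. \<forall>m\<ge>N. \<forall>n\<ge>N. (norm (fst (X m) - fst (X n)))\<^sup>2 < \<epsilon>"
    and shifted: "\<And>\<epsilon>. \<epsilon> > 0 \<Longrightarrow> \<exists>N. \<forall>m\<ge>N. \<forall>n\<ge>N.
       (norm (snd (X m) - snd (X n)))\<^sup>2 - a * (norm (fst (X m) - fst (X n)))\<^sup>2 < \<epsilon>"
  shows "\<exists>x\<in>S. X \<longlonglongrightarrow> x"
proof -
  have "Cauchy X"
  proof (rule metric_CauchyI)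
    fix e :: real assume "0 < e"
    define \<epsilon> where "\<epsilon> = e\<^sup>2 / (2 * (\<bar>a\<bar> + 1))"
    have \<epsilon>: "\<epsilon> > 0" using \<open>0 < e\<close> by (simp add: \<epsilon>_def)
    obtain N1 where N1: "\<And>m n. m \<ge> N1 \<Longrightarrow> n \<ge> N1 \<Longrightarrow> (norm (fst (X m) - fst (X n)))\<^sup>2 < \<epsilon>"
      using fst[OF \<epsilon>] by blast
    obtain N2 where N2: "\<And>m n. m \<ge> N2 \<Longrightarrow> n \<ge> N2 \<Longrightarrow>
       (norm (snd (X m) - snd (X n)))\<^sup>2 - a * (norm (fst (X m) - fst (X n)))\<^sup>2 < e\<^sup>2 / 2"
      using shifted[of "e\<^sup>2 / 2"] \<open>0 < e\<close> by auto
    show "\<exists>M. \<forall>m\<ge>M. \<forall>n\<ge>M. dist (X m) (X n) < e"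
    proof (intro exI[of _ "max N1 N2"] allI impI)
      fix m n assume "m \<ge> max N1 N2" "n \<ge> max N1 N2"
      then have 1: "(norm (fst (X m) - fst (X n)))\<^sup>2 < \<epsilon>"
        and 2: "(norm (snd (X m) - snd (X n)))\<^sup>2 - a * (norm (fst (X m) - fst (X n)))\<^sup>2 < e\<^sup>2 / 2"
        using N1 N2 by auto
      have "(dist (X m) (X n))\<^sup>2 = (norm (fst (X m) - fst (X n)))\<^sup>2 + (norm (snd (X m) - snd (X n)))\<^sup>2"
        by (simp add: dist_prod_def dist_norm real_sqrt_pow2)
      also have "\<dots> < (\<bar>a\<bar> + 1) * \<epsilon> + e\<^sup>2 / 2"
      proof -
        have "a * (norm (fst (X m) - fst (X n)))\<^sup>2 \<le> \<bar>a\<bar> * (norm (fst (X m) - fst (X n)))\<^sup>2"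
          by (intro mult_right_mono) auto
        also have "\<dots> \<le> \<bar>a\<bar> * \<epsilon>" using 1 by (intro mult_left_mono) auto
        finally show ?thesis using 1 2 by (simp add: algebra_simps)
      qed
      also have "\<dots> = e\<^sup>2" by (simp add: \<epsilon>_def field_simps)
      finally show "dist (X m) (X n) < e" using \<open>0 < e\<close> by (simp add: power_less_imp_less_base)
    qed
  qed
  then obtain x where "X \<longlonglongrightarrow> x" using Cauchy_convergent_iff convergent_def by metis
  with closed_sequentially[OF S(1)] S(2) show ?thesis by blast
qed

lemma quadratic_minimizer_stationary:
  fixes S :: "('a::real_inner \<times> 'b::real_inner) set"
  assumes S: "subspace S" and x: "x \<in> S" and y: "y \<in> S"
    and min: "\<And>z. z \<in> S \<Longrightarrow>
      (norm (snd x))\<^sup>2 - a * (norm (fst x))\<^sup>2 - 2 * (f \<bullet> fst x)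
       \<le> (norm (snd z))\<^sup>2 - a * (norm (fst z))\<^sup>2 - 2 * (f \<bullet> fst z)"
  shows "snd x \<bullet> snd y - a * (fst x \<bullet> fst y) = f \<bullet> fst y"
proof -
  have "snd x \<bullet> snd y - a * (fst x \<bullet> fst y) - f \<bullet> fst y = 0"
  proof (rule linear_coefficient_zero[where \<alpha> = "(norm (snd y))\<^sup>2 - a * (norm (fst y))\<^sup>2"])
    fix t :: real
    have "x + t *\<^sub>R y \<in> S" using S x y by (intro subspace_add subspace_scale)
    from min[OF this] show "0 \<le> t\<^sup>2 * ((norm (snd y))\<^sup>2 - a * (norm (fst y))\<^sup>2) +
         2 * t * (snd x \<bullet> snd y - a * (fst x \<bullet> fst y) - f \<bullet> fst y)"
      unfolding power2_norm_eq_inner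
      by (simp add: inner_add_left inner_add_right inner_commute[of "fst y" "fst x"]
          inner_commute[of "snd y" "snd x"] algebra_simps power2_eq_square)
  qed
  then show ?thesis by simp
qed

lemma parallelogram_half:
  fixes x y :: "'a::real_inner"
  shows "(norm ((1/2) *\<^sub>R (x + y)))\<^sup>2 = (norm x)\<^sup>2 / 2 + (norm y)\<^sup>2 / 2 - (norm (x - y))\<^sup>2 / 4"
  by (simp add: power2_norm_eq_inner inner_add_left inner_add_right inner_diff_left inner_diff_right inner_commute
      field_simps)

text \<open>
  The shape of the parallelogram estimate for a minimizing sequence whose \<open>n\<close>-th member is
  within \<open>1 / Suc n\<close> of the infimum.
\<close>

lemma double_inverse_small:
  assumes "\<And>m n. D m n \<le> 2 / real (Suc m) + 2 / real (Suc n)" "0 < (\<epsilon>::real)"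
  shows "\<exists>N. \<forall>m\<ge>N. \<forall>n\<ge>N. D m n < \<epsilon>"
proof -
  have "(\<lambda>n. 2 * inverse (real (Suc n))) \<longlonglongrightarrow> 2 * 0" by (intro tendsto_intros LIMSEQ_inverse_real_of_nat)
  from order_tendstoD(2)[OF this, of "\<epsilon> / 2"] assms(2)
  obtain N where N: "\<And>n. n \<ge> N \<Longrightarrow> 2 / real (Suc n) < \<epsilon> / 2"
    unfolding eventually_sequentially divide_inverse by auto
  have "D m n < \<epsilon>" if "m \<ge> N" "n \<ge> N" for m n
    using assms(1)[of m n] N[OF that(1)] N[OF that(2)] by linarith
  then show ?thesis by blast
qed

text \<open>
  The weak solution minimizes \<open>\<parallel>snd x\<parallel>\<^sup>2 - a \<parallel>fst x\<parallel>\<^sup>2 - 2 (f \<bullet> fst x)\<close>. Coercivity bounds this functional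
  from below and, through the parallelogram identity, makes minimizing sequences converge.
\<close>

lemma coercive_form_solution:
  fixes S :: "('a::{real_inner,complete_space} \<times> 'b::{real_inner,complete_space}) set"
  assumes S: "subspace S" "closed S"
    and coercive: "\<And>y. y \<in> S \<Longrightarrow> s * (norm (fst y))\<^sup>2 \<le> (norm (snd y))\<^sup>2"
    and a: "a < s"
  shows "\<exists>x\<in>S. \<forall>y\<in>S. snd x \<bullet> snd y - a * (fst x \<bullet> fst y) = f \<bullet> fst y"
proof -
  define Q where "Q x = (norm (snd x))\<^sup>2 - a * (norm (fst x))\<^sup>2" for x :: "'a \<times> 'b"
  define J where "J x = Q x - 2 * (f \<bullet> fst x)" for x
  have Q: "(s - a) * (norm (fst y))\<^sup>2 \<le> Q y" if "y \<in> S" for y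
    using coercive[OF that] by (simp add: Q_def algebra_simps)
  have lower: "- (norm f)\<^sup>2 / (s - a) \<le> J y" if "y \<in> S" for y
  proof -
    have "f \<bullet> fst y \<le> norm f * norm (fst y)" by (rule norm_cauchy_schwarz)
    moreover have "0 \<le> (norm f - (s - a) * norm (fst y))\<^sup>2 / (s - a)" using a by simp
    moreover have "(norm f - (s - a) * norm (fst y))\<^sup>2 / (s - a) =
       (norm f)\<^sup>2 / (s - a) - 2 * (norm f * norm (fst y)) + (s - a) * (norm (fst y))\<^sup>2"
      using a by (simp add: power2_eq_square field_simps)
    ultimately show ?thesis using Q[OF that] unfolding J_def by simp
  qed
  define \<iota> where "\<iota> = Inf (J ` S)"
  have ne: "S \<noteq> {}" using S(1) subspace_0 by auto
  have bdd: "bdd_below (J ` S)" using lower by (intro bdd_belowI2)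
  have \<iota>: "\<iota> \<le> J y" if "y \<in> S" for y unfolding \<iota>_def using that bdd by (simp add: cInf_lower)
  have "\<exists>x\<in>S. J x < \<iota> + 1 / real (Suc n)" for n
    using cInf_lessD[of "J ` S" "\<iota> + 1 / real (Suc n)"] ne by (auto simp: \<iota>_def)
  then obtain X where X: "\<And>n. X n \<in> S" "\<And>n. J (X n) < \<iota> + 1 / real (Suc n)" by metis
  have half: "J ((1/2) *\<^sub>R (x + y)) = J x / 2 + J y / 2 - Q (x - y) / 4" for x y
    unfolding J_def Q_def fst_scaleR snd_scaleR fst_add snd_add parallelogram_half
    by (simp add: inner_add_right algebra_simps add_divide_distrib diff_divide_distrib)
  have diff: "Q (X m - X n) \<le> 2 / real (Suc m) + 2 / real (Suc n)" for m n
  proof -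
    have "(1/2) *\<^sub>R (X m + X n) \<in> S" using S X by (intro subspace_scale subspace_add)
    from \<iota>[OF this] have "\<iota> \<le> J (X m) / 2 + J (X n) / 2 - Q (X m - X n) / 4"
      by (simp only: half)
    then show ?thesis using X(2)[of m] X(2)[of n] by simp
  qed
  have small: "\<exists>N. \<forall>m\<ge>N. \<forall>n\<ge>N. Q (X m - X n) < \<epsilon>" if "\<epsilon> > 0" for \<epsilon>
    using double_inverse_small[of "\<lambda>m n. Q (X m - X n)", OF diff that] .
  have "\<exists>x\<in>S. X \<longlonglongrightarrow> x"
  proof (rule form_Cauchy_convergent[OF S(2) X(1)])
    fix \<epsilon> :: real assume "\<epsilon> > 0"
    show "\<exists>N. \<forall>m\<ge>N. \<forall>n\<ge>N. (norm (snd (X m) - snd (X n)))\<^sup>2 - a * (norm (fst (X m) - fst (X n)))\<^sup>2 < \<epsilon>"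
      using small[OF \<open>\<epsilon> > 0\<close>] by (simp add: Q_def)
    obtain N where N: "\<And>m n. m \<ge> N \<Longrightarrow> n \<ge> N \<Longrightarrow> Q (X m - X n) < (s - a) * \<epsilon>"
      using small[of "(s - a) * \<epsilon>"] \<open>\<epsilon> > 0\<close> a by auto
    have "(norm (fst (X m) - fst (X n)))\<^sup>2 < \<epsilon>" if "m \<ge> N" "n \<ge> N" for m n
    proof -
      have "(s - a) * (norm (fst (X m - X n)))\<^sup>2 < (s - a) * \<epsilon>"
        using N[OF that] Q[of "X m - X n"] S X by (auto simp: subspace_diff)
      then show ?thesis using a by simp
    qed
    then show "\<exists>N. \<forall>m\<ge>N. \<forall>n\<ge>N. (norm (fst (X m) - fst (X n)))\<^sup>2 < \<epsilon>" by blast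
  qed
  then obtain x where x: "x \<in> S" "X \<longlonglongrightarrow> x" by blast
  have "(\<lambda>n. J (X n)) \<longlonglongrightarrow> J x" unfolding J_def Q_def by (intro tendsto_intros x)
  moreover have "(\<lambda>n. \<iota> + 1 / real (Suc n)) \<longlonglongrightarrow> \<iota> + 0"
    using LIMSEQ_inverse_real_of_nat by (intro tendsto_intros) (simp add: divide_inverse)
  ultimately have "J x \<le> \<iota> + 0" using X(2) by (intro LIMSEQ_le) (auto intro: less_imp_le)
  then have min: "J x \<le> J y" if "y \<in> S" for y using \<iota>[OF that] by simp
  show ?thesis
    using quadratic_minimizer_stationary[OF S(1) x(1), of _ a f] min x(1) unfolding J_def Q_def by blast
qed

text \<open>
  Let \<open>\<mu> < s\<close> be the infimum of the form on the unit sphere. The form minus \<open>\<mu>\<close> is nonnegative on \<open>S\<close>, so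
  by the parallelogram identity it is small on differences of a minimizing sequence. After
  passing to a subsequence the functionals are small on these differences as well, and then the
  gap inequality leaves only \<open>(s - \<mu>) \<parallel>fst v\<parallel>\<^sup>2\<close> small for a difference \<open>v\<close>: the sequence converges and
  the infimum is attained.
\<close>

lemma eigenvector_below_gap:
  fixes S :: "('a::{real_inner,complete_space} \<times> 'b::{real_inner,complete_space}) set"
    and l :: "nat \<Rightarrow> 'a \<times> 'b \<Rightarrow> real"
  assumes S: "subspace S" "closed S"
    and lin: "\<And>j. j < m \<Longrightarrow> bounded_linear (l j)"
    and gap: "\<And>y. y \<in> S \<Longrightarrow> s * (norm (fst y))\<^sup>2 \<le> (norm (snd y))\<^sup>2 + C * (\<Sum>j<m. (l j y)\<^sup>2)"
    and y0: "y0 \<in> S" "(norm (snd y0))\<^sup>2 < s * (norm (fst y0))\<^sup>2"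
  shows "\<exists>x\<in>S. \<exists>t<s. norm (fst x) = 1 \<and> (\<forall>y\<in>S. snd x \<bullet> snd y = t * (fst x \<bullet> fst y))"
proof -
  define T where "T = {y \<in> S. norm (fst y) = 1}"
  define \<mu> where "\<mu> = Inf ((\<lambda>y. (norm (snd y))\<^sup>2) ` T)"
  have bdd: "bdd_below ((\<lambda>y. (norm (snd y))\<^sup>2) ` T)" by (intro bdd_belowI2[of _ 0]) auto
  have y0n: "norm (fst y0) > 0"
  proof (rule ccontr)
    assume "\<not> norm (fst y0) > 0"
    then have "norm (fst y0) = 0" using norm_ge_zero[of "fst y0"] by linarith
    with y0(2) show False by (auto simp: not_less)
  qed
  define y1 where "y1 = (1 / norm (fst y0)) *\<^sub>R y0"
  have y1: "y1 \<in> T" "(norm (snd y1))\<^sup>2 < s"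
    using y0 y0n S by (auto simp: y1_def T_def subspace_scale power_divide field_simps)
  have "\<mu> \<le> (norm (snd y1))\<^sup>2" unfolding \<mu>_def using y1(1) bdd by (intro cInf_lower) auto
  then have \<mu>s: "\<mu> < s" using y1(2) by simp
  define Q where "Q x = (norm (snd x))\<^sup>2 - \<mu> * (norm (fst x))\<^sup>2" for x :: "'a \<times> 'b"
  have Qpos: "0 \<le> Q y" if "y \<in> S" for y
  proof (cases "fst y = 0")
    case True then show ?thesis by (simp add: Q_def)
  next
    case False
    then have "(1 / norm (fst y)) *\<^sub>R y \<in> T" using that S by (auto simp: T_def subspace_scale)
    then have "\<mu> \<le> (norm (snd ((1 / norm (fst y)) *\<^sub>R y)))\<^sup>2"
      unfolding \<mu>_def using bdd by (intro cInf_lower imageI)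
    also have "\<dots> = (norm (snd y))\<^sup>2 / (norm (fst y))\<^sup>2" by (simp add: power_divide)
    finally show ?thesis using False by (simp add: Q_def field_simps)
  qed
  have "\<exists>x\<in>T. (norm (snd x))\<^sup>2 < \<mu> + 1 / real (Suc n)" for n
    using cInf_lessD[of "(\<lambda>y. (norm (snd y))\<^sup>2) ` T" "\<mu> + 1 / real (Suc n)"] y1(1) by (auto simp: \<mu>_def)
  then obtain Z where Z: "\<And>n. Z n \<in> T" "\<And>n. (norm (snd (Z n)))\<^sup>2 < \<mu> + 1 / real (Suc n)" by metis
  have Znorm: "norm (Z n) \<le> sqrt (\<mu> + 2)" for n
  proof -
    have "(norm (Z n))\<^sup>2 = (norm (fst (Z n)))\<^sup>2 + (norm (snd (Z n)))\<^sup>2"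
      by (simp add: norm_prod_def)
    also have "\<dots> \<le> \<mu> + 2"
    proof -
      have "1 / real (Suc n) \<le> 1" by simp
      moreover have "norm (fst (Z n)) = 1" using Z(1)[of n] by (simp add: T_def)
      moreover have "(norm (snd (Z n)))\<^sup>2 < \<mu> + 1 / real (Suc n)" by (rule Z)
      ultimately have "(norm (snd (Z n)))\<^sup>2 \<le> \<mu> + 1" by linarith
      with \<open>norm (fst (Z n)) = 1\<close> show ?thesis by simp
    qed
    finally show ?thesis by (rule real_le_rsqrt)
  qed
  have bl: "bounded (range (\<lambda>n. l j (Z n)))" if j: "j < m" for j
  proof -
    obtain K where K: "\<And>x. norm (l j x) \<le> norm x * K" "0 \<le> K"
      using bounded_linear.nonneg_bounded[OF lin[OF j]] by blast
    have "norm (l j (Z n)) \<le> sqrt (\<mu> + 2) * K" for n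
      using K(1)[of "Z n"] mult_right_mono[OF Znorm[of n] K(2)] by linarith
    then show ?thesis by (auto simp: bounded_iff)
  qed
  have "\<exists>r::nat \<Rightarrow> nat. strict_mono r \<and> (\<forall>j<m. convergent (\<lambda>n. l j (Z (r n))))"
    by (rule common_convergent_subsequence) (rule bl)
  then obtain r where r: "strict_mono (r::nat\<Rightarrow>nat)" "\<And>j. j < m \<Longrightarrow> convergent (\<lambda>n. l j (Z (r n)))" by blast
  define X where "X n = Z (r n)" for n
  have X: "X n \<in> S" "norm (fst (X n)) = 1" for n using Z(1)[of "r n"] by (auto simp: X_def T_def)
  have QX: "Q (X n) < 1 / real (Suc n)" for n
  proof -
    have "1 / real (Suc (r n)) \<le> 1 / real (Suc n)" using seq_suble[OF r(1), of n] by (simp add: frac_le)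
    then show ?thesis using Z(2)[of "r n"] X(2)[of n] by (simp add: Q_def X_def)
  qed
  have diff: "Q (X i - X k) \<le> 2 / real (Suc i) + 2 / real (Suc k)" for i k
  proof -
    have "Q (X i - X k) = 2 * Q (X i) + 2 * Q (X k) - Q (X i + X k)"
      by (simp add: Q_def power2_norm_eq_inner inner_add_left inner_add_right inner_diff_left
          inner_diff_right inner_commute algebra_simps)
    moreover have "0 \<le> Q (X i + X k)" using X S by (intro Qpos subspace_add)
    ultimately show ?thesis using QX[of i] QX[of k] by simp
  qed
  have small: "\<exists>N. \<forall>m\<ge>N. \<forall>n\<ge>N. Q (X m - X n) < \<epsilon>" if "\<epsilon> > 0" for \<epsilon>
    using double_inverse_small[of "\<lambda>m n. Q (X m - X n)", OF diff that] .
  have functionals: "\<exists>N. \<forall>i\<ge>N. \<forall>k\<ge>N. C * (\<Sum>j<m. (l j (X i - X k))\<^sup>2) < \<epsilon>" if "\<epsilon> > 0" for \<epsilon>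
  proof -
    have conv: "((\<lambda>p. l j (X (fst p) - X (snd p))) \<longlongrightarrow> 0) (sequentially \<times>\<^sub>F sequentially)" if j: "j < m" for j
    proof -
      obtain L where "(\<lambda>n. l j (X n)) \<longlonglongrightarrow> L" using r(2)[OF j] by (auto simp: convergent_def X_def)
      then have "((\<lambda>p. l j (X (fst p)) - l j (X (snd p))) \<longlongrightarrow> L - L) (sequentially \<times>\<^sub>F sequentially)"
        by (intro tendsto_diff filterlim_compose[OF _ filterlim_fst] filterlim_compose[OF _ filterlim_snd])
      then show ?thesis using lin[OF j] by (simp add: linear_diff bounded_linear.linear)
    qed
    have "((\<lambda>p. C * (\<Sum>j<m. (l j (X (fst p) - X (snd p)))\<^sup>2)) \<longlongrightarrow> C * (\<Sum>j<m. 0\<^sup>2)) (sequentially \<times>\<^sub>F sequentially)"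
      by (intro tendsto_intros conv) simp
    then have "\<forall>\<^sub>F p in sequentially \<times>\<^sub>F sequentially. C * (\<Sum>j<m. (l j (X (fst p) - X (snd p)))\<^sup>2) < \<epsilon>"
      using that by (intro order_tendstoD(2)) auto
    then show ?thesis unfolding eventually_prod_sequentially by (simp, blast)
  qed
  have "\<exists>x\<in>S. X \<longlonglongrightarrow> x"
  proof (rule form_Cauchy_convergent[OF S(2) X(1)])
    fix \<epsilon> :: real assume "\<epsilon> > 0"
    show "\<exists>N. \<forall>m\<ge>N. \<forall>n\<ge>N. (norm (snd (X m) - snd (X n)))\<^sup>2 - \<mu> * (norm (fst (X m) - fst (X n)))\<^sup>2 < \<epsilon>"
      using small[OF \<open>\<epsilon> > 0\<close>] by (simp add: Q_def)
    define \<eta> where "\<eta> = (s - \<mu>) * \<epsilon> / 2"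
    have \<eta>: "\<eta> > 0" using \<open>\<epsilon> > 0\<close> \<mu>s by (simp add: \<eta>_def)
    obtain N where N: "\<And>m n. m \<ge> N \<Longrightarrow> n \<ge> N \<Longrightarrow> Q (X m - X n) < \<eta>"
      using small[OF \<eta>] by auto
    obtain N' where N': "\<And>i k. i \<ge> N' \<Longrightarrow> k \<ge> N' \<Longrightarrow> C * (\<Sum>j<m. (l j (X i - X k))\<^sup>2) < \<eta>"
      using functionals[OF \<eta>] by auto
    have "(norm (fst (X i) - fst (X k)))\<^sup>2 < \<epsilon>" if "i \<ge> max N N'" "k \<ge> max N N'" for i k
    proof -
      have "s * (norm (fst (X i - X k)))\<^sup>2 \<le> (norm (snd (X i - X k)))\<^sup>2 + C * (\<Sum>j<m. (l j (X i - X k))\<^sup>2)"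
        using S X by (intro gap subspace_diff)
      then have "(s - \<mu>) * (norm (fst (X i - X k)))\<^sup>2 \<le> Q (X i - X k) + C * (\<Sum>j<m. (l j (X i - X k))\<^sup>2)"
        by (simp add: Q_def algebra_simps)
      also have "\<dots> < (s - \<mu>) * \<epsilon>" using N[of i k] N'[of i k] that by (simp add: \<eta>_def)
      finally show ?thesis using \<mu>s by simp
    qed
    then show "\<exists>N. \<forall>m\<ge>N. \<forall>n\<ge>N. (norm (fst (X m) - fst (X n)))\<^sup>2 < \<epsilon>" by blast
  qed
  then obtain x where x: "x \<in> S" "X \<longlonglongrightarrow> x" by blast
  have "(\<lambda>n. Q (X n)) \<longlonglongrightarrow> Q x" unfolding Q_def by (intro tendsto_intros x)
  moreover have "(\<lambda>n. 1 / real (Suc n)) \<longlonglongrightarrow> 0"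
    using LIMSEQ_inverse_real_of_nat by (simp add: divide_inverse)
  ultimately have Qx: "Q x \<le> 0" using QX by (intro LIMSEQ_le) (auto intro: less_imp_le)
  have "(\<lambda>n. norm (fst (X n))) \<longlonglongrightarrow> norm (fst x)" by (intro tendsto_intros x)
  then have nx: "norm (fst x) = 1" using X(2) by (simp add: LIMSEQ_const_iff)
  have "snd x \<bullet> snd y - \<mu> * (fst x \<bullet> fst y) = 0 \<bullet> fst y" if "y \<in> S" for y
    by (rule quadratic_minimizer_stationary[OF S(1) x(1) that]) (use Qx Qpos in \<open>force simp: Q_def\<close>)
  then show ?thesis using x(1) nx \<mu>s by (intro bexI[of _ x] exI[of _ \<mu>]) auto
qed

section \<open>Eigenvalues below a spectral gap\<close>

definition eigenpair :: "('a::real_inner \<times> 'b::real_inner) set \<Rightarrow> real \<Rightarrow> 'a \<times> 'b \<Rightarrow> bool" where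
  "eigenpair G t x \<longleftrightarrow> x \<in> G \<and> (\<forall>y\<in>G. snd x \<bullet> snd y = t * (fst x \<bullet> fst y))"

definition eigen_system ::
  "('a::real_inner \<times> 'b::real_inner) set \<Rightarrow> nat \<Rightarrow> (nat \<Rightarrow> 'a \<times> 'b) \<Rightarrow> (nat \<Rightarrow> real) \<Rightarrow> bool" where
  "eigen_system G n e lam \<longleftrightarrow> (\<forall>i<n. eigenpair G (lam i) (e i)) \<and>
     (\<forall>i<n. \<forall>j<n. fst (e i) \<bullet> fst (e j) = (if i = j then 1 else 0))"

definition eigen_complement ::
  "('a::real_inner \<times> 'b::real_inner) set \<Rightarrow> nat \<Rightarrow> (nat \<Rightarrow> 'a \<times> 'b) \<Rightarrow> ('a \<times> 'b) set" where
  "eigen_complement G n e = {y \<in> G. \<forall>i<n. fst y \<bullet> fst (e i) = 0}"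

definition form_ge_on :: "('a::real_inner \<times> 'b::real_inner) set \<Rightarrow> real \<Rightarrow> bool" where
  "form_ge_on S s \<longleftrightarrow> (\<forall>y\<in>S. s * (norm (fst y))\<^sup>2 \<le> (norm (snd y))\<^sup>2)"

text \<open>
  A quantitative form of being bounded below by \<open>s\<close> on a subspace of codimension at most \<open>m\<close>, the
  common kernel of the functionals. Unlike the latter it applies to vectors which are only nearly
  in the kernel, as the differences in a minimizing sequence are.
\<close>

definition form_ge_modulo :: "('a::real_inner \<times> 'b::real_inner) set \<Rightarrow> real \<Rightarrow> nat \<Rightarrow> bool" where
  "form_ge_modulo S s m \<longleftrightarrow> (\<exists>C l. (\<forall>j<m. bounded_linear (l j)) \<and>
     (\<forall>y\<in>S. s * (norm (fst y))\<^sup>2 \<le> (norm (snd y))\<^sup>2 + C * (\<Sum>j<m. (l j y :: real)\<^sup>2)))"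

text \<open>
  Orthogonality for the scalar product and for the form makes the bound on the single vectors pass
  to their span.
\<close>

definition orthogonal_trials :: "('a::real_inner \<times> 'b::real_inner) set \<Rightarrow> real \<Rightarrow> nat \<Rightarrow> bool" where
  "orthogonal_trials S T k \<longleftrightarrow> (\<exists>y. (\<forall>j<k. y j \<in> S \<and> fst (y j) \<noteq> 0 \<and>
       (norm (snd (y j)))\<^sup>2 \<le> T * (norm (fst (y j)))\<^sup>2) \<and>
     (\<forall>i<k. \<forall>j<k. i \<noteq> j \<longrightarrow> fst (y i) \<bullet> fst (y j) = 0 \<and> snd (y i) \<bullet> snd (y j) = 0))"

lemma orthogonal_trials_mono:
  assumes "orthogonal_trials S T k" "T \<le> T'" shows "orthogonal_trials S T' k"
proof -
  have "x \<le> T' * (norm y)\<^sup>2" if "x \<le> T * (norm y)\<^sup>2" for x and y :: 'a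
    using that mult_right_mono[OF assms(2), of "(norm y)\<^sup>2"] by simp
  then show ?thesis using assms(1) unfolding orthogonal_trials_def by blast
qed

lemma eigen_systemD:
  assumes "eigen_system G n e lam" "i < n"
  shows "e i \<in> G" "\<And>y. y \<in> G \<Longrightarrow> snd (e i) \<bullet> snd y = lam i * (fst (e i) \<bullet> fst y)"
    "\<And>j. j < n \<Longrightarrow> fst (e i) \<bullet> fst (e j) = (if i = j then 1 else 0)"
  using assms by (auto simp: eigen_system_def eigenpair_def)

lemma norm_sq_sum_orthogonal:
  fixes v :: "nat \<Rightarrow> 'a::real_inner"
  assumes "finite I" "\<And>i j. i \<in> I \<Longrightarrow> j \<in> I \<Longrightarrow> i \<noteq> j \<Longrightarrow> v i \<bullet> v j = 0"
  shows "(norm (\<Sum>i\<in>I. c i *\<^sub>R v i))\<^sup>2 = (\<Sum>i\<in>I. (c i)\<^sup>2 * (norm (v i))\<^sup>2)"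
proof -
  have "(norm (\<Sum>i\<in>I. c i *\<^sub>R v i))\<^sup>2 = (\<Sum>i\<in>I. \<Sum>j\<in>I. c i * c j * (v i \<bullet> v j))"
    by (simp add: power2_norm_eq_inner inner_sum_left inner_sum_right sum_distrib_left mult.assoc)
       (simp add: inner_commute)
  also have "\<dots> = (\<Sum>i\<in>I. \<Sum>j\<in>I. if j = i then (c i)\<^sup>2 * (norm (v i))\<^sup>2 else 0)"
    using assms(2) by (intro sum.cong refl) (auto simp: power2_norm_eq_inner power2_eq_square[of "c _"])
  also have "\<dots> = (\<Sum>i\<in>I. (c i)\<^sup>2 * (norm (v i))\<^sup>2)" using assms(1) by simp
  finally show ?thesis .
qed

lemma eigen_system_combination:
  fixes c :: "nat \<Rightarrow> real"
  assumes G: "subspace G" and sys: "eigen_system G n e lam" and I: "I \<subseteq> {..<n}"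
  defines "y \<equiv> (\<Sum>i\<in>I. c i *\<^sub>R e i)"
  shows "y \<in> G" "\<And>j. j < n \<Longrightarrow> fst y \<bullet> fst (e j) = (if j \<in> I then c j else 0)"
    "\<And>z. z \<in> G \<Longrightarrow> snd y \<bullet> snd z = (\<Sum>i\<in>I. c i * lam i * (fst (e i) \<bullet> fst z))"
    "(norm (fst y))\<^sup>2 = (\<Sum>i\<in>I. (c i)\<^sup>2)" "(norm (snd y))\<^sup>2 = (\<Sum>i\<in>I. (c i)\<^sup>2 * lam i)"
proof -
  have fin: "finite I" using I finite_subset by blast
  have lt: "i < n" if "i \<in> I" for i using I that by auto
  note eD = eigen_systemD[OF sys]
  show yG: "y \<in> G" unfolding y_def using G lt eD(1) by (intro subspace_sum subspace_scale) auto
  show fy: "fst y \<bullet> fst (e j) = (if j \<in> I then c j else 0)" if "j < n" for j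
  proof -
    have "fst y \<bullet> fst (e j) = (\<Sum>i\<in>I. if i = j then c i else 0)"
      unfolding y_def fst_sum inner_sum_left
      using eD(3)[OF lt that] by (intro sum.cong refl) auto
    then show ?thesis using fin by simp
  qed
  show sy: "snd y \<bullet> snd z = (\<Sum>i\<in>I. c i * lam i * (fst (e i) \<bullet> fst z))" if "z \<in> G" for z
    unfolding y_def snd_sum inner_sum_left
    using eD(2)[OF lt that] by (intro sum.cong refl) auto
  have "(norm (fst y))\<^sup>2 = (\<Sum>i\<in>I. c i * (fst (e i) \<bullet> fst y))"
    unfolding power2_norm_eq_inner by (subst y_def) (simp add: fst_sum inner_sum_left)
  also have "\<dots> = (\<Sum>i\<in>I. (c i)\<^sup>2)"
    using fy lt by (intro sum.cong refl) (auto simp: inner_commute power2_eq_square)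
  finally show "(norm (fst y))\<^sup>2 = (\<Sum>i\<in>I. (c i)\<^sup>2)" .
  have "(norm (snd y))\<^sup>2 = (\<Sum>i\<in>I. c i * lam i * (fst (e i) \<bullet> fst y))"
    unfolding power2_norm_eq_inner by (rule sy[OF yG])
  also have "\<dots> = (\<Sum>i\<in>I. (c i)\<^sup>2 * lam i)"
    using fy lt by (intro sum.cong refl) (auto simp: inner_commute power2_eq_square)
  finally show "(norm (snd y))\<^sup>2 = (\<Sum>i\<in>I. (c i)\<^sup>2 * lam i)" .
qed

lemma eigen_complement_closed_subspace:
  fixes G :: "('a::real_inner \<times> 'b::real_inner) set"
  assumes "subspace G" "closed G"
  shows "subspace (eigen_complement G n e)" "closed (eigen_complement G n e)"
proof -
  show "subspace (eigen_complement G n e)"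
    using assms(1) unfolding subspace_def eigen_complement_def by (auto simp: inner_add_left)
  have "eigen_complement G n e = G \<inter> (\<Inter>i\<in>{..<n}. {y. fst y \<bullet> fst (e i) = 0})"
    by (auto simp: eigen_complement_def)
  also have "closed \<dots>"
    by (intro closed_Int assms closed_INT ballI closed_Collect_eq continuous_intros)
  finally show "closed (eigen_complement G n e)" .
qed

lemma eigen_decomposition:
  assumes G: "subspace G" and sys: "eigen_system G n e lam" and y: "y \<in> G"
  defines "p \<equiv> \<lambda>i. fst y \<bullet> fst (e i)"
  defines "y' \<equiv> y - (\<Sum>i<n. p i *\<^sub>R e i)"
  shows "y' \<in> eigen_complement G n e" "y = (\<Sum>i<n. p i *\<^sub>R e i) + y'"
    "(norm (fst y))\<^sup>2 = (\<Sum>i<n. (p i)\<^sup>2) + (norm (fst y'))\<^sup>2"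
    "(norm (snd y))\<^sup>2 = (\<Sum>i<n. (p i)\<^sup>2 * lam i) + (norm (snd y'))\<^sup>2"
proof -
  define w where "w = (\<Sum>i<n. p i *\<^sub>R e i)"
  note W = eigen_system_combination[OF G sys order_refl, where c = p, folded w_def]
  show y': "y' \<in> eigen_complement G n e"
    using W(1,2) y G unfolding y'_def eigen_complement_def w_def[symmetric]
    by (auto simp: subspace_diff inner_diff_left p_def)
  then have y'G: "y' \<in> G" and orth: "\<And>i. i < n \<Longrightarrow> fst (e i) \<bullet> fst y' = 0"
    by (auto simp: eigen_complement_def inner_commute)
  show yy: "y = (\<Sum>i<n. p i *\<^sub>R e i) + y'" by (simp add: y'_def)
  have y_eq: "y = w + y'" using yy by (simp add: w_def)
  have "fst w \<bullet> fst y' = 0" unfolding w_def fst_sum inner_sum_left using orth by simp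
  then show "(norm (fst y))\<^sup>2 = (\<Sum>i<n. (p i)\<^sup>2) + (norm (fst y'))\<^sup>2"
    unfolding W(4)[symmetric] by (subst y_eq) (simp add: power2_norm_eq_inner inner_add_left inner_add_right inner_commute)
  have "snd w \<bullet> snd y' = 0" using W(3)[OF y'G] orth by simp
  then show "(norm (snd y))\<^sup>2 = (\<Sum>i<n. (p i)\<^sup>2 * lam i) + (norm (snd y'))\<^sup>2"
    unfolding W(5)[symmetric] by (subst y_eq) (simp add: power2_norm_eq_inner inner_add_left inner_add_right inner_commute)
qed

text \<open>
  Some nontrivial combination of \<open>m + 1\<close> eigenvectors is annihilated by the \<open>m\<close> functionals; its form
  would lie both above and below \<open>s\<close> times its squared norm.
\<close>

lemma card_eigenvalues_below_le:
  assumes G: "subspace G" and sys: "eigen_system G n e lam" and ge: "form_ge_modulo G s m"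
  shows "card {i. i < n \<and> lam i < s} \<le> m"
proof (rule ccontr)
  define I where "I = {i. i < n \<and> lam i < s}"
  assume "\<not> card {i. i < n \<and> lam i < s} \<le> m"
  then have card: "card {..<m} < card I" by (simp add: I_def)
  have I: "I \<subseteq> {..<n}" "finite I" by (auto simp: I_def)
  obtain C l where lin: "\<And>j. j < m \<Longrightarrow> bounded_linear (l j)"
    and ge: "\<And>y. y \<in> G \<Longrightarrow> s * (norm (fst y))\<^sup>2 \<le> (norm (snd y))\<^sup>2 + C * (\<Sum>j<m. (l j y :: real)\<^sup>2)"
    using ge unfolding form_ge_modulo_def by blast
  obtain c where c: "\<exists>i\<in>I. c i \<noteq> 0" "\<And>j. j < m \<Longrightarrow> (\<Sum>i\<in>I. c i * l j (e i)) = 0"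
    using underdetermined_system_nontrivial_solution[OF _ I(2) card, of "\<lambda>i j. l j (e i)"] by auto
  define y where "y = (\<Sum>i\<in>I. c i *\<^sub>R e i)"
  note Y = eigen_system_combination[OF G sys I(1), where c = c, folded y_def]
  have "l j y = 0" if "j < m" for j
    using c(2)[OF that] lin[OF that] unfolding y_def
    by (simp add: linear_sum bounded_linear.linear linear_cmul)
  then have "s * (\<Sum>i\<in>I. (c i)\<^sup>2) \<le> (\<Sum>i\<in>I. (c i)\<^sup>2 * lam i)"
    using ge[OF Y(1)] Y(4,5) by simp
  moreover have "(\<Sum>i\<in>I. (c i)\<^sup>2 * lam i) < (\<Sum>i\<in>I. (c i)\<^sup>2 * s)"
  proof (rule sum_strict_mono_ex1[OF I(2)])
    show "\<forall>i\<in>I. (c i)\<^sup>2 * lam i \<le> (c i)\<^sup>2 * s" by (auto simp: I_def intro!: mult_left_mono)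
    show "\<exists>i\<in>I. (c i)\<^sup>2 * lam i < (c i)\<^sup>2 * s" using c(1) by (auto simp: I_def)
  qed
  ultimately show False by (simp add: sum_distrib_left mult.commute)
qed

text \<open>
  The size of an orthonormal system of eigenvectors below \<open>s\<close> is bounded, and a system that leaves
  the form below \<open>s\<close> somewhere on its complement can be enlarged by a minimizer over the
  complement. Such a minimizer is an eigenvector of the whole form because eigenvectors are
  orthogonal to the complement also for the form.
\<close>

lemma exists_maximal_eigen_system:
  fixes G :: "('a::{real_inner,complete_space} \<times> 'b::{real_inner,complete_space}) set"
  assumes G: "subspace G" "closed G" and ge: "form_ge_modulo G s m"
  shows "\<exists>n\<le>m. \<exists>e lam. eigen_system G n e lam \<and> (\<forall>i<n. lam i < s) \<and>
           form_ge_on (eigen_complement G n e) s"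
proof -
  define P where "P n \<longleftrightarrow> (\<exists>e lam. eigen_system G n e lam \<and> (\<forall>i<n. lam i < s))" for n
  have bound: "n \<le> m" if Pn: "P n" for n
  proof -
    obtain e lam where sys: "eigen_system G n e lam" "\<forall>i<n. lam i < s" using Pn unfolding P_def by blast
    then have "{i. i < n \<and> lam i < s} = {..<n}" by auto
    then show ?thesis using card_eigenvalues_below_le[OF G(1) sys(1) ge] by simp
  qed
  have P0: "P 0" by (auto simp: P_def eigen_system_def)
  define n where "n = (GREATEST n. P n)"
  have n: "P n" "\<And>k. P k \<Longrightarrow> k \<le> n"
    unfolding n_def using GreatestI_nat[of P 0 m] Greatest_le_nat[of P _ m] P0 bound by auto
  obtain e lam where sys: "eigen_system G n e lam" "\<forall>i<n. lam i < s" using n(1) unfolding P_def by blast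
  have "form_ge_on (eigen_complement G n e) s"
  proof (rule ccontr)
    define S where "S = eigen_complement G n e"
    note S = eigen_complement_closed_subspace[OF G, of n e, folded S_def]
    assume "\<not> form_ge_on (eigen_complement G n e) s"
    then obtain y0 where y0: "y0 \<in> S" "(norm (snd y0))\<^sup>2 < s * (norm (fst y0))\<^sup>2"
      by (auto simp: form_ge_on_def S_def not_le)
    obtain C l where lin: "\<And>j. j < m \<Longrightarrow> bounded_linear (l j)"
      and gap: "\<And>y. y \<in> G \<Longrightarrow> s * (norm (fst y))\<^sup>2 \<le> (norm (snd y))\<^sup>2 + C * (\<Sum>j<m. (l j y :: real)\<^sup>2)"
      using ge unfolding form_ge_modulo_def by blast
    have SG: "S \<subseteq> G" by (auto simp: S_def eigen_complement_def)
    have "\<exists>x\<in>S. \<exists>t<s. norm (fst x) = 1 \<and> (\<forall>y\<in>S. snd x \<bullet> snd y = t * (fst x \<bullet> fst y))"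
      by (rule eigenvector_below_gap[where l = l and m = m and C = C and ?y0.0 = y0])
        (use S lin gap SG y0 in auto)
    then obtain x t where x: "x \<in> S" "t < s" "norm (fst x) = 1"
      "\<And>y. y \<in> S \<Longrightarrow> snd x \<bullet> snd y = t * (fst x \<bullet> fst y)" by blast
    have xG: "x \<in> G" and orth: "\<And>i. i < n \<Longrightarrow> fst x \<bullet> fst (e i) = 0"
      using x(1) by (auto simp: S_def eigen_complement_def)
    have "snd x \<bullet> snd y = t * (fst x \<bullet> fst y)" if y: "y \<in> G" for y
    proof -
      define p where "p i = fst y \<bullet> fst (e i)" for i
      define y' where "y' = y - (\<Sum>i<n. p i *\<^sub>R e i)"
      have y': "y' \<in> S" "y = (\<Sum>i<n. p i *\<^sub>R e i) + y'"
        using eigen_decomposition(1,2)[OF G(1) sys(1) y] by (auto simp: y'_def p_def S_def)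
      have "snd x \<bullet> snd (e i) = 0" "fst x \<bullet> fst (e i) = 0" if "i < n" for i
        using eigen_systemD(2)[OF sys(1) that xG] orth[OF that] by (simp_all add: inner_commute)
      then show ?thesis using x(4)[OF y'(1)]
        by (subst (1 2) y'(2)) (simp add: inner_add_right snd_sum fst_sum inner_sum_right)
    qed
    then have ep: "eigenpair G t x" using xG by (simp add: eigenpair_def)
    have "eigen_system G (Suc n) (e(n := x)) (lam(n := t))"
      using sys(1) ep orth x(3) unfolding eigen_system_def
      by (auto simp: less_Suc_eq inner_commute norm_eq_1)
    moreover have "\<forall>i<Suc n. (lam(n := t)) i < s" using sys(2) x(2) by (auto simp: less_Suc_eq)
    ultimately have "P (Suc n)" unfolding P_def by blast
    from n(2)[OF this] show False by simp
  qed
  then show ?thesis using sys bound[OF n(1)] by blast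
qed

text \<open>
  With fewer than \<open>k\<close> eigenvalues up to \<open>T\<close> there would be a nonzero trial combination orthogonal to
  their eigenvectors. Its expansion then involves only eigenvalues above \<open>T\<close> and the complement,
  where the form exceeds \<open>T\<close> as well.
\<close>

lemma card_eigenvalues_ge_trials:
  assumes G: "subspace G" and sys: "eigen_system G n e lam"
    and ge: "form_ge_on (eigen_complement G n e) s" and T: "T < s"
    and trials: "orthogonal_trials G T k"
  shows "k \<le> card {i. i < n \<and> lam i \<le> T}"
proof (rule ccontr)
  define I where "I = {i. i < n \<and> lam i \<le> T}"
  have fin: "finite I" by (auto simp: I_def)
  assume "\<not> k \<le> card {i. i < n \<and> lam i \<le> T}"
  then have card: "card I < card {..<k}" by (simp add: I_def)
  obtain y where y: "\<And>j. j < k \<Longrightarrow> y j \<in> G" "\<And>j. j < k \<Longrightarrow> fst (y j) \<noteq> 0"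
      "\<And>j. j < k \<Longrightarrow> (norm (snd (y j)))\<^sup>2 \<le> T * (norm (fst (y j)))\<^sup>2"
    and orth: "\<And>i j. i < k \<Longrightarrow> j < k \<Longrightarrow> i \<noteq> j \<Longrightarrow> fst (y i) \<bullet> fst (y j) = 0"
      "\<And>i j. i < k \<Longrightarrow> j < k \<Longrightarrow> i \<noteq> j \<Longrightarrow> snd (y i) \<bullet> snd (y j) = 0"
    using trials unfolding orthogonal_trials_def by blast
  obtain c where c: "\<exists>j\<in>{..<k}. c j \<noteq> 0" "\<And>i. i \<in> I \<Longrightarrow> (\<Sum>j<k. c j * (fst (y j) \<bullet> fst (e i))) = 0"
    using underdetermined_system_nontrivial_solution[OF fin _ card, of "\<lambda>j i. fst (y j) \<bullet> fst (e i)"] by auto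
  define z where "z = (\<Sum>j<k. c j *\<^sub>R y j)"
  have zG: "z \<in> G" unfolding z_def using G y(1) by (intro subspace_sum subspace_scale) auto
  have zI: "fst z \<bullet> fst (e i) = 0" if "i \<in> I" for i
    using c(2)[OF that] by (simp add: z_def fst_sum inner_sum_left)
  have zf: "(norm (fst z))\<^sup>2 = (\<Sum>j<k. (c j)\<^sup>2 * (norm (fst (y j)))\<^sup>2)"
    unfolding z_def fst_sum fst_scaleR using orth by (intro norm_sq_sum_orthogonal) auto
  have zs: "(norm (snd z))\<^sup>2 = (\<Sum>j<k. (c j)\<^sup>2 * (norm (snd (y j)))\<^sup>2)"
    unfolding z_def snd_sum snd_scaleR using orth by (intro norm_sq_sum_orthogonal) auto
  have up: "(norm (snd z))\<^sup>2 \<le> T * (norm (fst z))\<^sup>2"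
  proof -
    have "(c j)\<^sup>2 * (norm (snd (y j)))\<^sup>2 \<le> T * ((c j)\<^sup>2 * (norm (fst (y j)))\<^sup>2)" if "j < k" for j
      using mult_left_mono[OF y(3)[OF that], of "(c j)\<^sup>2"] by (simp add: algebra_simps)
    then show ?thesis unfolding zf zs sum_distrib_left by (intro sum_mono) auto
  qed
  have zpos: "(norm (fst z))\<^sup>2 > 0"
  proof -
    obtain j where j: "j < k" "c j \<noteq> 0" using c(1) by auto
    have "0 < (\<Sum>j<k. (c j)\<^sup>2 * (norm (fst (y j)))\<^sup>2)"
      using j y(2)[OF j(1)] by (intro sum_pos2[where i = j]) auto
    then show ?thesis by (simp add: zf)
  qed
  define p where "p i = fst z \<bullet> fst (e i)" for i
  define z' where "z' = z - (\<Sum>i<n. p i *\<^sub>R e i)"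
  have z': "z' \<in> eigen_complement G n e" "(norm (fst z))\<^sup>2 = (\<Sum>i<n. (p i)\<^sup>2) + (norm (fst z'))\<^sup>2"
      "(norm (snd z))\<^sup>2 = (\<Sum>i<n. (p i)\<^sup>2 * lam i) + (norm (snd z'))\<^sup>2"
    using eigen_decomposition[OF G(1) sys zG] by (auto simp: z'_def p_def)
  have low: "s * (norm (fst z'))\<^sup>2 \<le> (norm (snd z'))\<^sup>2" using ge z'(1) by (auto simp: form_ge_on_def)
  have pI: "(p i)\<^sup>2 * lam i \<ge> (p i)\<^sup>2 * T" if "i < n" for i
    using zI[of i] that by (cases "i \<in> I") (auto simp: I_def p_def intro!: mult_left_mono)
  have "(\<Sum>i<n. (p i)\<^sup>2) * T \<le> (\<Sum>i<n. (p i)\<^sup>2 * lam i)"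
    unfolding sum_distrib_right using pI by (intro sum_mono) auto
  then have "(s - T) * (norm (fst z'))\<^sup>2 \<le> 0" using up low z'(2,3) by (simp add: algebra_simps)
  then have z'0: "(norm (fst z'))\<^sup>2 = 0" using T by (simp add: mult_le_0_iff)
  have "\<exists>i<n. p i \<noteq> 0"
  proof (rule ccontr)
    assume "\<not> (\<exists>i<n. p i \<noteq> 0)"
    then have "(\<Sum>i<n. (p i)\<^sup>2) = 0" by simp
    then show False using zpos z'(2) z'0 by simp
  qed
  then obtain i where i: "i < n" "p i \<noteq> 0" by blast
  then have "\<not> lam i \<le> T" using zI[of i] by (auto simp: I_def p_def)
  then have "(\<Sum>i<n. (p i)\<^sup>2 * T) < (\<Sum>i<n. (p i)\<^sup>2 * lam i)"
    using pI i by (intro sum_strict_mono_ex1) (auto intro!: bexI[of _ i])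
  then have "T * (norm (fst z))\<^sup>2 < (norm (snd z))\<^sup>2"
    using z'(2,3) z'0 by (simp add: sum_distrib_left mult.commute) (smt (verit) zero_le_power2)
  with up show False by simp
qed

text \<open>
  The bound modulo \<open>k\<close> functionals allows at most \<open>k\<close> eigenvalues below \<open>s\<close>, the trial vectors provide
  at least \<open>k\<close> up to \<open>T\<close>, and the bound modulo \<open>k - 1\<close> functionals forbids that all of them are
  below \<open>r\<close>.
\<close>

lemma exact_eigen_system:
  fixes G :: "('a::{real_inner,complete_space} \<times> 'b::{real_inner,complete_space}) set"
  assumes G: "subspace G" "closed G" and k: "0 < k"
    and above: "form_ge_modulo G s k" and below: "form_ge_modulo G r (k - 1)"
    and trials: "orthogonal_trials G T k" and T: "T < s"
  shows "\<exists>e lam. eigen_system G k e lam \<and> (\<forall>i<k. lam i \<le> T) \<and> (\<exists>i<k. r \<le> lam i) \<and>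
           form_ge_on (eigen_complement G k e) s"
proof -
  obtain n e lam where n: "n \<le> k" and sys: "eigen_system G n e lam"
    and ge: "form_ge_on (eigen_complement G n e) s"
    using exists_maximal_eigen_system[OF G above] by blast
  have "k \<le> card {i. i < n \<and> lam i \<le> T}" by (rule card_eigenvalues_ge_trials[OF G(1) sys ge T trials])
  also have cn: "\<dots> \<le> card {..<n}" by (intro card_mono) auto
  finally have [simp]: "n = k" using n by simp
  have all: "\<forall>i<k. lam i \<le> T"
  proof -
    have "{i. i < k \<and> lam i \<le> T} = {..<k}"
      using \<open>k \<le> card {i. i < n \<and> lam i \<le> T}\<close> by (intro card_seteq) auto
    then show ?thesis by auto
  qed
  have "\<exists>i<k. r \<le> lam i"
  proof (rule ccontr)
    assume "\<not> (\<exists>i<k. r \<le> lam i)"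
    then have "{i. i < n \<and> lam i < r} = {..<k}" by auto
    then show False using card_eigenvalues_below_le[OF G(1) sys below] k by simp
  qed
  then show ?thesis using sys ge all by auto
qed

section \<open>The operator of a form and its complex resolvent\<close>

definition form_operator :: "('a::real_inner \<times> 'b::real_inner) set \<Rightarrow> ('a \<times> 'a) set" where
  "form_operator G = {(u, f). \<exists>x\<in>G. fst x = u \<and> (\<forall>y\<in>G. snd x \<bullet> snd y = f \<bullet> fst y)}"

lemma mem_form_operator:
  "a \<in> form_operator G \<longleftrightarrow> (\<exists>x\<in>G. fst x = fst a \<and> (\<forall>y\<in>G. snd x \<bullet> snd y = snd a \<bullet> fst y))"
  by (simp add: form_operator_def case_prod_beta)

lemma form_operator_subspace:
  assumes "subspace G" shows "subspace (form_operator G)"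
proof -
  have G: "0 \<in> G" "\<And>x y. x \<in> G \<Longrightarrow> y \<in> G \<Longrightarrow> x + y \<in> G" "\<And>c x. x \<in> G \<Longrightarrow> c *\<^sub>R x \<in> G"
    using assms by (auto simp: subspace_def)
  show ?thesis unfolding subspace_def
  proof (intro conjI ballI allI)
    show "0 \<in> form_operator G"
      unfolding mem_form_operator using G(1) by (intro bexI[of _ 0]) simp_all
  next
    fix a b assume "a \<in> form_operator G" "b \<in> form_operator G"
    then obtain x y where xy: "x \<in> G" "fst x = fst a" "\<forall>z\<in>G. snd x \<bullet> snd z = snd a \<bullet> fst z"
      "y \<in> G" "fst y = fst b" "\<forall>z\<in>G. snd y \<bullet> snd z = snd b \<bullet> fst z"
      unfolding mem_form_operator by blast
    then show "a + b \<in> form_operator G"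
      unfolding mem_form_operator using G(2) by (intro bexI[of _ "x + y"]) (simp_all add: inner_add_left)
  next
    fix c a assume "a \<in> form_operator G"
    then obtain x where x: "x \<in> G" "fst x = fst a" "\<forall>z\<in>G. snd x \<bullet> snd z = snd a \<bullet> fst z"
      unfolding mem_form_operator by blast
    then show "c *\<^sub>R a \<in> form_operator G"
      unfolding mem_form_operator using G(3) by (intro bexI[of _ "c *\<^sub>R x"]) simp_all
  qed
qed

lemma form_operator_add:
  "subspace G \<Longrightarrow> (u, f) \<in> form_operator G \<Longrightarrow> (v, g) \<in> form_operator G \<Longrightarrow> (u + v, f + g) \<in> form_operator G"
  using subspace_add[OF form_operator_subspace, of G "(u, f)" "(v, g)"] by simp

lemma eigenvector_form_operator:
  assumes sys: "eigen_system G n e lam" and i: "i < n"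
  shows "(fst (e i), lam i *\<^sub>R fst (e i)) \<in> form_operator G"
  unfolding form_operator_def using eigen_systemD[OF sys i] by (auto intro!: bexI[of _ "e i"])

lemma eigenvectors_form_operator:
  assumes G: "subspace G" and sys: "eigen_system G n e lam"
  shows "((\<Sum>i<n. c i *\<^sub>R fst (e i)), (\<Sum>i<n. (c i * lam i) *\<^sub>R fst (e i))) \<in> form_operator G"
proof -
  have "(\<Sum>i<n. c i *\<^sub>R (fst (e i), lam i *\<^sub>R fst (e i))) \<in> form_operator G"
    using form_operator_subspace[OF G] eigenvector_form_operator[OF sys]
    by (intro subspace_sum subspace_scale) auto
  moreover have "(\<Sum>i<n. c i *\<^sub>R (fst (e i), lam i *\<^sub>R fst (e i))) =
     ((\<Sum>i<n. c i *\<^sub>R fst (e i)), (\<Sum>i<n. (c i * lam i) *\<^sub>R fst (e i)))"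
    by (simp add: prod_eq_iff fst_sum snd_sum)
  ultimately show ?thesis by simp
qed

text \<open>
  A solution that is tested only against the complement is a solution of the full equation, since
  testing it against an eigenvector gives zero on both sides.
\<close>

lemma complement_form_operator:
  assumes G: "subspace G" and sys: "eigen_system G n e lam"
    and x: "x \<in> eigen_complement G n e"
    and eq: "\<And>y. y \<in> eigen_complement G n e \<Longrightarrow> snd x \<bullet> snd y = f \<bullet> fst y"
    and f: "\<And>i. i < n \<Longrightarrow> f \<bullet> fst (e i) = 0"
  shows "(fst x, f) \<in> form_operator G"
proof -
  have xG: "x \<in> G" and xe: "\<And>i. i < n \<Longrightarrow> fst x \<bullet> fst (e i) = 0"
    using x by (auto simp: eigen_complement_def)
  have "snd x \<bullet> snd y = f \<bullet> fst y" if y: "y \<in> G" for y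
  proof -
    define p where "p i = fst y \<bullet> fst (e i)" for i
    define y' where "y' = y - (\<Sum>i<n. p i *\<^sub>R e i)"
    have y': "y' \<in> eigen_complement G n e" "y = (\<Sum>i<n. p i *\<^sub>R e i) + y'"
      using eigen_decomposition(1,2)[OF G(1) sys(1) y] by (auto simp: y'_def p_def)
    have "snd x \<bullet> snd (e i) = 0" if "i < n" for i
      using eigen_systemD(2)[OF sys(1) that xG] xe[OF that] by (simp add: inner_commute)
    then show ?thesis using eq[OF y'(1)] f
      by (subst (1 2) y'(2)) (simp add: inner_add_right snd_sum fst_sum inner_sum_right)
  qed
  then show ?thesis unfolding form_operator_def using xG by auto
qed

text \<open>
  With \<open>z = a + i b\<close> the equation for \<open>u1 + i u2\<close> is a coupled system for two real vectors. For real
  \<open>z = a\<close> it is solved by an operator \<open>R\<close> with Lipschitz constant \<open>1 / (s - a)\<close>; the coupling by \<open>b\<close> is then a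
  contraction on the product space.
\<close>

lemma complement_complex_resolvent:
  fixes G :: "('a::{real_inner,complete_space} \<times> 'b::{real_inner,complete_space}) set"
  assumes G: "subspace G" "closed G" and sys: "eigen_system G n e lam"
    and ge: "form_ge_on (eigen_complement G n e) s" and b: "\<bar>b\<bar> < s - a"
    and f: "\<And>i. i < n \<Longrightarrow> f1 \<bullet> fst (e i) = 0" "\<And>i. i < n \<Longrightarrow> f2 \<bullet> fst (e i) = 0"
  shows "\<exists>u1 u2. (u1, f1 + a *\<^sub>R u1 - b *\<^sub>R u2) \<in> form_operator G \<and>
                 (u2, f2 + a *\<^sub>R u2 + b *\<^sub>R u1) \<in> form_operator G"
proof -
  define S where "S = eigen_complement G n e"
  note S = eigen_complement_closed_subspace[OF G, of n e, folded S_def]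
  have coercive: "s * (norm (fst y))\<^sup>2 \<le> (norm (snd y))\<^sup>2" if "y \<in> S" for y
    using ge that by (auto simp: form_ge_on_def S_def)
  have as: "a < s" using b by linarith
  have "\<exists>x\<in>S. \<forall>y\<in>S. snd x \<bullet> snd y - a * (fst x \<bullet> fst y) = f \<bullet> fst y" for f
    by (rule coercive_form_solution[OF S coercive as])
  then obtain R where R: "\<And>f. R f \<in> S"
    "\<And>f y. y \<in> S \<Longrightarrow> snd (R f) \<bullet> snd y - a * (fst (R f) \<bullet> fst y) = f \<bullet> fst y" by metis
  have lip: "norm (fst (R f) - fst (R g)) \<le> norm (f - g) / (s - a)" for f g
  proof -
    define v where "v = R f - R g"
    have v: "v \<in> S" unfolding v_def using S(1) R(1) by (intro subspace_diff)
    have "(s - a) * (norm (fst v))\<^sup>2 \<le> (norm (snd v))\<^sup>2 - a * (norm (fst v))\<^sup>2"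
      using coercive[OF v] by (simp add: algebra_simps)
    also have "\<dots> = (snd (R f) \<bullet> snd v - a * (fst (R f) \<bullet> fst v)) - (snd (R g) \<bullet> snd v - a * (fst (R g) \<bullet> fst v))"
      unfolding power2_norm_eq_inner by (simp add: v_def inner_diff_left inner_diff_right algebra_simps)
    also have "\<dots> = (f - g) \<bullet> fst v" using R(2)[OF v] by (simp add: inner_diff_left)
    also have "\<dots> \<le> norm (f - g) * norm (fst v)" by (rule norm_cauchy_schwarz)
    finally have *: "norm (fst v) * ((s - a) * norm (fst v)) \<le> norm (fst v) * norm (f - g)"
      by (simp add: power2_eq_square mult_ac)
    have "(s - a) * norm (fst v) \<le> norm (f - g)"
    proof (cases "norm (fst v) = 0")
      case True then show ?thesis by simp
    next
      case False
      then have "0 < norm (fst v)" by simp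
      from mult_left_le_imp_le[OF * this] show ?thesis .
    qed
    then show ?thesis using as by (simp add: v_def field_simps)
  qed
  \<comment> \<open>its fixed points are the solutions of the coupled system\<close>
  define \<Phi> where "\<Phi> u = (fst (R (f1 - b *\<^sub>R snd u)), fst (R (f2 + b *\<^sub>R fst u)))" for u :: "'a \<times> 'a"
  define c where "c = \<bar>b\<bar> / (s - a)"
  have c: "0 \<le> c" "c < 1" using b as by (auto simp: c_def)
  have "dist (\<Phi> u) (\<Phi> v) \<le> c * dist u v" for u v
  proof -
    have 1: "norm (fst (R (f1 - b *\<^sub>R snd u)) - fst (R (f1 - b *\<^sub>R snd v))) \<le> c * norm (snd u - snd v)"
    proof -
      have "f1 - b *\<^sub>R snd u - (f1 - b *\<^sub>R snd v) = - b *\<^sub>R (snd u - snd v)" by (simp add: algebra_simps)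
      then have "norm (f1 - b *\<^sub>R snd u - (f1 - b *\<^sub>R snd v)) = \<bar>b\<bar> * norm (snd u - snd v)" by simp
      with lip[of "f1 - b *\<^sub>R snd u" "f1 - b *\<^sub>R snd v"] show ?thesis by (simp add: c_def)
    qed
    have 2: "norm (fst (R (f2 + b *\<^sub>R fst u)) - fst (R (f2 + b *\<^sub>R fst v))) \<le> c * norm (fst u - fst v)"
    proof -
      have "f2 + b *\<^sub>R fst u - (f2 + b *\<^sub>R fst v) = b *\<^sub>R (fst u - fst v)" by (simp add: algebra_simps)
      then have "norm (f2 + b *\<^sub>R fst u - (f2 + b *\<^sub>R fst v)) = \<bar>b\<bar> * norm (fst u - fst v)" by simp
      with lip[of "f2 + b *\<^sub>R fst u" "f2 + b *\<^sub>R fst v"] show ?thesis by (simp add: c_def)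
    qed
    have "dist (\<Phi> u) (\<Phi> v) \<le> sqrt ((c * norm (snd u - snd v))\<^sup>2 + (c * norm (fst u - fst v))\<^sup>2)"
      unfolding dist_prod_def \<Phi>_def fst_conv snd_conv dist_norm
      by (intro real_sqrt_le_mono add_mono power_mono 1 2) auto
    also have "\<dots> = c * dist u v"
      using c by (simp add: dist_prod_def dist_norm power_mult_distrib real_sqrt_mult
          flip: distrib_left)
    finally show ?thesis .
  qed
  then obtain u where u: "\<Phi> u = u" using banach_fix_type[OF c, of \<Phi>] by blast
  define u1 u2 where "u1 = fst u" and "u2 = snd u"
  have u1: "u1 = fst (R (f1 - b *\<^sub>R u2))" and u2: "u2 = fst (R (f2 + b *\<^sub>R u1))"
    using u by (auto simp: \<Phi>_def u1_def u2_def prod_eq_iff)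
  have "fst (R f) \<bullet> fst (e i) = 0" if "i < n" for f i
    using R(1)[of f] that by (auto simp: S_def eigen_complement_def)
  then have orth: "u1 \<bullet> fst (e i) = 0" "u2 \<bullet> fst (e i) = 0" if "i < n" for i
    using that u1 u2 by metis+
  have "(fst (R (f1 - b *\<^sub>R u2)), f1 - b *\<^sub>R u2 + a *\<^sub>R u1) \<in> form_operator G"
  proof (rule complement_form_operator[OF G(1) sys])
    show "R (f1 - b *\<^sub>R u2) \<in> eigen_complement G n e" using R(1) by (simp add: S_def)
    fix y assume "y \<in> eigen_complement G n e"
    then show "snd (R (f1 - b *\<^sub>R u2)) \<bullet> snd y = (f1 - b *\<^sub>R u2 + a *\<^sub>R u1) \<bullet> fst y"
      using R(2)[of y "f1 - b *\<^sub>R u2"] by (simp add: S_def inner_add_left flip: u1)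
  qed (use f orth in \<open>simp add: inner_add_left inner_diff_left\<close>)
  moreover have "(fst (R (f2 + b *\<^sub>R u1)), f2 + b *\<^sub>R u1 + a *\<^sub>R u2) \<in> form_operator G"
  proof (rule complement_form_operator[OF G(1) sys])
    show "R (f2 + b *\<^sub>R u1) \<in> eigen_complement G n e" using R(1) by (simp add: S_def)
    fix y assume "y \<in> eigen_complement G n e"
    then show "snd (R (f2 + b *\<^sub>R u1)) \<bullet> snd y = (f2 + b *\<^sub>R u1 + a *\<^sub>R u2) \<bullet> fst y"
      using R(2)[of y "f2 + b *\<^sub>R u1"] by (simp add: S_def inner_add_left flip: u2)
  qed (use f orth in \<open>simp add: inner_add_left inner_diff_left\<close>)
  ultimately show ?thesis
    unfolding u1[symmetric] u2[symmetric] by (intro exI[of _ u1] exI[of _ u2]) (simp add: algebra_simps)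
qed

text \<open>
  Along the eigenvectors the equation is solved by dividing the coefficients by \<open>lam i - z\<close>; the rest
  is the previous lemma.
\<close>

lemma complex_resolvent_onto:
  fixes G :: "('a::{real_inner,complete_space} \<times> 'b::{real_inner,complete_space}) set"
  assumes G: "subspace G" "closed G" and sys: "eigen_system G n e lam"
    and ge: "form_ge_on (eigen_complement G n e) s" and b: "\<bar>b\<bar> < s - a"
    and z: "\<And>i. i < n \<Longrightarrow> Complex a b \<noteq> of_real (lam i)"
  shows "\<exists>u1 u2. (u1, f1 + a *\<^sub>R u1 - b *\<^sub>R u2) \<in> form_operator G \<and>
                 (u2, f2 + a *\<^sub>R u2 + b *\<^sub>R u1) \<in> form_operator G"
proof -
  define \<alpha> where "\<alpha> i = f1 \<bullet> fst (e i)" for i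
  define \<beta> where "\<beta> i = f2 \<bullet> fst (e i)" for i
  define c where "c i = Complex (\<alpha> i) (\<beta> i) / (of_real (lam i) - Complex a b)" for i
  have c: "Re (c i) * lam i = \<alpha> i + a * Re (c i) - b * Im (c i)"
    "Im (c i) * lam i = \<beta> i + a * Im (c i) + b * Re (c i)" if "i < n" for i
  proof -
    have "(of_real (lam i) - Complex a b) * c i = Complex (\<alpha> i) (\<beta> i)"
      using z[OF that] by (simp add: c_def)
    then show "Re (c i) * lam i = \<alpha> i + a * Re (c i) - b * Im (c i)"
      "Im (c i) * lam i = \<beta> i + a * Im (c i) + b * Re (c i)"
      by (simp_all add: complex_eq_iff algebra_simps)
  qed
  define g1 where "g1 = f1 - (\<Sum>i<n. \<alpha> i *\<^sub>R fst (e i))"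
  define g2 where "g2 = f2 - (\<Sum>i<n. \<beta> i *\<^sub>R fst (e i))"
  have proj: "(\<Sum>i<n. d i *\<^sub>R fst (e i)) \<bullet> fst (e j) = d j" if "j < n" for d j
    using eigen_system_combination(2)[OF G(1) sys order_refl that, of d] that by (simp add: fst_sum)
  have "\<exists>u1 u2. (u1, g1 + a *\<^sub>R u1 - b *\<^sub>R u2) \<in> form_operator G \<and>
                (u2, g2 + a *\<^sub>R u2 + b *\<^sub>R u1) \<in> form_operator G"
    by (rule complement_complex_resolvent[OF G sys ge b])
       (simp_all add: g1_def g2_def inner_diff_left proj \<alpha>_def \<beta>_def)
  then obtain u1 u2 where u: "(u1, g1 + a *\<^sub>R u1 - b *\<^sub>R u2) \<in> form_operator G"
     "(u2, g2 + a *\<^sub>R u2 + b *\<^sub>R u1) \<in> form_operator G" by blast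
  define v1 where "v1 = (\<Sum>i<n. Re (c i) *\<^sub>R fst (e i))"
  define v2 where "v2 = (\<Sum>i<n. Im (c i) *\<^sub>R fst (e i))"
  have e1: "(\<Sum>i<n. (Re (c i) * lam i) *\<^sub>R fst (e i)) = (f1 - g1) + a *\<^sub>R v1 - b *\<^sub>R v2"
    unfolding g1_def v1_def v2_def
    by (simp add: c scaleR_sum_right sum.distrib sum_subtractf scaleR_add_left scaleR_diff_left)
  have e2: "(\<Sum>i<n. (Im (c i) * lam i) *\<^sub>R fst (e i)) = (f2 - g2) + a *\<^sub>R v2 + b *\<^sub>R v1"
    unfolding g2_def v1_def v2_def
    by (simp add: c scaleR_sum_right sum.distrib sum_subtractf scaleR_add_left scaleR_diff_left)
  have "(v1, (f1 - g1) + a *\<^sub>R v1 - b *\<^sub>R v2) \<in> form_operator G"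
    using eigenvectors_form_operator[OF G(1) sys, of "\<lambda>i. Re (c i)"] unfolding e1 by (simp add: v1_def)
  from form_operator_add[OF G(1) u(1) this]
  have "(u1 + v1, f1 + a *\<^sub>R (u1 + v1) - b *\<^sub>R (u2 + v2)) \<in> form_operator G" by (simp add: algebra_simps)
  moreover have "(v2, (f2 - g2) + a *\<^sub>R v2 + b *\<^sub>R v1) \<in> form_operator G"
    using eigenvectors_form_operator[OF G(1) sys, of "\<lambda>i. Im (c i)"] unfolding e2 by (simp add: v2_def)
  from form_operator_add[OF G(1) u(2) this]
  have "(u2 + v2, f2 + a *\<^sub>R (u2 + v2) + b *\<^sub>R (u1 + v1)) \<in> form_operator G" by (simp add: algebra_simps)
  ultimately show ?thesis by blast
qed

lemma norm_sq_orthogonal_projection: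
  assumes G: "subspace G" and sys: "eigen_system G n e lam"
  defines "p \<equiv> \<lambda>f i. f \<bullet> fst (e i)"
  defines "P \<equiv> \<lambda>f. f - (\<Sum>i<n. p f i *\<^sub>R fst (e i))"
  shows "(norm f)\<^sup>2 = (\<Sum>i<n. (p f i)\<^sup>2) + (norm (P f))\<^sup>2"
    "\<And>i. i < n \<Longrightarrow> P f \<bullet> fst (e i) = 0"
proof -
  define w where "w = (\<Sum>i<n. p f i *\<^sub>R e i)"
  note W = eigen_system_combination[OF G sys order_refl, where c = "p f", folded w_def]
  have fw: "fst w = (\<Sum>i<n. p f i *\<^sub>R fst (e i))" by (simp add: w_def fst_sum)
  have P: "P f = f - fst w" by (simp add: P_def fw)
  show orth: "P f \<bullet> fst (e i) = 0" if "i < n" for i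
    using W(2)[OF that] that by (simp add: P inner_diff_left p_def)
  then have "P f \<bullet> fst w = 0" by (simp add: fw inner_sum_right)
  moreover have "f = fst w + P f" by (simp add: P)
  ultimately have "(norm f)\<^sup>2 = (norm (fst w))\<^sup>2 + (norm (P f))\<^sup>2"
    unfolding power2_norm_eq_inner by (metis (no_types, lifting) add.right_neutral add_0 inner_add_left inner_add_right inner_commute)
  then show "(norm f)\<^sup>2 = (\<Sum>i<n. (p f i)\<^sup>2) + (norm (P f))\<^sup>2" by (simp add: W(4))
qed

text \<open>
  By orthogonality it suffices to bound the coefficients, each of which is multiplied by \<open>lam i - z\<close>, and
  the component in the complement. There the skew coupling by \<open>b\<close> cancels when the equation is tested
  with the solution, and the gap \<open>s - a\<close> remains.
\<close>

lemma complex_resolvent_bounded: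
  fixes G :: "('a::real_inner \<times> 'b::real_inner) set"
  assumes G: "subspace G" and sys: "eigen_system G n e lam"
    and ge: "form_ge_on (eigen_complement G n e) s" and b: "\<bar>b\<bar> < s - a"
    and z: "\<And>i. i < n \<Longrightarrow> Complex a b \<noteq> of_real (lam i)"
  shows "\<exists>C\<ge>0. \<forall>u1 g1 u2 g2. (u1, g1) \<in> form_operator G \<longrightarrow> (u2, g2) \<in> form_operator G \<longrightarrow>
     (norm u1)\<^sup>2 + (norm u2)\<^sup>2 \<le>
       C\<^sup>2 * ((norm (g1 - a *\<^sub>R u1 + b *\<^sub>R u2))\<^sup>2 + (norm (g2 - a *\<^sub>R u2 - b *\<^sub>R u1))\<^sup>2)"
proof -
  \<comment> \<open>a lower bound for the gap and for the distances from \<open>z\<close> to the eigenvalues\<close>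
  define \<kappa> where "\<kappa> = Min (insert (s - a) ((\<lambda>i. cmod (Complex a b - of_real (lam i))) ` {..<n}))"
  have \<kappa>: "\<kappa> > 0" "\<kappa> \<le> s - a" "\<And>i. i < n \<Longrightarrow> \<kappa> \<le> cmod (Complex a b - of_real (lam i))"
    using b z unfolding \<kappa>_def by (auto simp: Min_le_iff)
  have "(norm u1)\<^sup>2 + (norm u2)\<^sup>2 \<le>
       (1/\<kappa>)\<^sup>2 * ((norm (g1 - a *\<^sub>R u1 + b *\<^sub>R u2))\<^sup>2 + (norm (g2 - a *\<^sub>R u2 - b *\<^sub>R u1))\<^sup>2)"
    if "(u1, g1) \<in> form_operator G" "(u2, g2) \<in> form_operator G" for u1 g1 u2 g2
  proof -
    define f1 f2 where "f1 = g1 - a *\<^sub>R u1 + b *\<^sub>R u2" and "f2 = g2 - a *\<^sub>R u2 - b *\<^sub>R u1"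
    obtain x1 where x1: "x1 \<in> G" "fst x1 = u1" "\<And>y. y \<in> G \<Longrightarrow> snd x1 \<bullet> snd y = g1 \<bullet> fst y"
      using \<open>(u1, g1) \<in> form_operator G\<close> by (auto simp: form_operator_def)
    obtain x2 where x2: "x2 \<in> G" "fst x2 = u2" "\<And>y. y \<in> G \<Longrightarrow> snd x2 \<bullet> snd y = g2 \<bullet> fst y"
      using \<open>(u2, g2) \<in> form_operator G\<close> by (auto simp: form_operator_def)
    define p where "p f i = f \<bullet> fst (e i)" for f i
    define P where "P f = f - (\<Sum>i<n. p f i *\<^sub>R fst (e i))" for f
    note proj = norm_sq_orthogonal_projection[OF G sys, folded p_def, folded P_def]
    define y1 where "y1 = x1 - (\<Sum>i<n. p u1 i *\<^sub>R e i)"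
    define y2 where "y2 = x2 - (\<Sum>i<n. p u2 i *\<^sub>R e i)"
    have y: "y1 \<in> eigen_complement G n e" "y2 \<in> eigen_complement G n e"
      using eigen_decomposition(1)[OF G sys x1(1)] eigen_decomposition(1)[OF G sys x2(1)]
      by (auto simp: y1_def y2_def p_def x1 x2)
    have fy: "fst y1 = P u1" "fst y2 = P u2" by (simp_all add: y1_def y2_def P_def x1 x2 fst_sum)
    have yG: "y1 \<in> G" "y2 \<in> G" using y by (auto simp: eigen_complement_def)
    have pg: "p g1 i = lam i * p u1 i" "p g2 i = lam i * p u2 i" if "i < n" for i
      using x1(3)[OF eigen_systemD(1)[OF sys that]] x2(3)[OF eigen_systemD(1)[OF sys that]]
        eigen_systemD(2)[OF sys that x1(1)] eigen_systemD(2)[OF sys that x2(1)]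
      by (simp_all add: p_def x1(2) x2(2) inner_commute)
    have pf: "\<kappa>\<^sup>2 * ((p u1 i)\<^sup>2 + (p u2 i)\<^sup>2) \<le> (p f1 i)\<^sup>2 + (p f2 i)\<^sup>2" if "i < n" for i
    proof -
      have p1: "p f1 i = (lam i - a) * p u1 i + b * p u2 i" and p2: "p f2 i = (lam i - a) * p u2 i - b * p u1 i"
        using pg[OF that] by (simp_all add: p_def f1_def f2_def inner_add_left inner_diff_left algebra_simps)
      have "(cmod (Complex a b - of_real (lam i)))\<^sup>2 = (lam i - a)\<^sup>2 + b\<^sup>2"
        by (simp add: cmod_power2 power2_commute)
      moreover have "\<kappa>\<^sup>2 \<le> (cmod (Complex a b - of_real (lam i)))\<^sup>2" using \<kappa>(1) \<kappa>(3)[OF that] by (intro power_mono) auto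
      ultimately have "\<kappa>\<^sup>2 * ((p u1 i)\<^sup>2 + (p u2 i)\<^sup>2) \<le> ((lam i - a)\<^sup>2 + b\<^sup>2) * ((p u1 i)\<^sup>2 + (p u2 i)\<^sup>2)"
        by (intro mult_right_mono) auto
      also have "\<dots> = (p f1 i)\<^sup>2 + (p f2 i)\<^sup>2" unfolding p1 p2 by (simp add: power2_eq_square algebra_simps)
      finally show ?thesis .
    qed
    have fP: "f \<bullet> P u = P f \<bullet> P u" for f u
    proof -
      have "fst (e i) \<bullet> P u = 0" if "i < n" for i
        using proj(2)[OF that, of u] by (simp add: inner_commute p_def)
      then show ?thesis by (subst (2) P_def) (simp add: inner_diff_left inner_sum_left)
    qed
    have xy: "snd x \<bullet> snd y' = (norm (snd y'))\<^sup>2"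
      if "x = w + y'" "w = (\<Sum>i<n. c i *\<^sub>R e i)" "y' \<in> eigen_complement G n e" for x w y' and c :: "nat \<Rightarrow> real"
    proof -
      have y'G: "y' \<in> G" and y'o: "\<And>i. i < n \<Longrightarrow> fst (e i) \<bullet> fst y' = 0"
        using that(3) by (auto simp: eigen_complement_def inner_commute)
      have "snd w \<bullet> snd y' = 0"
        using eigen_system_combination(3)[OF G sys order_refl y'G, of c] y'o that(2) by simp
      then show ?thesis by (simp add: that(1) inner_add_left power2_norm_eq_inner)
    qed
    have "x1 = (\<Sum>i<n. p u1 i *\<^sub>R e i) + y1" "x2 = (\<Sum>i<n. p u2 i *\<^sub>R e i) + y2"
      by (simp_all add: y1_def y2_def)
    then have q1: "g1 \<bullet> P u1 = (norm (snd y1))\<^sup>2" and q2: "g2 \<bullet> P u2 = (norm (snd y2))\<^sup>2"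
      using x1(3)[OF yG(1)] x2(3)[OF yG(2)] xy[OF _ refl y(1)] xy[OF _ refl y(2)]
      unfolding fy by metis+
    define N where "N = (norm (P u1))\<^sup>2 + (norm (P u2))\<^sup>2"
    define F where "F = (norm (P f1))\<^sup>2 + (norm (P f2))\<^sup>2"
    have Nge: "s * N \<le> (norm (snd y1))\<^sup>2 + (norm (snd y2))\<^sup>2"
      using ge y unfolding form_ge_on_def N_def fy[symmetric] by (fastforce simp: distrib_left intro: add_mono)
    have uP: "u1 \<bullet> P u1 = (norm (P u1))\<^sup>2" "u2 \<bullet> P u2 = (norm (P u2))\<^sup>2" "u2 \<bullet> P u1 = P u2 \<bullet> P u1" "u1 \<bullet> P u2 = P u2 \<bullet> P u1"
      using fP[of u1 u1] fP[of u2 u2] fP[of u2 u1] fP[of u1 u2]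
      by (simp_all add: power2_norm_eq_inner inner_commute[of "P u1" "P u2"])
    have "(s - a) * N \<le> f1 \<bullet> P u1 + f2 \<bullet> P u2"
      using Nge q1 q2 uP unfolding f1_def f2_def N_def
      by (simp add: inner_add_left inner_diff_left algebra_simps)
    also have "\<dots> = P f1 \<bullet> P u1 + P f2 \<bullet> P u2" by (simp only: fP[of f1 u1] fP[of f2 u2])
    also have "\<dots> = (P f1, P f2) \<bullet> (P u1, P u2)" by simp
    also have "\<dots> \<le> norm (P f1, P f2) * norm (P u1, P u2)" by (rule norm_cauchy_schwarz)
    also have "\<dots> = sqrt F * sqrt N" by (simp add: norm_Pair F_def N_def)
    finally have main: "(s - a) * N \<le> sqrt F * sqrt N" .
    have N0: "0 \<le> N" and F0: "0 \<le> F" by (simp_all add: N_def F_def)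
    have "\<kappa>\<^sup>2 * N \<le> F"
    proof (cases "N = 0")
      case True then show ?thesis using F0 by simp
    next
      case False
      then have Np: "0 < sqrt N" using N0 by simp
      have "sqrt N * (\<kappa> * sqrt N) = \<kappa> * N" using N0 by simp
      also have "\<dots> \<le> (s - a) * N" using \<kappa>(2) N0 by (intro mult_right_mono)
      also have "\<dots> \<le> sqrt N * sqrt F" using main by (simp add: mult.commute)
      finally have "\<kappa> * sqrt N \<le> sqrt F" using Np by (simp only: mult_le_cancel_left_pos)
      then have "(\<kappa> * sqrt N)\<^sup>2 \<le> (sqrt F)\<^sup>2" using \<kappa>(1) Np by (intro power_mono) auto
      then show ?thesis using N0 F0 by (simp add: power_mult_distrib)
    qed
    moreover have "\<kappa>\<^sup>2 * (\<Sum>i<n. (p u1 i)\<^sup>2 + (p u2 i)\<^sup>2) \<le> (\<Sum>i<n. (p f1 i)\<^sup>2 + (p f2 i)\<^sup>2)"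
      unfolding sum_distrib_left using pf by (intro sum_mono) auto
    ultimately have "\<kappa>\<^sup>2 * ((norm u1)\<^sup>2 + (norm u2)\<^sup>2) \<le> (norm f1)\<^sup>2 + (norm f2)\<^sup>2"
      unfolding proj(1)[of u1] proj(1)[of u2] proj(1)[of f1] proj(1)[of f2] N_def F_def
      by (simp add: sum.distrib algebra_simps)
    then show ?thesis using \<kappa>(1) by (simp add: f1_def f2_def power_divide field_simps)
  qed
  then show ?thesis using \<kappa>(1) by (intro exI[of _ "1/\<kappa>"]) auto
qed

text \<open>
  The component in the complement is an eigenvector of the form restricted to the complement, where
  the form is too large for the eigenvalue \<open>t\<close>; coefficients for other eigenvalues vanish by symmetry.
\<close>

lemma eigenvector_in_span:
  fixes G :: "('a::real_inner \<times> 'b::real_inner) set"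
  assumes G: "subspace G" and sys: "eigen_system G n e lam"
    and ge: "form_ge_on (eigen_complement G n e) s" and t: "t < s"
    and u: "(u, t *\<^sub>R u) \<in> form_operator G"
  shows "u = (\<Sum>i | i < n \<and> lam i = t. (u \<bullet> fst (e i)) *\<^sub>R fst (e i))"
proof -
  obtain x where x: "x \<in> G" "fst x = u" "\<And>y. y \<in> G \<Longrightarrow> snd x \<bullet> snd y = t * (u \<bullet> fst y)"
    using u by (auto simp: form_operator_def)
  define p where "p i = fst x \<bullet> fst (e i)" for i
  define y where "y = x - (\<Sum>i<n. p i *\<^sub>R e i)"
  have y: "y \<in> eigen_complement G n e" "x = (\<Sum>i<n. p i *\<^sub>R e i) + y"
    using eigen_decomposition(1,2)[OF G sys x(1)] by (auto simp: y_def p_def)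
  have yG: "y \<in> G" and ye: "\<And>i. i < n \<Longrightarrow> fst (e i) \<bullet> fst y = 0"
    using y(1) by (auto simp: eigen_complement_def inner_commute)
  define w where "w = (\<Sum>i<n. p i *\<^sub>R e i)"
  have "snd w \<bullet> snd y = 0"
    using eigen_system_combination(3)[OF G sys order_refl yG, of p] ye by (simp add: w_def)
  moreover have "fst w \<bullet> fst y = 0" using ye by (simp add: w_def fst_sum inner_sum_left)
  ultimately have "(norm (snd y))\<^sup>2 = t * (norm (fst y))\<^sup>2"
    using x(3)[OF yG] y(2) unfolding x(2)[symmetric] w_def[symmetric]
    by (simp add: inner_add_left power2_norm_eq_inner)
  moreover have "s * (norm (fst y))\<^sup>2 \<le> (norm (snd y))\<^sup>2" using ge y(1) by (auto simp: form_ge_on_def)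
  ultimately have "(s - t) * (norm (fst y))\<^sup>2 \<le> 0" by (simp add: algebra_simps)
  then have "fst y = 0" using t by (simp add: mult_le_0_iff)
  then have "fst x = (\<Sum>i<n. p i *\<^sub>R fst (e i))" by (subst y(2)) (simp add: fst_sum)
  then have "u = (\<Sum>i<n. p i *\<^sub>R fst (e i))" by (simp only: x(2))
  also have "\<dots> = (\<Sum>i | i < n \<and> lam i = t. p i *\<^sub>R fst (e i))"
  proof (rule sum.mono_neutral_right)
    show "\<forall>i\<in>{..<n} - {i. i < n \<and> lam i = t}. p i *\<^sub>R fst (e i) = 0"
    proof
      fix i assume i: "i \<in> {..<n} - {i. i < n \<and> lam i = t}"
      have "lam i * p i = t * p i"
        using x(3)[OF eigen_systemD(1)[OF sys, of i]] eigen_systemD(2)[OF sys _ x(1), of i] i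
        by (auto simp: p_def x(2) inner_commute)
      then show "p i *\<^sub>R fst (e i) = 0" using i by (auto simp: p_def)
    qed
  qed auto
  finally show ?thesis by (simp add: p_def x(2))
qed

section \<open>The real Hilbert space of square integrable functions\<close>

definition real_L2 :: "(real \<Rightarrow> real) set" where
  "real_L2 = {u \<in> borel_measurable borel. integrable lborel (\<lambda>x. (u x)\<^sup>2)}"

lemma real_L2_measurable: "u \<in> real_L2 \<Longrightarrow> u \<in> borel_measurable borel"
  by (simp add: real_L2_def)

lemma real_L2_integrable_square: "u \<in> real_L2 \<Longrightarrow> integrable lborel (\<lambda>x. (u x)\<^sup>2)"
  by (simp add: real_L2_def)

lemma real_L2_integrable_mult:
  assumes u: "u \<in> real_L2" and v: "v \<in> real_L2"
  shows "integrable lborel (\<lambda>x. u x * v x)"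
proof (rule Bochner_Integration.integrable_bound)
  show "integrable lborel (\<lambda>x. (u x)\<^sup>2 + (v x)\<^sup>2)"
    using u v by (intro Bochner_Integration.integrable_add real_L2_integrable_square)
  show "(\<lambda>x. u x * v x) \<in> borel_measurable lborel"
    using u v by (auto dest!: real_L2_measurable)
  have "\<bar>u x * v x\<bar> \<le> (u x)\<^sup>2 + (v x)\<^sup>2" for x
  proof -
    have "2 * (\<bar>u x\<bar> * \<bar>v x\<bar>) \<le> (u x)\<^sup>2 + (v x)\<^sup>2"
      using sum_squares_bound[of "\<bar>u x\<bar>" "\<bar>v x\<bar>"] by (simp add: mult.assoc)
    moreover have "0 \<le> \<bar>u x\<bar> * \<bar>v x\<bar>" by simp
    ultimately show ?thesis unfolding abs_mult by linarith
  qed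
  then show "AE x in lborel. norm (u x * v x) \<le> norm ((u x)\<^sup>2 + (v x)\<^sup>2)" by simp
qed

lemma real_L2_add [intro]:
  assumes u: "u \<in> real_L2" and v: "v \<in> real_L2"
  shows "(\<lambda>x. u x + v x) \<in> real_L2"
proof -
  have "integrable lborel (\<lambda>x. (u x)\<^sup>2 + 2 * (u x * v x) + (v x)\<^sup>2)"
    using u v by (intro Bochner_Integration.integrable_add integrable_mult_right real_L2_integrable_square real_L2_integrable_mult)
  moreover have "(\<lambda>x. (u x + v x)\<^sup>2) = (\<lambda>x. (u x)\<^sup>2 + 2 * (u x * v x) + (v x)\<^sup>2)"
    by (simp add: fun_eq_iff power2_eq_square algebra_simps)
  ultimately show ?thesis using u v by (auto simp: real_L2_def)
qed

lemma real_L2_scale [intro]: "u \<in> real_L2 \<Longrightarrow> (\<lambda>x. c * u x) \<in> real_L2"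
  by (auto simp: real_L2_def power_mult_distrib)

lemma real_L2_diff [intro]: "u \<in> real_L2 \<Longrightarrow> v \<in> real_L2 \<Longrightarrow> (\<lambda>x. u x - v x) \<in> real_L2"
  using real_L2_add[of u "\<lambda>x. -1 * v x"] real_L2_scale[of v "-1"] by simp

lemma real_L2_zero [intro, simp]: "(\<lambda>x. 0) \<in> real_L2"
  by (simp add: real_L2_def)

lemma real_L2_dominated:
  assumes "w \<in> real_L2" "u \<in> borel_measurable borel" "\<And>x. \<bar>u x\<bar> \<le> \<bar>w x\<bar>"
  shows "u \<in> real_L2"
proof -
  have "integrable lborel (\<lambda>x. (u x)\<^sup>2)"
    by (rule Bochner_Integration.integrable_bound[OF real_L2_integrable_square[OF assms(1)]])
       (use assms in \<open>auto simp: abs_le_square_iff\<close>)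
  with assms show ?thesis by (simp add: real_L2_def)
qed

lemma real_L2_cong_AE:
  assumes "u \<in> real_L2" "v \<in> borel_measurable borel" "AE x in lborel. u x = v x"
  shows "v \<in> real_L2"
proof -
  have "integrable lborel (\<lambda>x. (v x)\<^sup>2)"
    by (rule integrable_cong_AE_imp[OF real_L2_integrable_square[OF assms(1)]])
      (use assms in auto)
  with assms show ?thesis by (simp add: real_L2_def)
qed

text \<open>
  Square integrable functions up to null sets. Having them as elements of a type in the classes
  \<open>real_inner\<close> and \<open>complete_space\<close> makes the abstract part applicable.
\<close>

quotient_type rl2 = "real \<Rightarrow> real" / partial:
  "\<lambda>u v. u \<in> real_L2 \<and> v \<in> real_L2 \<and> (AE x in lborel. u x = v x)"
proof (rule part_equivpI)
  show "\<exists>x::real\<Rightarrow>real. x \<in> real_L2 \<and> x \<in> real_L2 \<and> (AE xa in lborel. x xa = x xa)"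
    by (intro exI[of _ "\<lambda>_. 0"]) simp
  show "symp (\<lambda>u v. u \<in> real_L2 \<and> v \<in> real_L2 \<and> (AE x in lborel. u x = v x))"
    by (intro sympI) (auto elim: AE_mp)
  show "transp (\<lambda>u v. u \<in> real_L2 \<and> v \<in> real_L2 \<and> (AE x in lborel. u x = v x))"
  proof (intro transpI, elim conjE, intro conjI)
    fix x y z :: "real \<Rightarrow> real" assume "AE t in lborel. x t = y t" "AE t in lborel. y t = z t"
    then show "AE t in lborel. x t = z t" by eventually_elim simp
  qed
qed

abbreviation (input) cls :: "(real \<Rightarrow> real) \<Rightarrow> rl2" where "cls \<equiv> abs_rl2"

lemma rep_in_L2 [simp, intro]: "rep_rl2 x \<in> real_L2"
  using Quotient3_rep_reflp[OF Quotient3_rl2, of x] by blast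

lemma abs_rep [simp]: "cls (rep_rl2 x) = x"
  using Quotient3_abs_rep[OF Quotient3_rl2] .

lemma cls_eq_iff: "u \<in> real_L2 \<Longrightarrow> v \<in> real_L2 \<Longrightarrow> cls u = cls v \<longleftrightarrow> (AE x in lborel. u x = v x)"
  using Quotient3_rel[OF Quotient3_rl2, of u v] by auto

lemma AE_rep_cls: "u \<in> real_L2 \<Longrightarrow> AE x in lborel. rep_rl2 (cls u) x = u x"
  using cls_eq_iff[of "rep_rl2 (cls u)" u] by simp

lemma rep_measurable [measurable]: "rep_rl2 x \<in> borel_measurable borel"
  by (rule real_L2_measurable) simp

instantiation rl2 :: real_inner
begin

definition zero_rl2 :: rl2 where "0 = cls (\<lambda>_. 0)"
definition plus_rl2 :: "rl2 \<Rightarrow> rl2 \<Rightarrow> rl2" where "x + y = cls (\<lambda>t. rep_rl2 x t + rep_rl2 y t)"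
definition minus_rl2 :: "rl2 \<Rightarrow> rl2 \<Rightarrow> rl2" where "x - y = cls (\<lambda>t. rep_rl2 x t - rep_rl2 y t)"
definition uminus_rl2 :: "rl2 \<Rightarrow> rl2" where "- x = cls (\<lambda>t. - 1 * rep_rl2 x t)"
definition scaleR_rl2 :: "real \<Rightarrow> rl2 \<Rightarrow> rl2" where "c *\<^sub>R x = cls (\<lambda>t. c * rep_rl2 x t)"
definition inner_rl2 :: "rl2 \<Rightarrow> rl2 \<Rightarrow> real" where "x \<bullet> y = (LINT t|lborel. rep_rl2 x t * rep_rl2 y t)"
definition norm_rl2 :: "rl2 \<Rightarrow> real" where "norm x = sqrt (x \<bullet> x)" for x :: rl2
definition sgn_rl2 :: "rl2 \<Rightarrow> rl2" where "sgn x = inverse (norm x) *\<^sub>R x" for x :: rl2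
definition dist_rl2 :: "rl2 \<Rightarrow> rl2 \<Rightarrow> real" where "dist x y = norm (x - y)" for x y :: rl2
definition uniformity_rl2 :: "(rl2 \<times> rl2) filter"
  where "uniformity_rl2 = (INF e\<in>{0<..}. principal {(x, y). dist x y < e})"
definition open_rl2 :: "rl2 set \<Rightarrow> bool"
  where "open_rl2 U \<longleftrightarrow> (\<forall>x\<in>U. eventually (\<lambda>(x', y). x' = x \<longrightarrow> y \<in> U) uniformity)"

lemma cls_add: "u \<in> real_L2 \<Longrightarrow> v \<in> real_L2 \<Longrightarrow> cls u + cls v = cls (\<lambda>t. u t + v t)"
  unfolding plus_rl2_def using AE_rep_cls[of u] AE_rep_cls[of v]
  by (subst cls_eq_iff) (auto elim: eventually_elim2)

lemma cls_diff: "u \<in> real_L2 \<Longrightarrow> v \<in> real_L2 \<Longrightarrow> cls u - cls v = cls (\<lambda>t. u t - v t)"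
  unfolding minus_rl2_def using AE_rep_cls[of u] AE_rep_cls[of v]
  by (subst cls_eq_iff) (auto elim: eventually_elim2)

lemma cls_scaleR: "u \<in> real_L2 \<Longrightarrow> c *\<^sub>R cls u = cls (\<lambda>t. c * u t)"
  unfolding scaleR_rl2_def using AE_rep_cls[of u]
  by (subst cls_eq_iff) auto

lemma cls_uminus: "u \<in> real_L2 \<Longrightarrow> - cls u = cls (\<lambda>t. - 1 * u t)"
  using cls_scaleR[of u "-1"] by (simp only: scaleR_rl2_def uminus_rl2_def)

lemma inner_cls: "u \<in> real_L2 \<Longrightarrow> v \<in> real_L2 \<Longrightarrow> cls u \<bullet> cls v = (LINT t|lborel. u t * v t)"
  unfolding inner_rl2_def using AE_rep_cls[of u] AE_rep_cls[of v]
  by (intro integral_cong_AE) (auto intro!: borel_measurable_times dest: real_L2_measurable elim: eventually_elim2)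

instance
proof
  fix x y z :: rl2 and a b :: real
  obtain u v w where uvw: "u \<in> real_L2" "v \<in> real_L2" "w \<in> real_L2" "x = cls u" "y = cls v" "z = cls w"
    using rep_in_L2 abs_rep by metis
  note [simp] = uvw(4-6) cls_add cls_diff cls_scaleR cls_uminus inner_cls zero_rl2_def
    uvw(1-3)[THEN real_L2_scale] real_L2_add[OF uvw(1,2)] real_L2_add[OF uvw(2,3)] real_L2_add[OF uvw(2,1)] uvw(1-3)
  show "x - y = x + - y"
    using real_L2_scale[OF uvw(2), of "-1"] by simp
  show "x + y + z = x + (y + z)" by (simp add: add.assoc)
  show "x + y = y + x" by (simp add: add.commute)
  show "0 + x = x" by simp
  show "- x + x = 0" using real_L2_scale[OF uvw(1), of "-1"] by simp
  show "a *\<^sub>R (x + y) = a *\<^sub>R x + a *\<^sub>R y" by (simp add: distrib_left)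
  show "(a + b) *\<^sub>R x = a *\<^sub>R x + b *\<^sub>R x" by (simp add: distrib_right)
  show "a *\<^sub>R b *\<^sub>R x = (a * b) *\<^sub>R x" by (simp add: mult.assoc)
  show "1 *\<^sub>R x = x" by simp
  show "dist x y = norm (x - y)" by (simp only: dist_rl2_def)
  show "sgn x = inverse (norm x) *\<^sub>R x" by (simp only: sgn_rl2_def)
  show "uniformity = (INF e\<in>{0<..}. principal {(x, y). dist (x::rl2) y < e})" by (rule uniformity_rl2_def)
  show "open U \<longleftrightarrow> (\<forall>x\<in>U. \<forall>\<^sub>F (x', y) in uniformity. x' = x \<longrightarrow> y \<in> U)" for U :: "rl2 set"
    by (rule open_rl2_def)
  show "x \<bullet> y = y \<bullet> x" by (simp add: mult.commute)
  show "(x + y) \<bullet> z = x \<bullet> z + y \<bullet> z"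
    by (simp add: distrib_right real_L2_integrable_mult)
  show "(a *\<^sub>R x) \<bullet> y = a * (x \<bullet> y)" by (simp add: mult.assoc)
  show "0 \<le> x \<bullet> x" by simp
  show "x \<bullet> x = 0 \<longleftrightarrow> x = 0"
    using integral_nonneg_eq_0_iff_AE[OF real_L2_integrable_mult[OF uvw(1,1)]]
    by (simp add: cls_eq_iff)
  show "norm x = sqrt (x \<bullet> x)" by (rule norm_rl2_def)
qed

end

lemma norm_sq_cls: "u \<in> real_L2 \<Longrightarrow> (norm (cls u))\<^sup>2 = (LINT t|lborel. (u t)\<^sup>2)"
  by (simp add: power2_norm_eq_inner inner_cls) (simp add: power2_eq_square)

text \<open>
  Pointwise \<open>\<bar>d k t\<bar> \<le> 4 ^ k (d k t)\<^sup>2 + (1 / 4) ^ k\<close>, and the first terms have a finite sum of integrals. This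
  replaces the triangle inequality for infinite sums of norms in the proof of completeness.
\<close>

lemma AE_pointwise_summable:
  fixes d :: "nat \<Rightarrow> real \<Rightarrow> real"
  assumes d: "\<And>k. d k \<in> real_L2" and small: "\<And>k. (LINT t|lborel. (d k t)\<^sup>2) \<le> (1/16)^k"
  shows "AE t in lborel. summable (\<lambda>k. d k t)"
proof -
  have [measurable]: "d k \<in> borel_measurable borel" for k using d by (rule real_L2_measurable)
  have "(\<integral>\<^sup>+t. (\<Sum>k. ennreal (4^k * (d k t)\<^sup>2)) \<partial>lborel) = (\<Sum>k. \<integral>\<^sup>+t. ennreal (4^k * (d k t)\<^sup>2) \<partial>lborel)"
    by (intro nn_integral_suminf) measurable
  also have "\<dots> \<le> (\<Sum>k. ennreal ((1/4)^k))"
  proof (intro suminf_le summableI)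
    fix k
    have "(\<integral>\<^sup>+t. ennreal (4^k * (d k t)\<^sup>2) \<partial>lborel) = ennreal (LINT t|lborel. 4^k * (d k t)\<^sup>2)"
      by (intro nn_integral_eq_integral integrable_mult_right real_L2_integrable_square d) auto
    also have "(LINT t|lborel. 4^k * (d k t)\<^sup>2) \<le> 4^k * (1/16)^k"
      using small[of k] by simp
    also have "(4::real)^k * (1/16)^k = (1/4)^k" by (simp flip: power_mult_distrib)
    finally show "(\<integral>\<^sup>+t. ennreal (4^k * (d k t)\<^sup>2) \<partial>lborel) \<le> ennreal ((1/4)^k)"
      by (simp add: ennreal_leI)
  qed
  also have "\<dots> = ennreal (\<Sum>k. (1/4)^k)" by (intro suminf_ennreal2) (auto intro: summable_geometric)
  also have "\<dots> < \<infinity>" by simp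
  finally have "AE t in lborel. (\<Sum>k. ennreal (4^k * (d k t)\<^sup>2)) \<noteq> \<infinity>"
    by (intro nn_integral_PInf_AE) auto
  then show ?thesis
  proof eventually_elim
    fix t assume "(\<Sum>k. ennreal (4^k * (d k t)\<^sup>2)) \<noteq> \<infinity>"
    then have s1: "summable (\<lambda>k. 4^k * (d k t)\<^sup>2)" by (intro summable_suminf_not_top) auto
    have "summable (\<lambda>k. 4^k * (d k t)\<^sup>2 + (1/4)^k)" by (intro summable_add s1 summable_geometric) auto
    then show "summable (\<lambda>k. d k t)"
    proof (rule summable_comparison_test')
      fix k
      have "2 * (2^k * \<bar>d k t\<bar>) * (1/2)^k \<le> (2^k * \<bar>d k t\<bar>)\<^sup>2 + ((1/2)^k)\<^sup>2" by (rule sum_squares_bound)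
      moreover have "2 * (2^k * \<bar>d k t\<bar>) * (1/2)^k = 2 * \<bar>d k t\<bar>" by (simp add: power_one_over)
      moreover have "(2^k * \<bar>d k t\<bar>)\<^sup>2 = 4^k * (d k t)\<^sup>2"
      proof -
        have "((2::real)^k)\<^sup>2 = 4^k" by (simp add: power2_eq_square flip: power_mult_distrib)
        then show ?thesis by (simp add: power_mult_distrib)
      qed
      moreover have "((1/2::real)^k)\<^sup>2 = (1/4)^k" by (simp add: power2_eq_square flip: power_mult_distrib)
      ultimately show "norm (d k t) \<le> 4^k * (d k t)\<^sup>2 + (1/4)^k" by simp
    qed
  qed
qed

text \<open>
  Completeness (Riesz and Fischer): a fast subsequence converges almost everywhere, and Fatou's lemma
  turns the Cauchy property into convergence to the pointwise limit.
\<close>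

instance rl2 :: complete_space
proof
  fix X :: "nat \<Rightarrow> rl2" assume X: "Cauchy X"
  define f where "f n = rep_rl2 (X n)" for n
  have f: "f n \<in> real_L2" "cls (f n) = X n" for n by (simp_all add: f_def)
  have [measurable]: "f n \<in> borel_measurable borel" for n using f(1) by (rule real_L2_measurable)
  have dist: "(LINT t|lborel. (f m t - f n t)\<^sup>2) = (norm (X m - X n))\<^sup>2" for m n
    using norm_sq_cls[OF real_L2_diff[OF f(1)[of m] f(1)[of n]]] cls_diff[OF f(1)[of m] f(1)[of n]]
    by (simp add: f(2))
  have "\<exists>N. \<forall>m\<ge>N. \<forall>n\<ge>N. norm (X m - X n) < (1/4)^k" for k
    using metric_CauchyD[OF X, of "(1/4)^k"] by (simp add: dist_norm)
  then obtain N where N: "\<And>k m n. m \<ge> N k \<Longrightarrow> n \<ge> N k \<Longrightarrow> norm (X m - X n) < (1/4)^k" by metis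
  \<comment> \<open>at least \<open>N j\<close> for all \<open>j \<le> k\<close>, and at least \<open>k\<close>\<close>
  define r where "r k = k + (\<Sum>j\<le>k. N j)" for k
  have rN: "N k \<le> r k" "N k \<le> r (Suc k)" "k \<le> r k" for k
    unfolding r_def using member_le_sum[of k "{..k}" N] by auto
  define d where "d k t = f (r (Suc k)) t - f (r k) t" for k t
  have "AE t in lborel. summable (\<lambda>k. d k t)"
  proof (rule AE_pointwise_summable)
    show "d k \<in> real_L2" for k unfolding d_def using f by auto
    show "(LINT t|lborel. (d k t)\<^sup>2) \<le> (1/16)^k" for k
    proof -
      have "(norm (X (r (Suc k)) - X (r k)))\<^sup>2 \<le> ((1/4)^k)\<^sup>2"
        using N[of k "r (Suc k)" "r k"] rN[of k] by (intro power_mono) auto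
      also have "((1/4::real)^k)\<^sup>2 = (1/16)^k" by (simp add: power2_eq_square flip: power_mult_distrib)
      finally show ?thesis unfolding d_def dist .
    qed
  qed
  define u where "u t = lim (\<lambda>k. f (r k) t)" for t
  have [measurable]: "u \<in> borel_measurable borel" unfolding u_def by measurable
  have lim: "AE t in lborel. (\<lambda>k. f (r k) t) \<longlonglongrightarrow> u t"
    using \<open>AE t in lborel. summable (\<lambda>k. d k t)\<close>
  proof eventually_elim
    fix t assume "summable (\<lambda>k. d k t)"
    moreover have "(\<Sum>k<n. d k t) = f (r n) t - f (r 0) t" for n
      unfolding d_def by (rule sum_lessThan_telescope)
    ultimately have "convergent (\<lambda>n. f (r n) t - f (r 0) t)" by (simp add: summable_iff_convergent)
    then have "convergent (\<lambda>n. f (r n) t)" by (simp add: convergent_diff_const_right_iff)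
    then show "(\<lambda>k. f (r k) t) \<longlonglongrightarrow> u t" by (simp add: u_def convergent_LIMSEQ_iff)
  qed
  have Fatou: "(\<integral>\<^sup>+t. ennreal ((u t - f m t)\<^sup>2) \<partial>lborel) \<le> ennreal (((1/4)^k)\<^sup>2)" if m: "m \<ge> N k" for m k
  proof -
    have "(\<integral>\<^sup>+t. ennreal ((u t - f m t)\<^sup>2) \<partial>lborel) = (\<integral>\<^sup>+t. liminf (\<lambda>j. ennreal ((f (r j) t - f m t)\<^sup>2)) \<partial>lborel)"
    proof (rule nn_integral_cong_AE, use lim in eventually_elim)
      fix t assume "(\<lambda>k. f (r k) t) \<longlonglongrightarrow> u t"
      then have "(\<lambda>j. ennreal ((f (r j) t - f m t)\<^sup>2)) \<longlonglongrightarrow> ennreal ((u t - f m t)\<^sup>2)"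
        by (intro tendsto_intros)
      then have "liminf (\<lambda>j. ennreal ((f (r j) t - f m t)\<^sup>2)) = ennreal ((u t - f m t)\<^sup>2)"
        by (rule lim_imp_Liminf[OF sequentially_bot])
      then show "ennreal ((u t - f m t)\<^sup>2) = liminf (\<lambda>j. ennreal ((f (r j) t - f m t)\<^sup>2))" ..
    qed
    also have "\<dots> \<le> liminf (\<lambda>j. \<integral>\<^sup>+t. ennreal ((f (r j) t - f m t)\<^sup>2) \<partial>lborel)"
      by (intro nn_integral_liminf) measurable
    also have "\<dots> \<le> ennreal (((1/4)^k)\<^sup>2)"
    proof (rule Liminf_le)
      show "\<forall>\<^sub>F j in sequentially. (\<integral>\<^sup>+t. ennreal ((f (r j) t - f m t)\<^sup>2) \<partial>lborel) \<le> ennreal (((1/4)^k)\<^sup>2)"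
        unfolding eventually_sequentially
      proof (intro exI[of _ "N k"] allI impI)
        fix j assume "j \<ge> N k"
        then have "r j \<ge> N k" using rN(3)[of j] by linarith
        have "(\<integral>\<^sup>+t. ennreal ((f (r j) t - f m t)\<^sup>2) \<partial>lborel) = ennreal ((norm (X (r j) - X m))\<^sup>2)"
          unfolding dist[symmetric] using f
          by (intro nn_integral_eq_integral real_L2_integrable_square real_L2_diff) auto
        also have "\<dots> \<le> ennreal (((1/4)^k)\<^sup>2)"
          using N[OF \<open>r j \<ge> N k\<close> m] by (intro ennreal_leI power_mono) auto
        finally show "(\<integral>\<^sup>+t. ennreal ((f (r j) t - f m t)\<^sup>2) \<partial>lborel) \<le> ennreal (((1/4)^k)\<^sup>2)" .
      qed
    qed simp
    finally show ?thesis .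
  qed
  have diffL2: "(\<lambda>t. u t - f m t) \<in> real_L2" if "m \<ge> N k" for m k
  proof -
    have "integrable lborel (\<lambda>t. (u t - f m t)\<^sup>2)"
      using le_less_trans[OF Fatou[OF that] ennreal_less_top] by (intro integrableI_bounded) auto
    then show ?thesis by (simp add: real_L2_def)
  qed
  have uL2: "u \<in> real_L2" using real_L2_add[OF diffL2[of 0 "N 0"] f(1)[of "N 0"]] by simp
  have close: "norm (X m - cls u) \<le> (1/4)^k" if "m \<ge> N k" for m k
  proof -
    have "(norm (cls u - X m))\<^sup>2 = (LINT t|lborel. (u t - f m t)\<^sup>2)"
      using norm_sq_cls[OF diffL2[OF that]] cls_diff[OF uL2 f(1)[of m]] f(2)[of m] by simp
    also have "\<dots> \<le> ((1/4)^k)\<^sup>2"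
      using Fatou[OF that] nn_integral_eq_integral[OF real_L2_integrable_square[OF diffL2[OF that]]]
      by (simp add: ennreal_le_iff)
    finally show ?thesis by (simp add: abs_le_square_iff[symmetric] norm_minus_commute)
  qed
  have "X \<longlonglongrightarrow> cls u"
  proof (rule LIMSEQ_I)
    fix e :: real assume "0 < e"
    then obtain k where k: "(1/4)^k < e" using real_arch_pow_inv[of e "1/4"] by auto
    then show "\<exists>no. \<forall>n\<ge>no. norm (X n - cls u) < e"
      using close[of k] by (intro exI[of _ "N k"]) (meson le_less_trans)
  qed
  then show "convergent X" by (auto simp: convergent_def)
qed

text \<open>
  Needed to express multiplication by the unbounded function \<open>sqrt V\<close> through bounded operators.
\<close>

lemma bounded_linear_multiplier:
  assumes [measurable]: "\<phi> \<in> borel_measurable borel" and bound: "\<And>t. \<bar>\<phi> t\<bar> \<le> 1"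
  shows "bounded_linear (\<lambda>x. cls (\<lambda>t. \<phi> t * rep_rl2 x t))"
    "u \<in> real_L2 \<Longrightarrow> (\<lambda>t. \<phi> t * u t) \<in> real_L2"
    "u \<in> real_L2 \<Longrightarrow> cls (\<lambda>t. \<phi> t * rep_rl2 (cls u) t) = cls (\<lambda>t. \<phi> t * u t)"
proof -
  show L2: "(\<lambda>t. \<phi> t * u t) \<in> real_L2" if "u \<in> real_L2" for u
    by (rule real_L2_dominated[OF that])
      (use that bound in \<open>auto dest: real_L2_measurable simp: abs_mult intro: mult_left_le_one_le\<close>)
  show cong: "cls (\<lambda>t. \<phi> t * rep_rl2 (cls u) t) = cls (\<lambda>t. \<phi> t * u t)" if "u \<in> real_L2" for u
    using AE_rep_cls[OF that] L2 that by (subst cls_eq_iff) auto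
  have ex: "\<exists>u\<in>real_L2. x = cls u" for x using rep_in_L2 abs_rep by metis
  show "bounded_linear (\<lambda>x. cls (\<lambda>t. \<phi> t * rep_rl2 x t))"
  proof (rule bounded_linear_intro[where K = 1])
    fix x y :: rl2 and c :: real
    obtain u v where uv: "u \<in> real_L2" "v \<in> real_L2" "x = cls u" "y = cls v" using ex by metis
    have "(\<lambda>t. \<phi> t * (u t + v t)) \<in> real_L2" by (intro L2 real_L2_add uv)
    then show "cls (\<lambda>t. \<phi> t * rep_rl2 (x + y) t) = cls (\<lambda>t. \<phi> t * rep_rl2 x t) + cls (\<lambda>t. \<phi> t * rep_rl2 y t)"
      using uv by (simp add: cls_add cong L2 real_L2_add distrib_left)
    show "cls (\<lambda>t. \<phi> t * rep_rl2 (c *\<^sub>R x) t) = c *\<^sub>R cls (\<lambda>t. \<phi> t * rep_rl2 x t)"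
      using uv by (simp add: cls_scaleR cong L2 real_L2_scale mult.left_commute)
    have "(norm (cls (\<lambda>t. \<phi> t * u t)))\<^sup>2 \<le> (norm (cls u))\<^sup>2"
      unfolding norm_sq_cls[OF L2[OF uv(1)]] norm_sq_cls[OF uv(1)]
    proof (intro integral_mono real_L2_integrable_square L2 uv)
      fix t
      have "\<bar>\<phi> t * u t\<bar> \<le> \<bar>u t\<bar>" using bound by (auto simp: abs_mult intro: mult_left_le_one_le)
      then show "(\<phi> t * u t)\<^sup>2 \<le> (u t)\<^sup>2" by (simp add: abs_le_square_iff)
    qed
    then show "norm (cls (\<lambda>t. \<phi> t * rep_rl2 x t)) \<le> norm x * 1"
      using uv by (simp add: cong)
  qed
qed

section \<open>Absolutely continuous functions on an interval\<close>

text \<open>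
  The two integrals extend over the two triangles into which the diagonal divides the plane.
\<close>

lemma Fubini_triangles:
  fixes f g :: "real \<Rightarrow> real"
  assumes f: "integrable lborel f" and g: "integrable lborel g"
  defines "\<Phi> \<equiv> \<lambda>x. LINT t|lborel. f t * indicator {..x} t"
  defines "\<Gamma> \<equiv> \<lambda>x. LINT t|lborel. g t * indicator {..x} t"
  shows "integrable lborel (\<lambda>x. f x * \<Gamma> x)" "integrable lborel (\<lambda>x. \<Phi> x * g x)"
    "(LINT x|lborel. f x * \<Gamma> x) + (LINT x|lborel. \<Phi> x * g x) = (LINT x|lborel. f x) * (LINT x|lborel. g x)"
proof -
  have [measurable]: "f \<in> borel_measurable borel" "g \<in> borel_measurable borel"
    using f g by (auto dest: borel_measurable_integrable)
  define h where "h p = f (fst p) * g (snd p)" for p :: "real \<times> real"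
  have [measurable]: "h \<in> borel_measurable (lborel \<Otimes>\<^sub>M lborel)" unfolding h_def by measurable
  have h: "integrable (lborel \<Otimes>\<^sub>M lborel) h"
  proof (rule lborel_pair.Fubini_integrable)
    show "integrable lborel (\<lambda>x. LINT y|lborel. norm (h (x, y)))"
      using f g by (simp add: h_def abs_mult)
    show "AE x in lborel. integrable lborel (\<lambda>y. h (x, y))" using g by (simp add: h_def)
  qed measurable
  define A where "A = {p :: real \<times> real. snd p \<le> fst p}"
  define B where "B = {p :: real \<times> real. fst p \<le> snd p}"
  have meas: "A \<in> sets (lborel \<Otimes>\<^sub>M lborel)" "B \<in> sets (lborel \<Otimes>\<^sub>M lborel)"
    unfolding A_def B_def lborel_prod sets_lborel
    by (intro borel_closed closed_Collect_le continuous_intros)+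
  have hA: "integrable (lborel \<Otimes>\<^sub>M lborel) (case_prod (\<lambda>s t. f s * g t * indicator {..s} t))"
    using integrable_mult_indicator[OF meas(1) h]
    by (rule Bochner_Integration.integrable_cong[THEN iffD1, rotated -1])
       (auto simp: h_def A_def split: split_indicator)
  have hB: "integrable (lborel \<Otimes>\<^sub>M lborel) (case_prod (\<lambda>s t. f s * g t * indicator {..t} s))"
    using integrable_mult_indicator[OF meas(2) h]
    by (rule Bochner_Integration.integrable_cong[THEN iffD1, rotated -1])
       (auto simp: h_def B_def split: split_indicator)
  show i1: "integrable lborel (\<lambda>x. f x * \<Gamma> x)"
    using lborel_pair.integrable_fst[OF hA] by (simp add: \<Gamma>_def mult.assoc)
  have \<Phi>g: "\<Phi> t * g t = (LINT s|lborel. f s * g t * indicator {..t} s)" for t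
  proof -
    have "\<Phi> t * g t = (LINT s|lborel. f s * indicator {..t} s * g t)" by (simp add: \<Phi>_def)
    also have "\<dots> = (LINT s|lborel. f s * g t * indicator {..t} s)"
      by (rule Bochner_Integration.integral_cong[OF refl]) (simp only: mult_ac)
    finally show ?thesis .
  qed
  show i2: "integrable lborel (\<lambda>x. \<Phi> x * g x)"
    unfolding \<Phi>g by (rule lborel_pair.integrable_snd[OF hB])
  have "(LINT t|lborel. \<Phi> t * g t) = (LINT t|lborel. LINT s|lborel. f s * g t * indicator {..t} s)"
    unfolding \<Phi>g ..
  also have "\<dots> = (LINT s|lborel. LINT t|lborel. f s * g t * indicator {..t} s)"
    by (rule lborel_pair.Fubini_integral[OF hB])
  finally have e2: "(LINT t|lborel. \<Phi> t * g t) = (LINT s|lborel. LINT t|lborel. f s * g t * indicator {..t} s)" .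
  have e1: "(LINT s|lborel. f s * \<Gamma> s) = (LINT s|lborel. LINT t|lborel. f s * g t * indicator {..s} t)"
    by (simp add: \<Gamma>_def mult.assoc)
  have "(LINT s|lborel. f s * \<Gamma> s) + (LINT t|lborel. \<Phi> t * g t) =
    (LINT s|lborel. (LINT t|lborel. f s * g t * indicator {..s} t) + (LINT t|lborel. f s * g t * indicator {..t} s))"
    unfolding e1 e2 by (intro Bochner_Integration.integral_add[symmetric] lborel_pair.integrable_fst[OF hA] lborel_pair.integrable_fst[OF hB])
  also have "\<dots> = (LINT s|lborel. f s * (LINT t|lborel. g t))"
  proof (rule Bochner_Integration.integral_cong[OF refl])
    fix s
    have "(LINT t|lborel. f s * g t * indicator {..s} t) + (LINT t|lborel. f s * g t * indicator {..t} s) =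
          (LINT t|lborel. f s * g t * indicator {..s} t + f s * g t * indicator {..t} s)"
    proof (rule Bochner_Integration.integral_add[symmetric])
      show "integrable lborel (\<lambda>t. f s * g t * indicator {..s} t)"
        using g by (intro integrable_real_mult_indicator integrable_mult_right) auto
      have "integrable lborel (\<lambda>t. f s * g t * indicator {s..} t)"
        using g by (intro integrable_real_mult_indicator integrable_mult_right) auto
      then show "integrable lborel (\<lambda>t. f s * g t * indicator {..t} s)" by (simp add: indicator_def)
    qed
    also have "\<dots> = (LINT t|lborel. f s * g t)"
    proof (rule integral_cong_AE)
      show "(\<lambda>t. f s * g t * indicator {..s} t + f s * g t * indicator {..t} s) \<in> borel_measurable lborel"
      proof -
        have "(\<lambda>t. f s * g t * indicator {..s} t + f s * g t * indicator {s..} t) \<in> borel_measurable lborel"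
          by measurable
        then show ?thesis by (simp add: indicator_def)
      qed
      have "AE t in lborel. t \<noteq> s" by (rule AE_lborel_singleton)
      then show "AE t in lborel. f s * g t * indicator {..s} t + f s * g t * indicator {..t} s = f s * g t"
        by eventually_elim (auto simp: indicator_def)
    qed measurable
    finally show "(LINT t|lborel. f s * g t * indicator {..s} t) + (LINT t|lborel. f s * g t * indicator {..t} s) =
       f s * (LINT t|lborel. g t)" by simp
  qed
  finally show "(LINT x|lborel. f x * \<Gamma> x) + (LINT x|lborel. \<Phi> x * g x) = (LINT x|lborel. f x) * (LINT x|lborel. g x)"
    by simp
qed

text \<open>
  \<open>F\<close> is absolutely continuous on the interval with derivative \<open>f\<close> almost everywhere.
\<close>

definition primitive_on :: "real \<Rightarrow> real \<Rightarrow> (real \<Rightarrow> real) \<Rightarrow> (real \<Rightarrow> real) \<Rightarrow> bool" where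
  "primitive_on a b f F \<longleftrightarrow> set_integrable lborel {a..b} f \<and>
     (\<forall>x\<in>{a..b}. F x = F a + (LINT t:{a..x}|lborel. f t))"

lemma primitive_onD: "primitive_on a b f F \<Longrightarrow> x \<in> {a..b} \<Longrightarrow> F x = F a + (LINT t:{a..x}|lborel. f t)"
  unfolding primitive_on_def by blast

lemma primitive_on_integral: "primitive_on a b f F \<Longrightarrow> a \<le> b \<Longrightarrow> (LINT t:{a..b}|lborel. f t) = F b - F a"
  using primitive_onD[of a b f F b] by simp

lemma set_integral_Icc_split:
  fixes f :: "real \<Rightarrow> real"
  assumes f: "set_integrable lborel {a..c} f" and "a \<le> b" "b \<le> c"
  shows "(LINT t:{a..c}|lborel. f t) = (LINT t:{a..b}|lborel. f t) + (LINT t:{b..c}|lborel. f t)"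
proof -
  have "{a..c} = {a..b} \<union> {b..c}" using assms by auto
  moreover have "(LINT t:{a..b} \<union> {b..c}|lborel. f t) = (LINT t:{a..b}|lborel. f t) + (LINT t:{b..c}|lborel. f t)"
  proof (rule set_integral_Un_AE)
    have "AE t in lborel. t \<noteq> b" by (rule AE_lborel_singleton)
    then show "AE x in lborel. \<not> (x \<in> {a..b} \<and> x \<in> {b..c})" by eventually_elim auto
  qed (use assms in \<open>auto intro: set_integrable_subset\<close>)
  ultimately show ?thesis by simp
qed

lemma primitive_on_subinterval:
  assumes p: "primitive_on a b f F" and "a \<le> c" "d \<le> b"
  shows "primitive_on c d f F"
proof (cases "c \<le> d")
  case True
  have f: "set_integrable lborel {a..b} f" using p by (simp add: primitive_on_def)
  have "F x = F c + (LINT t:{c..x}|lborel. f t)" if "x \<in> {c..d}" for x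
  proof -
    have "F x = F a + (LINT t:{a..x}|lborel. f t)" "F c = F a + (LINT t:{a..c}|lborel. f t)"
      using primitive_onD[OF p, of x] primitive_onD[OF p, of c] that assms by auto
    moreover have "(LINT t:{a..x}|lborel. f t) = (LINT t:{a..c}|lborel. f t) + (LINT t:{c..x}|lborel. f t)"
      using that assms by (intro set_integral_Icc_split set_integrable_subset[OF f]) auto
    ultimately show ?thesis by simp
  qed
  moreover have "set_integrable lborel {c..d} f" using assms by (intro set_integrable_subset[OF f]) auto
  ultimately show ?thesis unfolding primitive_on_def by blast
next
  case False
  then show ?thesis by (simp add: primitive_on_def set_integrable_def)
qed

lemma primitive_on_C1:
  assumes "\<And>x. x \<in> {a..b} \<Longrightarrow> (F has_real_derivative f x) (at x)" "continuous_on {a..b} f"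
  shows "primitive_on a b f F"
  unfolding primitive_on_def
proof (intro conjI ballI)
  show "set_integrable lborel {a..b} f" using assms(2) by (rule borel_integrable_atLeastAtMost')
  fix x assume x: "x \<in> {a..b}"
  have "(LINT t:{a..x}|lborel. f t) = F x - F a"
    unfolding set_lebesgue_integral_def
  proof (rule integral_FTC_atLeastAtMost)
    fix y assume "a \<le> y" "y \<le> x"
    then have "(F has_real_derivative f y) (at y)" using assms(1) x by auto
    then show "(F has_vector_derivative f y) (at y within {a..x})"
      by (simp add: has_real_derivative_iff_has_vector_derivative has_vector_derivative_at_within)
  qed (use x continuous_on_subset[OF assms(2)] in auto)
  then show "F x = F a + (LINT t:{a..x}|lborel. f t)" by simp
qed

text \<open>
  The product rule for absolutely continuous functions is Fubini's theorem for the product of the two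
  derivatives on a square, cut along its diagonal.
\<close>

lemma primitive_on_mult:
  assumes F: "primitive_on a b f F" and G: "primitive_on a b g G"
  shows "primitive_on a b (\<lambda>x. f x * G x + F x * g x) (\<lambda>x. F x * G x)"
proof -
  have base: "set_integrable lborel {a..b} (\<lambda>x. f x * G x + F x * g x) \<and>
      (LINT t:{a..b}|lborel. f t * G t + F t * g t) = F b * G b - F a * G a"
    if "a \<le> b" "primitive_on a b f F" "primitive_on a b g G" for b
  proof -
    define f1 where "f1 x = indicator {a..b} x * f x" for x
    define g1 where "g1 x = indicator {a..b} x * g x" for x
    define \<Phi> where "\<Phi> x = (LINT t|lborel. f1 t * indicator {..x} t)" for x
    define \<Gamma> where "\<Gamma> x = (LINT t|lborel. g1 t * indicator {..x} t)" for x
    have i: "integrable lborel f1" "integrable lborel g1"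
      using that unfolding primitive_on_def f1_def g1_def set_integrable_def by auto
    note T = Fubini_triangles[OF i, folded \<Phi>_def \<Gamma>_def]
    have FF: "F x = F a + \<Phi> x" and GG: "G x = G a + \<Gamma> x" if "x \<in> {a..b}" for x
    proof -
      have "(\<lambda>t. f1 t * indicator {..x} t) = (\<lambda>t. indicator {a..x} t *\<^sub>R f t)"
        "(\<lambda>t. g1 t * indicator {..x} t) = (\<lambda>t. indicator {a..x} t *\<^sub>R g t)"
        using that by (auto simp: fun_eq_iff f1_def g1_def split: split_indicator)
      then show "F x = F a + \<Phi> x" "G x = G a + \<Gamma> x"
        using primitive_onD[OF \<open>primitive_on a b f F\<close> that] primitive_onD[OF \<open>primitive_on a b g G\<close> that]
        unfolding \<Phi>_def \<Gamma>_def set_lebesgue_integral_def by simp_all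
    qed
    have eq: "indicator {a..b} x *\<^sub>R (f x * G x + F x * g x) =
        G a * f1 x + f1 x * \<Gamma> x + (F a * g1 x + \<Phi> x * g1 x)" for x
      using FF[of x] GG[of x] by (cases "x \<in> {a..b}") (simp_all add: f1_def g1_def algebra_simps)
    have int: "(LINT x|lborel. f1 x) = F b - F a" "(LINT x|lborel. g1 x) = G b - G a"
      using primitive_on_integral[OF that(2,1)] primitive_on_integral[OF that(3,1)]
      by (simp_all add: f1_def g1_def set_lebesgue_integral_def)
    have "integrable lborel (\<lambda>x. indicator {a..b} x *\<^sub>R (f x * G x + F x * g x))"
      unfolding eq using i T(1,2) by (intro Bochner_Integration.integrable_add integrable_mult_right)
    moreover have "(LINT x|lborel. indicator {a..b} x *\<^sub>R (f x * G x + F x * g x)) = F b * G b - F a * G a"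
    proof -
      have "(LINT x|lborel. indicator {a..b} x *\<^sub>R (f x * G x + F x * g x)) =
        G a * (LINT x|lborel. f1 x) + (LINT x|lborel. f1 x * \<Gamma> x) + (F a * (LINT x|lborel. g1 x) + (LINT x|lborel. \<Phi> x * g1 x))"
        unfolding eq using i T(1,2) by simp
      also have "\<dots> = G a * (F b - F a) + F a * (G b - G a) + (F b - F a) * (G b - G a)"
        using T(3) unfolding int by simp
      finally show ?thesis by (simp add: algebra_simps)
    qed
    ultimately show ?thesis by (simp add: set_integrable_def set_lebesgue_integral_def)
  qed
  show ?thesis
  proof (cases "a \<le> b")
    case True
    have "F x * G x = F a * G a + (LINT t:{a..x}|lborel. f t * G t + F t * g t)" if "x \<in> {a..b}" for x
      using base[of x] primitive_on_subinterval[OF F, of a x] primitive_on_subinterval[OF G, of a x] that by auto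
    then show ?thesis using base[OF True F G] unfolding primitive_on_def by blast
  qed (simp add: primitive_on_def set_integrable_def)
qed

lemma primitive_on_continuous:
  assumes "primitive_on a b f F" shows "continuous_on {a..b} F"
proof -
  have f: "set_integrable lborel {a..b} f" using assms by (simp add: primitive_on_def)
  have "f integrable_on {a..b}" using set_borel_integral_eq_integral(1)[OF f] .
  then have "continuous_on {a..b} (\<lambda>x. F a + integral {a..x} f)"
    by (intro continuous_intros indefinite_integral_continuous_1)
  moreover have "F x = F a + integral {a..x} f" if "x \<in> {a..b}" for x
  proof -
    have "set_integrable lborel {a..x} f" using that by (intro set_integrable_subset[OF f]) auto
    from set_borel_integral_eq_integral(2)[OF this] primitive_onD[OF assms that] show ?thesis by simp
  qed
  ultimately show ?thesis by (metis (no_types, lifting) continuous_on_cong)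
qed

lemma primitive_on_cong:
  assumes "primitive_on a b f F" "\<And>x. x \<in> {a..b} \<Longrightarrow> F x = G x"
  shows "primitive_on a b f G"
proof (cases "a \<le> b")
  case True
  then have "F a = G a" using assms(2) by auto
  then show ?thesis using assms unfolding primitive_on_def by (metis)
qed (simp add: primitive_on_def set_integrable_def)

text \<open>
  The positive and the negative part of \<open>f\<close> are densities of two finite measures which agree on all
  half-lines, hence coincide.
\<close>

lemma AE_zero_of_tail_integrals:
  fixes f :: "real \<Rightarrow> real"
  assumes f: "integrable lborel f" and zero: "\<And>x. (LINT t:{x<..}|lborel. f t) = 0"
  shows "AE x in lborel. f x = 0"
proof -
  have [measurable]: "f \<in> borel_measurable borel" using f by (auto dest: borel_measurable_integrable)
  define p where "p x = max 0 (f x)" for x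
  define n where "n x = max 0 (- f x)" for x
  have ip: "integrable lborel p" "integrable lborel n"
    unfolding p_def n_def using f by auto
  have [measurable]: "p \<in> borel_measurable borel" "n \<in> borel_measurable borel" unfolding p_def n_def by measurable
  have pn: "f x = p x - n x" for x by (simp add: p_def n_def)
  have dens: "emeasure (density lborel (\<lambda>x. ennreal (q x))) {x<..} = ennreal (LINT t:{x<..}|lborel. q t)"
    if q: "integrable lborel q" "\<And>x. q x \<ge> 0" for q :: "real \<Rightarrow> real" and x
  proof -
    have [measurable]: "q \<in> borel_measurable borel" using q by (auto dest: borel_measurable_integrable)
    have "emeasure (density lborel (\<lambda>x. ennreal (q x))) {x<..} = (\<integral>\<^sup>+t. ennreal (q t) * indicator {x<..} t \<partial>lborel)"
      by (subst emeasure_density) auto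
    also have "\<dots> = (\<integral>\<^sup>+t. ennreal (indicator {x<..} t *\<^sub>R q t) \<partial>lborel)"
      by (intro nn_integral_cong) (auto split: split_indicator)
    also have "\<dots> = ennreal (LINT t:{x<..}|lborel. q t)"
      unfolding set_lebesgue_integral_def using q
      by (intro nn_integral_eq_integral integrable_mult_indicator) (auto simp: borel_open)
    finally show ?thesis .
  qed
  have eq: "(LINT t:{x<..}|lborel. p t) = (LINT t:{x<..}|lborel. n t)" for x
  proof -
    have "set_integrable lborel {x<..} p" "set_integrable lborel {x<..} n"
      unfolding set_integrable_def by (intro integrable_mult_indicator ip; simp)+
    then have "(LINT t:{x<..}|lborel. f t) = (LINT t:{x<..}|lborel. p t) - (LINT t:{x<..}|lborel. n t)"
      unfolding pn by (rule set_integral_diff)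
    then show ?thesis using zero[of x] by simp
  qed
  have "density lborel (\<lambda>x. ennreal (p x)) = density lborel (\<lambda>x. ennreal (n x))"
  proof (rule measure_eqI_lessThan)
    show "emeasure (density lborel (\<lambda>x. ennreal (p x))) {x<..} < \<infinity>" for x
      by (subst dens) (use ip in \<open>auto simp: p_def\<close>)
    show "emeasure (density lborel (\<lambda>x. ennreal (p x))) {x<..} = emeasure (density lborel (\<lambda>x. ennreal (n x))) {x<..}" for x
    proof -
      have "\<And>x. 0 \<le> p x" "\<And>x. 0 \<le> n x" by (simp_all add: p_def n_def)
      then show ?thesis using dens[OF ip(1)] dens[OF ip(2)] eq by simp
    qed
  qed auto
  then have "AE x in lborel. ennreal (p x) = ennreal (n x)"
    by (subst (asm) sigma_finite_measure.density_unique_iff[OF sigma_finite_lborel]) auto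
  then show ?thesis
  proof eventually_elim
    fix x assume eq: "ennreal (p x) = ennreal (n x)"
    have "0 \<le> p x" "0 \<le> n x" by (simp_all add: p_def n_def)
    then have "p x = n x" using eq by (simp add: ennreal_inj)
    then show "f x = 0" using pn[of x] by linarith
  qed
qed

section \<open>Weak derivatives and test functions\<close>

lemma real_L2_bounded_support:
  assumes "u \<in> borel_measurable borel" "\<And>x. \<bar>u x\<bar> \<le> C" "\<And>x. x \<notin> {a..b} \<Longrightarrow> u x = 0"
  shows "u \<in> real_L2"
proof -
  have "integrable lborel (\<lambda>x. indicator {a..b} x *\<^sub>R C\<^sup>2)"
    by (intro integrable_scaleR_left integrable_real_indicator) (auto simp: emeasure_lborel_Icc_eq)
  then have "integrable lborel (\<lambda>x. (u x)\<^sup>2)"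
  proof (rule Bochner_Integration.integrable_bound)
    show "(\<lambda>x. (u x)\<^sup>2) \<in> borel_measurable lborel" using assms(1) by simp
    have "(u x)\<^sup>2 \<le> C\<^sup>2" for x using power_mono[OF assms(2)[of x], of 2] by simp
    then show "AE x in lborel. norm ((u x)\<^sup>2) \<le> norm (indicator {a..b} x *\<^sub>R C\<^sup>2)"
      using assms(3) by (auto simp: indicator_def)
  qed
  with assms(1) show ?thesis by (simp add: real_L2_def)
qed

lemma real_L2_indicator: "(\<lambda>x. indicator {a..b} x) \<in> real_L2"
  by (rule real_L2_bounded_support[where C = 1]) (auto simp: indicator_def)

lemma real_L2_set_integrable: "u \<in> real_L2 \<Longrightarrow> set_integrable lborel {a..b} u"
  using real_L2_integrable_mult[OF real_L2_indicator, of u a b] by (simp add: set_integrable_def)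

definition test_function :: "(real \<Rightarrow> real) \<Rightarrow> (real \<Rightarrow> real) \<Rightarrow> bool" where
  "test_function \<phi> \<phi>' \<longleftrightarrow> (\<forall>x. (\<phi> has_real_derivative \<phi>' x) (at x)) \<and> continuous_on UNIV \<phi>' \<and>
     compact (closure {x. \<phi> x \<noteq> 0})"

definition weak_deriv :: "(real \<Rightarrow> real) \<Rightarrow> (real \<Rightarrow> real) \<Rightarrow> bool" where
  "weak_deriv u g \<longleftrightarrow> u \<in> real_L2 \<and> g \<in> real_L2 \<and>
     (\<forall>\<phi> \<phi>'. test_function \<phi> \<phi>' \<longrightarrow>
        (LINT x|lborel. u x * \<phi>' x) = - (LINT x|lborel. g x * \<phi> x))"

lemma test_function_support:
  assumes "test_function \<phi> \<phi>'"
  obtains M where "M > 0" "\<And>x. x \<notin> {-M..M} \<Longrightarrow> \<phi> x = 0" "\<And>x. x \<notin> {-M..M} \<Longrightarrow> \<phi>' x = 0"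
    "\<phi> (-M) = 0" "\<phi> M = 0"
proof -
  have "bounded (closure {x. \<phi> x \<noteq> 0})" using assms by (auto simp: test_function_def compact_imp_bounded)
  then obtain B where "\<forall>x\<in>closure {x. \<phi> x \<noteq> 0}. norm x \<le> B" unfolding bounded_iff by blast
  moreover have "{x. \<phi> x \<noteq> 0} \<subseteq> closure {x. \<phi> x \<noteq> 0}" by (rule closure_subset)
  ultimately have B: "\<bar>x\<bar> \<le> B" if "\<phi> x \<noteq> 0" for x using that by auto
  define M where "M = \<bar>B\<bar> + 1"
  have 0: "\<phi> x = 0" if "\<bar>x\<bar> \<ge> M" for x using B[of x] that unfolding M_def by linarith
  have "\<phi>' x = 0" if "x \<notin> {-M..M}" for x
  proof -
    have "open (- {-M..M})" by (intro open_Compl closed_atLeastAtMost)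
    then have "\<forall>\<^sub>F y in nhds x. y \<in> - {-M..M}" using that by (intro eventually_nhds_in_open) auto
    then have "\<forall>\<^sub>F y in nhds x. \<phi> y = 0" by eventually_elim (use 0 in auto)
    then have "(\<phi> has_real_derivative \<phi>' x) (at x) \<longleftrightarrow> ((\<lambda>_. 0) has_real_derivative \<phi>' x) (at x)"
      by (intro DERIV_cong_ev) auto
    moreover have "(\<phi> has_real_derivative \<phi>' x) (at x)" using assms by (simp add: test_function_def)
    ultimately show ?thesis using DERIV_unique[of "\<lambda>_. 0" "\<phi>' x" x 0] by simp
  qed
  moreover have "M > 0" by (simp add: M_def)
  moreover have "\<phi> x = 0" if "x \<notin> {-M..M}" for x using that by (intro 0) auto
  ultimately show ?thesis using that[of M] 0[of M] 0[of "-M"] by auto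
qed

lemma continuous_compact_support_L2:
  assumes "continuous_on UNIV \<phi>" "\<And>x. x \<notin> {-M..M} \<Longrightarrow> \<phi> x = 0"
  shows "\<phi> \<in> real_L2"
proof -
  have "continuous_on {-M..M} \<phi>" using assms(1) by (rule continuous_on_subset) simp
  then have "bounded (\<phi> ` {-M..M})" by (intro compact_imp_bounded compact_continuous_image compact_Icc)
  then obtain C where C: "\<And>x. x \<in> {-M..M} \<Longrightarrow> \<bar>\<phi> x\<bar> \<le> C" unfolding bounded_iff by (metis imageI real_norm_def)
  have "\<bar>\<phi> x\<bar> \<le> max C 0" for x using C[of x] assms(2)[of x] by (cases "x \<in> {-M..M}") auto
  then show ?thesis
    using assms by (intro real_L2_bounded_support[of \<phi> "max C 0" "-M" M] borel_measurable_continuous_onI) auto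
qed

lemma test_function_L2:
  assumes "test_function \<phi> \<phi>'" shows "\<phi> \<in> real_L2" "\<phi>' \<in> real_L2"
proof -
  obtain M where M: "\<And>x. x \<notin> {-M..M} \<Longrightarrow> \<phi> x = 0" "\<And>x. x \<notin> {-M..M} \<Longrightarrow> \<phi>' x = 0"
    using test_function_support[OF assms] by metis
  have "continuous_on UNIV \<phi>"
    using assms by (auto simp: test_function_def intro!: continuous_at_imp_continuous_on DERIV_isCont)
  then show "\<phi> \<in> real_L2" "\<phi>' \<in> real_L2"
    using assms M by (auto simp: test_function_def intro!: continuous_compact_support_L2[of _ M])
qed

text \<open>
  A continuous function with compact support and mean zero is the derivative of a test function.
\<close>

lemma test_function_of_derivative:
  assumes \<psi>: "continuous_on UNIV \<psi>" and N: "0 < N" and supp: "\<And>x. x \<notin> {-N..N} \<Longrightarrow> \<psi> x = 0"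
    and mean: "(LINT x:{-N..N}|lborel. \<psi> x) = 0"
  obtains \<phi> where "test_function \<phi> \<psi>" "\<And>x. x \<notin> {-N..N} \<Longrightarrow> \<phi> x = 0" "\<phi> (-N) = 0" "\<phi> N = 0"
proof -
  have "\<exists>F. \<forall>x :: real. -\<infinity> < ereal x \<longrightarrow> ereal x < \<infinity> \<longrightarrow> (F has_vector_derivative \<psi> x) (at x)"
    by (rule einterval_antiderivative) (use \<psi> in \<open>auto simp: continuous_on_eq_continuous_at\<close>)
  then obtain F where F: "\<And>x. (F has_real_derivative \<psi> x) (at x)"
    by (auto simp: has_real_derivative_iff_has_vector_derivative)
  have FTC: "F y - F x = (LINT t:{x..y}|lborel. \<psi> t)" if "x \<le> y" for x y
    by (rule primitive_on_integral[symmetric, OF primitive_on_C1 that])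
      (use F \<psi> in \<open>auto intro: continuous_on_subset\<close>)
  have null: "(LINT t:{x..y}|lborel. \<psi> t) = 0" if "y \<le> -N \<or> N \<le> x" for x y
  proof -
    have "AE t in lborel. t \<noteq> -N" "AE t in lborel. t \<noteq> N" by (rule AE_lborel_singleton)+
    then have "AE t in lborel. indicator {x..y} t *\<^sub>R \<psi> t = 0"
      by eventually_elim (use that supp in \<open>auto simp: indicator_def\<close>)
    then show ?thesis unfolding set_lebesgue_integral_def by (rule integral_eq_zero_AE)
  qed
  define \<phi> where "\<phi> x = F x - F (-N)" for x
  have \<phi>N: "\<phi> N = 0" using FTC[of "-N" N] mean N by (simp add: \<phi>_def)
  have out: "\<phi> x = 0" if "x \<notin> {-N..N}" for x
  proof (cases "x < -N")
    case True
    then show ?thesis using FTC[of x "-N"] null[of "-N" x] by (simp add: \<phi>_def)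
  next
    case False
    then have "N < x" using that by auto
    then show ?thesis using FTC[of N x] null[of x N] \<phi>N by (simp add: \<phi>_def)
  qed
  have "test_function \<phi> \<psi>"
    unfolding test_function_def
  proof (intro conjI allI \<psi>)
    show "(\<phi> has_real_derivative \<psi> x) (at x)" for x
      unfolding \<phi>_def using DERIV_diff[OF F[of x] DERIV_const[of "F (-N)"]] by simp
    have "{x. \<phi> x \<noteq> 0} \<subseteq> {-N..N}" using out by blast
    then have "closure {x. \<phi> x \<noteq> 0} \<subseteq> {-N..N}" by (intro closure_minimal) auto
    then show "compact (closure {x. \<phi> x \<noteq> 0})"
      using compact_Icc closed_closure by (metis closed_Int_compact inf.absorb_iff2 inf_commute)
  qed
  then show ?thesis using that[of \<phi>] out \<phi>N by (simp add: \<phi>_def)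
qed

text \<open>
  Continuous functions with values in \<open>[0, 1]\<close> that increase to the indicator of the open interval.
\<close>

definition trapezoid :: "nat \<Rightarrow> real \<Rightarrow> real \<Rightarrow> real \<Rightarrow> real" where
  "trapezoid n a b t = max 0 (min 1 (real n * min (t - a) (b - t)))"

lemma trapezoid_continuous: "continuous_on UNIV (trapezoid n a b)"
  unfolding trapezoid_def by (intro continuous_intros)

lemma trapezoid_bounds: "0 \<le> trapezoid n a b t" "trapezoid n a b t \<le> 1"
  by (auto simp: trapezoid_def)

lemma trapezoid_support: assumes "t \<notin> {a<..<b}" shows "trapezoid n a b t = 0"
proof -
  have "min (t - a) (b - t) \<le> 0" using assms by (auto simp: min_le_iff_disj)
  then have "real n * min (t - a) (b - t) \<le> 0" by (intro mult_nonneg_nonpos) auto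
  then show ?thesis unfolding trapezoid_def by simp
qed

lemma trapezoid_limit: "(\<lambda>n. trapezoid n a b t) \<longlonglongrightarrow> indicator {a<..<b} t"
proof (cases "t \<in> {a<..<b}")
  case True
  define d where "d = min (t - a) (b - t)"
  have d: "d > 0" using True by (simp add: d_def)
  obtain N :: nat where N: "1 / d < real N" using reals_Archimedean2 by blast
  have "trapezoid n a b t = 1" if "n \<ge> N" for n
  proof -
    have "1 < real N * d" using N d by (simp add: field_simps)
    also have "\<dots> \<le> real n * d" using that d by (intro mult_right_mono) auto
    finally have "1 < real n * d" .
    then have "1 < real n * min (t - a) (b - t)" by (simp add: d_def)
    then show ?thesis by (simp add: trapezoid_def)
  qed
  then have "\<forall>\<^sub>F n in sequentially. trapezoid n a b t = indicator {a<..<b} t"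
    using True by (auto simp: eventually_sequentially)
  then show ?thesis by (rule tendsto_eventually)
next
  case False
  then show ?thesis using trapezoid_support[OF False] by simp
qed

lemma trapezoid_integral_limit:
  assumes "integrable lborel f"
  shows "(\<lambda>n. LINT t|lborel. f t * trapezoid n a b t) \<longlonglongrightarrow> (LINT t:{a<..<b}|lborel. f t)"
    "integrable lborel (\<lambda>t. f t * trapezoid n a b t)"
proof -
  have [measurable]: "f \<in> borel_measurable borel" using assms by (auto dest: borel_measurable_integrable)
  have [measurable]: "trapezoid n a b \<in> borel_measurable borel" for n
    by (intro borel_measurable_continuous_onI trapezoid_continuous)
  have bound: "norm (f t * trapezoid n a b t) \<le> norm (f t)" for n t
    using trapezoid_bounds[of n a b t] by (simp add: abs_mult mult_left_le)
  show "(\<lambda>n. LINT t|lborel. f t * trapezoid n a b t) \<longlonglongrightarrow> (LINT t:{a<..<b}|lborel. f t)"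
    unfolding set_lebesgue_integral_def
  proof (rule integral_dominated_convergence)
    show "integrable lborel (\<lambda>t. norm (f t))" using assms by simp
    show "AE t in lborel. (\<lambda>n. f t * trapezoid n a b t) \<longlonglongrightarrow> indicator {a<..<b} t *\<^sub>R f t"
    proof (rule AE_I2)
      fix t
      have "(\<lambda>n. f t * trapezoid n a b t) \<longlonglongrightarrow> f t * indicator {a<..<b} t"
        by (intro tendsto_intros trapezoid_limit)
      then show "(\<lambda>n. f t * trapezoid n a b t) \<longlonglongrightarrow> indicator {a<..<b} t *\<^sub>R f t"
        by (simp add: mult.commute)
    qed
  qed (use bound in auto)
  show "integrable lborel (\<lambda>t. f t * trapezoid n a b t)"
    by (rule Bochner_Integration.integrable_bound[OF assms]) (use bound in auto)
qed

section \<open>The absolutely continuous representative and the Picone inequality\<close>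

text \<open>
  Du Bois-Reymond's lemma. Let \<open>U\<close> be a primitive of \<open>g\<close>. By the product rule \<open>u - U\<close> is orthogonal to the
  derivatives of all test functions, that is, to all continuous functions of mean zero.
  Approximating differences of normalized indicators by trapezoids shows that \<open>u - U\<close> has the same
  mean over all intervals, so it is constant.
\<close>

lemma weak_deriv_local_primitive:
  assumes wd: "weak_deriv u g" and N: "0 < N"
  obtains F where "primitive_on (-N) N g F" "AE x in lborel. x \<in> {-N..N} \<longrightarrow> u x = F x"
proof -
  have L2: "u \<in> real_L2" "g \<in> real_L2" using wd by (auto simp: weak_deriv_def)
  define U where "U x = (LINT t:{-N..x}|lborel. g t)" for x
  have "U (-N) = 0"
  proof -
    have "AE t in lborel. t \<noteq> -N" by (rule AE_lborel_singleton)
    then have "AE t in lborel. indicator {-N..-N} t *\<^sub>R g t = 0" by eventually_elim auto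
    then show ?thesis unfolding U_def set_lebesgue_integral_def by (rule integral_eq_zero_AE)
  qed
  then have U: "primitive_on (-N) N g U"
    unfolding primitive_on_def using real_L2_set_integrable[OF L2(2)] by (simp add: U_def)
  define W where "W x = indicator {-N..N} x * (u x - U x)" for x
  have W: "integrable lborel W"
  proof -
    have "set_integrable lborel {-N..N} (\<lambda>x. u x - U x)"
      by (intro set_integral_diff(1) real_L2_set_integrable L2 borel_integrable_atLeastAtMost' primitive_on_continuous[OF U])
    then show ?thesis by (simp add: set_integrable_def W_def[abs_def])
  qed
  have orth: "(LINT x|lborel. W x * \<psi> x) = 0"
    if \<psi>: "continuous_on UNIV \<psi>" "\<And>x. x \<notin> {-N..N} \<Longrightarrow> \<psi> x = 0" "(LINT x:{-N..N}|lborel. \<psi> x) = 0" for \<psi>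
  proof -
    obtain \<phi> where \<phi>: "test_function \<phi> \<psi>" "\<And>x. x \<notin> {-N..N} \<Longrightarrow> \<phi> x = 0" "\<phi> (-N) = 0" "\<phi> N = 0"
      using test_function_of_derivative[OF \<psi>(1) N \<psi>(2,3)] by metis
    have p\<phi>: "primitive_on (-N) N \<psi> \<phi>"
      using \<phi>(1) by (intro primitive_on_C1) (auto simp: test_function_def intro: continuous_on_subset)
    have g\<phi>: "integrable lborel (\<lambda>x. g x * \<phi> x)" and u\<psi>: "integrable lborel (\<lambda>x. u x * \<psi> x)"
      using L2 test_function_L2[OF \<phi>(1)] by (auto intro: real_L2_integrable_mult)
    have "set_integrable lborel {-N..N} (\<lambda>x. U x * \<psi> x)"
      by (intro borel_integrable_atLeastAtMost' continuous_intros primitive_on_continuous[OF U] continuous_on_subset[OF \<psi>(1)]) auto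
    moreover have "(\<lambda>x. indicator {-N..N} x *\<^sub>R (U x * \<psi> x)) = (\<lambda>x. U x * \<psi> x)"
      using \<psi>(2) by (auto simp: fun_eq_iff indicator_def)
    ultimately have U\<psi>: "integrable lborel (\<lambda>x. U x * \<psi> x)" by (simp add: set_integrable_def)
    have "(LINT x:{-N..N}|lborel. g x * \<phi> x + U x * \<psi> x) = 0"
      using primitive_on_integral[OF primitive_on_mult[OF U p\<phi>]] N \<phi>(3,4) by simp
    moreover have "(\<lambda>x. indicator {-N..N} x *\<^sub>R (g x * \<phi> x + U x * \<psi> x)) = (\<lambda>x. g x * \<phi> x + U x * \<psi> x)"
    proof (rule ext)
      show "indicator {-N..N} x *\<^sub>R (g x * \<phi> x + U x * \<psi> x) = g x * \<phi> x + U x * \<psi> x" for x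
        by (cases "x \<in> {-N..N}") (use \<psi>(2)[of x] \<phi>(2)[of x] in auto)
    qed
    ultimately have "(LINT x|lborel. g x * \<phi> x) + (LINT x|lborel. U x * \<psi> x) = 0"
      unfolding set_lebesgue_integral_def using g\<phi> U\<psi> by simp
    moreover have "(LINT x|lborel. u x * \<psi> x) = - (LINT x|lborel. g x * \<phi> x)"
      using wd \<phi>(1) by (auto simp: weak_deriv_def)
    moreover have "(\<lambda>x. W x * \<psi> x) = (\<lambda>x. u x * \<psi> x - U x * \<psi> x)"
      using \<psi>(2) by (auto simp: fun_eq_iff W_def indicator_def algebra_simps)
    ultimately show ?thesis using u\<psi> U\<psi> by simp
  qed
  define m where "m = (LINT t:{-N<..<N}|lborel. W t)"
  have len: "(LINT t:{a<..<b}|lborel. indicator {-N..N} t) = b - a" if "-N \<le> a" "a \<le> b" "b \<le> N" for a b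
  proof -
    have "(\<lambda>t. indicator {a<..<b} t *\<^sub>R indicator {-N..N} t :: real) = indicator {a<..<b}"
      using that by (auto simp: fun_eq_iff indicator_def)
    then show ?thesis unfolding set_lebesgue_integral_def using that by simp
  qed
  have intN: "integrable lborel (indicator {-N..N} :: real \<Rightarrow> real)"
    by (intro integrable_real_indicator) (auto simp: emeasure_lborel_Icc_eq)
  have proportional: "2 * N * (LINT t:{a<..<b}|lborel. W t) = (b - a) * m" if ab: "-N \<le> a" "a \<le> b" "b \<le> N" for a b
  proof -
    define A where "A n = (LINT t|lborel. indicator {-N..N} t * trapezoid n a b t)" for n
    define B where "B n = (LINT t|lborel. indicator {-N..N} t * trapezoid n (-N) N t)" for n
    define WA where "WA n = (LINT t|lborel. W t * trapezoid n a b t)" for n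
    define WB where "WB n = (LINT t|lborel. W t * trapezoid n (-N) N t)" for n
    have "B n * WA n - A n * WB n = 0" for n
    proof -
      \<comment> \<open>the combination of the two trapezoids with mean zero\<close>
      define \<psi> where "\<psi> t = B n * trapezoid n a b t - A n * trapezoid n (-N) N t" for t
      have "(LINT t:{-N..N}|lborel. \<psi> t) = B n * A n - A n * B n"
      proof -
        have "(LINT t:{-N..N}|lborel. \<psi> t) =
           (LINT t|lborel. B n * (indicator {-N..N} t * trapezoid n a b t) - A n * (indicator {-N..N} t * trapezoid n (-N) N t))"
          unfolding set_lebesgue_integral_def by (rule Bochner_Integration.integral_cong) (auto simp: \<psi>_def algebra_simps)
        also have "\<dots> = B n * A n - A n * B n"
          unfolding A_def B_def
          using trapezoid_integral_limit(2)[OF intN, of n a b] trapezoid_integral_limit(2)[OF intN, of n "-N" N] by simp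
        finally show ?thesis .
      qed
      moreover have "continuous_on UNIV \<psi>" unfolding \<psi>_def by (intro continuous_intros trapezoid_continuous)
      moreover have "\<psi> x = 0" if "x \<notin> {-N..N}" for x
        using that ab trapezoid_support[of x a b n] trapezoid_support[of x "-N" N n] by (auto simp: \<psi>_def)
      ultimately have "(LINT t|lborel. W t * \<psi> t) = 0" by (intro orth) auto
      moreover have "(LINT t|lborel. W t * \<psi> t) = (LINT t|lborel. B n * (W t * trapezoid n a b t) - A n * (W t * trapezoid n (-N) N t))"
        by (rule Bochner_Integration.integral_cong) (auto simp: \<psi>_def algebra_simps)
      moreover have "\<dots> = B n * WA n - A n * WB n"
        unfolding WA_def WB_def
        using trapezoid_integral_limit(2)[OF W, of n a b] trapezoid_integral_limit(2)[OF W, of n "-N" N] by simp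
      ultimately show ?thesis by simp
    qed
    moreover have "(\<lambda>n. B n * WA n - A n * WB n) \<longlonglongrightarrow> (N - (-N)) * (LINT t:{a<..<b}|lborel. W t) - (b - a) * m"
      unfolding A_def B_def WA_def WB_def m_def
      using trapezoid_integral_limit(1)[OF intN, of a b] trapezoid_integral_limit(1)[OF intN, of "-N" N] len[OF ab] len[of "-N" N] N
      by (intro tendsto_diff tendsto_mult trapezoid_integral_limit(1)[OF W]) auto
    ultimately show ?thesis by (simp add: LIMSEQ_const_iff)
  qed
  \<comment> \<open>the mean of \<open>u - U\<close> over the whole interval\<close>
  define c where "c = m / (2 * N)"
  define f where "f x = W x - c * indicator {-N..N} x" for x
  have fi: "integrable lborel f" unfolding f_def using W intN by auto
  have "(LINT t:{x<..}|lborel. f t) = 0" for x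
  proof -
    define a where "a = min N (max x (-N))"
    have a: "-N \<le> a" "a \<le> N" using N by (auto simp: a_def)
    have si: "set_integrable lborel {a<..<N} W" "set_integrable lborel {a<..<N} (\<lambda>t. c * indicator {-N..N} t)"
      unfolding set_integrable_def by (intro integrable_mult_indicator integrable_mult_right W intN; simp)+
    have "AE t in lborel. t \<noteq> N" "AE t in lborel. t \<noteq> -N" by (rule AE_lborel_singleton)+
    then have ae: "AE t in lborel. indicator {x<..} t *\<^sub>R f t = indicator {a<..<N} t *\<^sub>R f t"
      by eventually_elim (auto simp: a_def f_def W_def indicator_def)
    have [measurable]: "f \<in> borel_measurable borel" using fi by (auto dest: borel_measurable_integrable)
    have "(LINT t:{x<..}|lborel. f t) = (LINT t:{a<..<N}|lborel. f t)"
      unfolding set_lebesgue_integral_def by (rule integral_cong_AE) (use ae in \<open>auto intro!: borel_measurable_times\<close>)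
    also have "\<dots> = (LINT t:{a<..<N}|lborel. W t) - (LINT t:{a<..<N}|lborel. c * indicator {-N..N} t)"
      unfolding f_def by (rule set_integral_diff(2)[OF si])
    also have "\<dots> = 0"
    proof -
      have "(LINT t:{a<..<N}|lborel. c * indicator {-N..N} t) = c * (N - a)"
        using len[of a N] a by simp
      moreover have "(LINT t:{a<..<N}|lborel. W t) = c * (N - a)"
        using proportional[of a N] a N by (simp add: c_def field_simps)
      ultimately show ?thesis by linarith
    qed
    finally show ?thesis .
  qed
  from AE_zero_of_tail_integrals[OF fi this]
  have "AE x in lborel. x \<in> {-N..N} \<longrightarrow> u x = c + U x"
    by eventually_elim (auto simp: f_def W_def)
  moreover have "primitive_on (-N) N g (\<lambda>x. c + U x)"
    unfolding primitive_on_def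
  proof (intro conjI ballI)
    show "set_integrable lborel {-N..N} g" using L2(2) by (rule real_L2_set_integrable)
    fix x assume "x \<in> {-N..N}"
    from primitive_onD[OF U this] show "c + U x = c + U (-N) + (LINT t:{-N..x}|lborel. g t)" by linarith
  qed
  ultimately show ?thesis using that by blast
qed

text \<open>
  If \<open>u\<close> is absolutely continuous with derivative \<open>g\<close>, the integrand is the derivative of \<open>(t - x + 1) u t\<close>, and the
  integral is \<open>u x\<close>. In this form the evaluation at a point is visibly a bounded linear functional of the
  pair \<open>(u, g)\<close> and does not depend on the representatives.
\<close>

definition point_value :: "(real \<Rightarrow> real) \<Rightarrow> (real \<Rightarrow> real) \<Rightarrow> real \<Rightarrow> real" where
  "point_value u g x = (LINT t:{x-1..x}|lborel. u t + (t - x + 1) * g t)"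

lemma point_value_local:
  assumes wd: "weak_deriv u g" and N: "0 < N"
    and F: "primitive_on (-N) N g F" "AE x in lborel. x \<in> {-N..N} \<longrightarrow> u x = F x"
    and x: "x \<in> {-N+1..N}"
  shows "point_value u g x = F x"
proof -
  have L2: "u \<in> real_L2" "g \<in> real_L2" using wd by (auto simp: weak_deriv_def)
  have [measurable]: "u \<in> borel_measurable borel" "g \<in> borel_measurable borel" using L2 by (auto dest: real_L2_measurable)
  have sub: "{x-1..x} \<subseteq> {-N..N}" using x by auto
  have F': "primitive_on (x-1) x g F" by (rule primitive_on_subinterval[OF F(1)]) (use x in auto)
  have P: "primitive_on (x-1) x (\<lambda>t. g t * (t - x + 1) + F t * 1) (\<lambda>t. F t * (t - x + 1))"
    by (intro primitive_on_mult F' primitive_on_C1) (auto intro!: derivative_eq_intros continuous_intros)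
  have si: "set_integrable lborel {x-1..x} (\<lambda>t. g t * (t - x + 1) + F t * 1)" using P by (simp add: primitive_on_def)
  have "point_value u g x = (LINT t:{x-1..x}|lborel. g t * (t - x + 1) + F t * 1)"
    unfolding point_value_def set_lebesgue_integral_def
  proof (rule integral_cong_AE)
    show "AE t in lborel. indicator {x-1..x} t *\<^sub>R (u t + (t - x + 1) * g t) = indicator {x-1..x} t *\<^sub>R (g t * (t - x + 1) + F t * 1)"
      using F(2) by eventually_elim (use sub in \<open>auto simp: indicator_def\<close>)
    show "(\<lambda>t. indicator {x-1..x} t *\<^sub>R (g t * (t - x + 1) + F t * 1)) \<in> borel_measurable lborel"
      using si unfolding set_integrable_def by (rule borel_measurable_integrable)
  qed measurable
  also have "\<dots> = F x" using primitive_on_integral[OF P] by simp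
  finally show ?thesis .
qed

lemma point_value_primitive:
  assumes wd: "weak_deriv u g"
  shows "primitive_on a b g (point_value u g)"
proof -
  define N where "N = \<bar>a\<bar> + \<bar>b\<bar> + 1"
  have N: "0 < N" by (simp add: N_def)
  obtain F where F: "primitive_on (-N) N g F" "AE x in lborel. x \<in> {-N..N} \<longrightarrow> u x = F x"
    using weak_deriv_local_primitive[OF wd N] .
  have "primitive_on a b g F" by (rule primitive_on_subinterval[OF F(1)]) (auto simp: N_def)
  then show ?thesis
  proof (rule primitive_on_cong)
    fix x assume "x \<in> {a..b}"
    then have "x \<in> {-N+1..N}" by (auto simp: N_def)
    from point_value_local[OF wd N F this] show "F x = point_value u g x" by simp
  qed
qed

lemma AE_point_value:
  assumes wd: "weak_deriv u g"
  shows "AE x in lborel. u x = point_value u g x"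
proof -
  have "AE x in lborel. x \<in> {- real n..real n} \<longrightarrow> u x = point_value u g x" for n
  proof -
    define N where "N = real n + 1"
    have N: "0 < N" by (simp add: N_def)
    obtain F where F: "primitive_on (-N) N g F" "AE x in lborel. x \<in> {-N..N} \<longrightarrow> u x = F x"
      using weak_deriv_local_primitive[OF wd N] .
    show ?thesis
      using F(2) by eventually_elim (use point_value_local[OF wd N F] in \<open>auto simp: N_def\<close>)
  qed
  then have "AE x in lborel. \<forall>n. x \<in> {- real n..real n} \<longrightarrow> u x = point_value u g x"
    by (subst AE_all_countable) blast
  then show ?thesis
  proof eventually_elim
    fix x assume *: "\<forall>n. x \<in> {- real n..real n} \<longrightarrow> u x = point_value u g x"
    obtain n where "\<bar>x\<bar> \<le> real n" using real_arch_simple by blast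
    then show "u x = point_value u g x" using * by (auto simp: abs_le_iff)
  qed
qed

lemma continuous_AE_zero:
  fixes h :: "real \<Rightarrow> real"
  assumes "continuous_on UNIV h" "AE x in lborel. h x = 0"
  shows "h x = 0"
proof (rule ccontr)
  assume "h x \<noteq> 0"
  have op: "open (h -` (- {0}))" using assms(1) by (intro open_vimage) auto
  moreover have "x \<in> h -` (- {0})" using \<open>h x \<noteq> 0\<close> by simp
  ultimately obtain d where d: "d > 0" "ball x d \<subseteq> h -` (- {0})"
    unfolding open_contains_ball by blast
  have "{x. h x \<noteq> 0} \<in> null_sets lborel"
  proof -
    have "{x. h x \<noteq> 0} = h -` (- {0})" by auto
    then have "{x. h x \<noteq> 0} \<in> sets lborel" using op by (simp add: borel_open)
    from AE_iff_null_sets[OF this] show ?thesis using assms(2) by simp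
  qed
  then have "ball x d \<in> null_sets lborel"
    by (rule null_sets_subset) (use d(2) in auto)
  then have "emeasure lborel {x - d<..<x + d} = 0" by (simp add: null_sets_def ball_eq_greaterThanLessThan)
  then show False using d(1) by simp
qed

text \<open>
  The absolutely continuous representatives agree almost everywhere, hence everywhere by continuity, so
  that the two derivatives have the same integrals over all intervals.
\<close>

lemma weak_deriv_unique:
  assumes "weak_deriv u g" "weak_deriv v g'" "AE x in lborel. u x = v x"
  shows "AE x in lborel. g x = g' x"
proof -
  have L2: "u \<in> real_L2" "g \<in> real_L2" "v \<in> real_L2" "g' \<in> real_L2" using assms by (auto simp: weak_deriv_def)
  define h where "h x = point_value u g x - point_value v g' x" for x
  have cont: "continuous_on {-a..a} h" for a
    unfolding h_def using primitive_on_continuous[OF point_value_primitive[OF assms(1)]]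
      primitive_on_continuous[OF point_value_primitive[OF assms(2)]] by (intro continuous_intros)
  have "continuous_on UNIV h"
  proof (rule continuous_at_imp_continuous_on, rule ballI)
    fix x :: real
    have "isCont h x \<longleftrightarrow> continuous (at x within {-(\<bar>x\<bar>+1)..\<bar>x\<bar>+1}) h"
      by (subst at_within_interior) auto
    moreover have "x \<in> {-(\<bar>x\<bar>+1)..\<bar>x\<bar>+1}" by auto
    ultimately show "isCont h x" using cont[of "\<bar>x\<bar>+1"] unfolding continuous_on_eq_continuous_within by blast
  qed
  moreover have "AE x in lborel. h x = 0"
    using AE_point_value[OF assms(1)] AE_point_value[OF assms(2)] assms(3)
    by eventually_elim (simp add: h_def)
  ultimately have h0: "h x = 0" for x by (rule continuous_AE_zero)
  have zero: "(LINT t:{a..b}|lborel. g t - g' t) = 0" if "a \<le> b" for a b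
  proof -
    have "(LINT t:{a..b}|lborel. g t - g' t) = (LINT t:{a..b}|lborel. g t) - (LINT t:{a..b}|lborel. g' t)"
      using L2 by (intro set_integral_diff(2) real_L2_set_integrable)
    also have "\<dots> = h b - h a"
      using primitive_on_integral[OF point_value_primitive[OF assms(1)] that] primitive_on_integral[OF point_value_primitive[OF assms(2)] that]
      by (simp add: h_def)
    finally show ?thesis by (simp add: h0)
  qed
  have "AE x in lborel. indicator {-real n..real n} x * (g x - g' x) = 0" for n
  proof (rule AE_zero_of_tail_integrals)
    have [measurable]: "g \<in> borel_measurable borel" "g' \<in> borel_measurable borel" using L2 by (auto dest: real_L2_measurable)
    show "integrable lborel (\<lambda>x. indicator {-real n..real n} x * (g x - g' x))"
      using set_integral_diff(1)[OF real_L2_set_integrable[OF L2(2)] real_L2_set_integrable[OF L2(4)]]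
      by (simp add: set_integrable_def)
    fix x
    define a where "a = max x (- real n)"
    have "AE t in lborel. t \<noteq> x" by (rule AE_lborel_singleton)
    then have "AE t in lborel. indicator {x<..} t *\<^sub>R (indicator {-real n..real n} t * (g t - g' t)) = indicator {a..real n} t *\<^sub>R (g t - g' t)"
      by eventually_elim (auto simp: a_def indicator_def)
    then have "(LINT t:{x<..}|lborel. indicator {-real n..real n} t * (g t - g' t)) = (LINT t:{a..real n}|lborel. g t - g' t)"
      unfolding set_lebesgue_integral_def by (intro integral_cong_AE) (auto intro!: borel_measurable_times)
    also have "\<dots> = 0"
      using zero[of a "real n"] by (cases "a \<le> real n") (simp, simp add: set_lebesgue_integral_def)
    finally show "(LINT t:{x<..}|lborel. indicator {-real n..real n} t * (g t - g' t)) = 0" .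
  qed
  then have "AE x in lborel. \<forall>n. indicator {-real n..real n} x * (g x - g' x) = 0"
    by (subst AE_all_countable) blast
  then show ?thesis
  proof eventually_elim
    fix x assume *: "\<forall>n. indicator {-real n..real n} x * (g x - g' x) = 0"
    obtain n where "\<bar>x\<bar> \<le> real n" using real_arch_simple by blast
    then show "g x = g' x" using *[rule_format, of n] by (auto simp: abs_le_iff indicator_def)
  qed
qed

text \<open>
  Integrate \<open>0 \<le> (g + p v)\<^sup>2\<close> and use that \<open>p v\<^sup>2\<close> is a primitive of \<open>p' v\<^sup>2 + 2 p v g\<close>. For \<open>p = - \<phi>' / \<phi>\<close> this is the comparison
  of \<open>v\<close> with a positive solution \<open>\<phi>\<close> of \<open>\<phi>'' + (p' - p\<^sup>2) \<phi> = 0\<close>.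
\<close>

lemma Picone_inequality:
  assumes wd: "weak_deriv u g" and ab: "a \<le> b"
    and p: "\<And>x. x \<in> {a..b} \<Longrightarrow> (p has_real_derivative p' x) (at x)" "continuous_on {a..b} p'"
  defines "v \<equiv> point_value u g"
  shows "set_integrable lborel {a..b} (\<lambda>t. (p' t - (p t)\<^sup>2) * (u t)\<^sup>2)"
    "(LINT t:{a..b}|lborel. (p' t - (p t)\<^sup>2) * (u t)\<^sup>2) - p b * (v b)\<^sup>2 + p a * (v a)\<^sup>2 \<le> (LINT t:{a..b}|lborel. (g t)\<^sup>2)"
proof -
  have L2: "u \<in> real_L2" "g \<in> real_L2" using wd by (auto simp: weak_deriv_def)
  have [measurable]: "u \<in> borel_measurable borel" using L2 by (auto dest: real_L2_measurable)
  have V: "primitive_on a b g v" unfolding v_def by (rule point_value_primitive[OF wd])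
  have cp: "continuous_on {a..b} p" using DERIV_isCont[OF p(1)] by (simp add: continuous_at_imp_continuous_on)
  have cv: "continuous_on {a..b} v" by (rule primitive_on_continuous[OF V])
  have pp: "primitive_on a b p' p" using p by (rule primitive_on_C1)
  have V2: "primitive_on a b (\<lambda>t. (g t * v t + v t * g t) * p t + (v t * v t) * p' t) (\<lambda>t. (v t * v t) * p t)"
    by (intro primitive_on_mult V pp)
  have sg: "set_integrable lborel {a..b} (\<lambda>t. (g t)\<^sup>2)"
    unfolding set_integrable_def using real_L2_integrable_square[OF L2(2)] by (intro integrable_mult_indicator) auto
  have sv: "set_integrable lborel {a..b} (\<lambda>t. (p' t - (p t)\<^sup>2) * (v t)\<^sup>2)"
    by (intro borel_integrable_atLeastAtMost' continuous_intros cp cv p(2))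
  have sV2: "set_integrable lborel {a..b} (\<lambda>t. (g t * v t + v t * g t) * p t + (v t * v t) * p' t)"
    using V2 by (simp add: primitive_on_def)
  have ae: "AE t in lborel. u t = v t" unfolding v_def by (rule AE_point_value[OF wd])
  have "(\<lambda>t. indicator {a..b} t *\<^sub>R ((p' t - (p t)\<^sup>2) * (u t)\<^sup>2)) \<in> borel_measurable lborel"
  proof -
    have "(\<lambda>t. indicator {a..b} t *\<^sub>R (p' t - (p t)\<^sup>2)) \<in> borel_measurable borel"
      by (intro borel_measurable_continuous_on_indicator continuous_intros p(2) cp) auto
    then have "(\<lambda>t. (indicator {a..b} t *\<^sub>R (p' t - (p t)\<^sup>2)) * (u t)\<^sup>2) \<in> borel_measurable borel" by measurable
    then show ?thesis by (simp add: mult.assoc)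
  qed
  then have eqAE: "integrable lborel (\<lambda>t. indicator {a..b} t *\<^sub>R ((p' t - (p t)\<^sup>2) * (u t)\<^sup>2))"
     "(LINT t:{a..b}|lborel. (p' t - (p t)\<^sup>2) * (u t)\<^sup>2) = (LINT t:{a..b}|lborel. (p' t - (p t)\<^sup>2) * (v t)\<^sup>2)"
    unfolding set_lebesgue_integral_def
    using sv ae by (auto simp: set_integrable_def intro!: integral_cong_AE elim: integrable_cong_AE_imp)
  then show "set_integrable lborel {a..b} (\<lambda>t. (p' t - (p t)\<^sup>2) * (u t)\<^sup>2)" by (simp add: set_integrable_def)
  have "(LINT t:{a..b}|lborel. (p' t - (p t)\<^sup>2) * (v t)\<^sup>2) - (p b * (v b)\<^sup>2 - p a * (v a)\<^sup>2) =
     (LINT t:{a..b}|lborel. (p' t - (p t)\<^sup>2) * (v t)\<^sup>2) -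
     (LINT t:{a..b}|lborel. (g t * v t + v t * g t) * p t + (v t * v t) * p' t)"
    using primitive_on_integral[OF V2 ab] by (simp add: power2_eq_square mult_ac)
  also have "\<dots> = (LINT t:{a..b}|lborel. (p' t - (p t)\<^sup>2) * (v t)\<^sup>2 - ((g t * v t + v t * g t) * p t + (v t * v t) * p' t))"
    by (rule set_integral_diff(2)[OF sv sV2, symmetric])
  also have "\<dots> \<le> (LINT t:{a..b}|lborel. (g t)\<^sup>2)"
  proof (rule set_integral_mono[OF set_integral_diff(1)[OF sv sV2] sg])
    fix t
    have "0 \<le> (g t + p t * v t)\<^sup>2" by simp
    then show "(p' t - (p t)\<^sup>2) * (v t)\<^sup>2 - ((g t * v t + v t * g t) * p t + (v t * v t) * p' t) \<le> (g t)\<^sup>2"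
      by (simp add: power2_eq_square algebra_simps)
  qed
  finally show "(LINT t:{a..b}|lborel. (p' t - (p t)\<^sup>2) * (u t)\<^sup>2) - p b * (v b)\<^sup>2 + p a * (v a)\<^sup>2 \<le> (LINT t:{a..b}|lborel. (g t)\<^sup>2)"
    unfolding eqAE(2) by simp
qed

section \<open>The graph of the Schroedinger form\<close>

text \<open>
  Half a period of a sine. With half-open intervals, bumps on adjacent intervals and also their
  derivatives have product zero at every point.
\<close>

definition bump :: "real \<Rightarrow> real \<Rightarrow> real \<Rightarrow> real" where
  "bump c d x = indicator {c..<d} x * sin (pi / (d - c) * (x - c))"

definition bump_deriv :: "real \<Rightarrow> real \<Rightarrow> real \<Rightarrow> real" where
  "bump_deriv c d x = indicator {c..<d} x * (pi / (d - c) * cos (pi / (d - c) * (x - c)))"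

lemma bump_L2: "bump c d \<in> real_L2" "bump_deriv c d \<in> real_L2"
proof -
  show "bump c d \<in> real_L2"
    by (rule real_L2_bounded_support[where C = 1 and a = c and b = d])
      (auto simp: bump_def[abs_def] indicator_def)
  have "\<bar>bump_deriv c d x\<bar> \<le> \<bar>pi / (d - c)\<bar>" for x
  proof -
    have "\<bar>pi / (d - c)\<bar> * \<bar>cos (pi / (d - c) * (x - c))\<bar> \<le> \<bar>pi / (d - c)\<bar> * 1"
      by (intro mult_left_mono) auto
    then show ?thesis by (auto simp: bump_deriv_def indicator_def abs_mult)
  qed
  then show "bump_deriv c d \<in> real_L2"
    by (intro real_L2_bounded_support[where C = "\<bar>pi / (d - c)\<bar>" and a = c and b = d])
      (auto simp: bump_deriv_def[abs_def] indicator_def)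
qed

lemma integral_half_open:
  fixes f :: "real \<Rightarrow> real"
  assumes "f \<in> borel_measurable borel"
  shows "(LINT x|lborel. indicator {c..<d} x * f x) = (LINT x:{c..d}|lborel. f x)"
  unfolding set_lebesgue_integral_def
proof (rule integral_cong_AE)
  have "AE x in lborel. x \<noteq> d" by (rule AE_lborel_singleton)
  then show "AE x in lborel. indicator {c..<d} x * f x = indicator {c..d} x *\<^sub>R f x"
    by eventually_elim (auto simp: indicator_def)
qed (use assms in auto)

lemma weak_deriv_bump:
  assumes "c < d" shows "weak_deriv (bump c d) (bump_deriv c d)"
  unfolding weak_deriv_def
proof (intro conjI bump_L2 allI impI)
  fix \<phi> \<phi>' assume t: "test_function \<phi> \<phi>'"
  define k where "k = pi / (d - c)"
  define S where "S x = sin (k * (x - c))" for x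
  define S' where "S' x = k * cos (k * (x - c))" for x
  have [measurable]: "\<phi> \<in> borel_measurable borel" "\<phi>' \<in> borel_measurable borel"
    using test_function_L2[OF t] by (auto dest: real_L2_measurable)
  have Sd: "S c = 0" "S d = 0" using assms by (simp_all add: S_def k_def)
  have 1: "primitive_on c d S' S"
    unfolding S_def S'_def by (intro primitive_on_C1) (auto intro!: derivative_eq_intros continuous_intros)
  have 2: "primitive_on c d \<phi>' \<phi>"
    using t by (intro primitive_on_C1) (auto simp: test_function_def intro: continuous_on_subset)
  have cont: "continuous_on {c..d} \<phi>" by (rule primitive_on_continuous[OF 2])
  have si: "set_integrable lborel {c..d} (\<lambda>x. S' x * \<phi> x)" "set_integrable lborel {c..d} (\<lambda>x. S x * \<phi>' x)"
    unfolding S_def S'_def using t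
    by (auto intro!: borel_integrable_atLeastAtMost' continuous_intros cont simp: test_function_def intro: continuous_on_subset)
  have "(LINT x:{c..d}|lborel. S' x * \<phi> x + S x * \<phi>' x) = 0"
    using primitive_on_integral[OF primitive_on_mult[OF 1 2]] assms Sd by simp
  then have "(LINT x:{c..d}|lborel. S' x * \<phi> x) + (LINT x:{c..d}|lborel. S x * \<phi>' x) = 0"
    by (simp add: set_integral_add(2)[OF si])
  moreover have "(LINT x|lborel. bump c d x * \<phi>' x) = (LINT x:{c..d}|lborel. S x * \<phi>' x)"
    by (subst integral_half_open[symmetric]) (auto simp: bump_def S_def k_def mult.assoc)
  moreover have "(LINT x|lborel. bump_deriv c d x * \<phi> x) = (LINT x:{c..d}|lborel. S' x * \<phi> x)"
    by (subst integral_half_open[symmetric]) (auto simp: bump_deriv_def S'_def k_def mult.assoc)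
  ultimately show "(LINT x|lborel. bump c d x * \<phi>' x) = - (LINT x|lborel. bump_deriv c d x * \<phi> x)" by simp
qed

lemma bump_norms:
  assumes cd: "c < d"
  shows "(LINT x|lborel. (bump c d x)\<^sup>2) = (d - c) / 2"
    "(LINT x|lborel. (bump_deriv c d x)\<^sup>2) = (pi / (d - c))\<^sup>2 * ((d - c) / 2)"
proof -
  define k where "k = pi / (d - c)"
  have k: "k > 0" using cd by (simp add: k_def)
  define A where "A = (LINT x:{c..d}|lborel. (sin (k * (x - c)))\<^sup>2)"
  define B where "B = (LINT x:{c..d}|lborel. (cos (k * (x - c)))\<^sup>2)"
  have si: "set_integrable lborel {c..d} (\<lambda>x. (sin (k * (x - c)))\<^sup>2)" "set_integrable lborel {c..d} (\<lambda>x. (cos (k * (x - c)))\<^sup>2)"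
    by (auto intro!: borel_integrable_atLeastAtMost' continuous_intros)
  have "A + B = (LINT x:{c..d}|lborel. (sin (k * (x - c)))\<^sup>2 + (cos (k * (x - c)))\<^sup>2)"
    unfolding A_def B_def by (rule set_integral_add(2)[OF si, symmetric])
  also have "\<dots> = (LINT x:{c..d}|lborel. 1)" by simp
  also have "\<dots> = d - c" using cd by (simp add: set_lebesgue_integral_def)
  finally have sum: "A + B = d - c" .
  have "primitive_on c d (\<lambda>x. (cos (k * (x - c)))\<^sup>2 - (sin (k * (x - c)))\<^sup>2) (\<lambda>x. sin (k * (x - c)) * cos (k * (x - c)) / k)"
    using k by (intro primitive_on_C1) (auto intro!: derivative_eq_intros continuous_intros simp: power2_eq_square field_simps)
  from primitive_on_integral[OF this] have "(LINT x:{c..d}|lborel. (cos (k * (x - c)))\<^sup>2 - (sin (k * (x - c)))\<^sup>2) = 0"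
    using cd by (simp add: k_def)
  then have "B = A" unfolding A_def B_def by (simp add: set_integral_diff(2)[OF si(2) si(1)])
  then have AB: "A = (d - c) / 2" "B = (d - c) / 2" using sum by simp_all
  have "(LINT x|lborel. (bump c d x)\<^sup>2) = A"
    unfolding A_def
    by (subst integral_half_open[symmetric]) (auto simp: bump_def k_def indicator_def intro!: Bochner_Integration.integral_cong)
  then show "(LINT x|lborel. (bump c d x)\<^sup>2) = (d - c) / 2" by (simp add: AB)
  have "(LINT x|lborel. (bump_deriv c d x)\<^sup>2) = (LINT x|lborel. k\<^sup>2 * (indicator {c..<d} x * (cos (k * (x - c)))\<^sup>2))"
  proof (rule Bochner_Integration.integral_cong[OF refl])
    show "(bump_deriv c d x)\<^sup>2 = k\<^sup>2 * (indicator {c..<d} x * (cos (k * (x - c)))\<^sup>2)" for x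
      by (cases "x \<in> {c..<d}") (auto simp: bump_deriv_def k_def power_mult_distrib power_divide)
  qed
  also have "\<dots> = k\<^sup>2 * B"
    unfolding B_def by (subst integral_half_open[symmetric]) auto
  finally show "(LINT x|lborel. (bump_deriv c d x)\<^sup>2) = (pi / (d - c))\<^sup>2 * ((d - c) / 2)"
    by (simp add: AB k_def)
qed

definition form_graph :: "real \<Rightarrow> (real \<Rightarrow> real) \<Rightarrow> (rl2 \<times> rl2 \<times> rl2) set" where
  "form_graph h V = {(cls u, h *\<^sub>R cls g, cls (\<lambda>x. sqrt (V x) * u x)) | u g.
     weak_deriv u g \<and> (\<lambda>x. sqrt (V x) * u x) \<in> real_L2}"

lemma weak_deriv_iff_inner:
  assumes "u \<in> real_L2" "g \<in> real_L2"
  shows "weak_deriv u g \<longleftrightarrow> (\<forall>\<phi> \<phi>'. test_function \<phi> \<phi>' \<longrightarrow> cls u \<bullet> cls \<phi>' = - (cls g \<bullet> cls \<phi>))"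
  using assms by (auto simp: weak_deriv_def inner_cls test_function_L2)

text \<open>
  The weak derivative is characterized by scalar products with test functions. For the potential,
  dividing \<open>w = sqrt V u\<close> by \<open>1 + sqrt V\<close> leaves an equation between bounded multiples of \<open>w\<close> and of \<open>u\<close>. In this
  description closedness of the graph, that is of the form, is evident.
\<close>

lemma form_graph_eq:
  assumes V: "continuous_on UNIV V" and nn: "\<And>x. 0 \<le> V x" and h: "h > 0"
  defines "M1 \<equiv> \<lambda>x :: rl2. cls (\<lambda>t. 1 / (1 + sqrt (V t)) * rep_rl2 x t)"
  defines "M2 \<equiv> \<lambda>x :: rl2. cls (\<lambda>t. sqrt (V t) / (1 + sqrt (V t)) * rep_rl2 x t)"
  shows "form_graph h V = {p. (\<forall>\<phi> \<phi>'. test_function \<phi> \<phi>' \<longrightarrow>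
      h * (fst p \<bullet> cls \<phi>') + fst (snd p) \<bullet> cls \<phi> = 0) \<and> M1 (snd (snd p)) - M2 (fst p) = 0}"
    "bounded_linear M1" "bounded_linear M2"
proof -
  have [measurable]: "V \<in> borel_measurable borel" using V by (rule borel_measurable_continuous_onI)
  define m1 where "m1 t = 1 / (1 + sqrt (V t))" for t
  define m2 where "m2 t = sqrt (V t) / (1 + sqrt (V t))" for t
  have pos: "0 < 1 + sqrt (V t)" for t using nn[of t] by (simp add: add_pos_nonneg)
  have meas: "m1 \<in> borel_measurable borel" "m2 \<in> borel_measurable borel" unfolding m1_def m2_def by measurable
  have bound: "\<bar>m1 t\<bar> \<le> 1" "\<bar>m2 t\<bar> \<le> 1" for t
    using pos[of t] nn[of t] by (auto simp: m1_def m2_def abs_div_pos)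
  note B1 = bounded_linear_multiplier[OF meas(1) bound(1)]
  note B2 = bounded_linear_multiplier[OF meas(2) bound(2)]
  have M: "M1 = (\<lambda>x. cls (\<lambda>t. m1 t * rep_rl2 x t))" "M2 = (\<lambda>x. cls (\<lambda>t. m2 t * rep_rl2 x t))"
    by (simp_all add: M1_def M2_def m1_def m2_def)
  show "bounded_linear M1" "bounded_linear M2" unfolding M using B1(1) B2(1) by auto
  show "form_graph h V = {p. (\<forall>\<phi> \<phi>'. test_function \<phi> \<phi>' \<longrightarrow>
      h * (fst p \<bullet> cls \<phi>') + fst (snd p) \<bullet> cls \<phi> = 0) \<and> M1 (snd (snd p)) - M2 (fst p) = 0}" (is "_ = ?R")
  proof (intro equalityI subsetI)
    fix p assume "p \<in> form_graph h V"
    then obtain u g where ug: "weak_deriv u g" "(\<lambda>x. sqrt (V x) * u x) \<in> real_L2"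
      and p: "p = (cls u, h *\<^sub>R cls g, cls (\<lambda>x. sqrt (V x) * u x))" by (auto simp: form_graph_def)
    have L2: "u \<in> real_L2" "g \<in> real_L2" using ug by (auto simp: weak_deriv_def)
    have "M1 (cls (\<lambda>x. sqrt (V x) * u x)) = M2 (cls u)"
      unfolding M B1(3)[OF ug(2)] B2(3)[OF L2(1)] by (simp add: m1_def m2_def)
    moreover have "h * (cls u \<bullet> cls \<phi>') + (h *\<^sub>R cls g) \<bullet> cls \<phi> = 0" if "test_function \<phi> \<phi>'" for \<phi> \<phi>'
      using weak_deriv_iff_inner[OF L2] ug(1) that by simp
    ultimately show "p \<in> ?R" by (simp add: p)
  next
    fix p assume p: "p \<in> ?R"
    define u where "u = rep_rl2 (fst p)"
    define g where "g t = 1 / h * rep_rl2 (fst (snd p)) t" for t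
    have L2: "u \<in> real_L2" "g \<in> real_L2"
      using real_L2_scale[OF rep_in_L2[of "fst (snd p)"], of "1 / h"] by (simp_all add: u_def g_def[abs_def])
    have [measurable]: "u \<in> borel_measurable borel" using L2 by (auto dest: real_L2_measurable)
    have cg: "cls g = (1 / h) *\<^sub>R fst (snd p)"
      using cls_scaleR[of "rep_rl2 (fst (snd p))" "1 / h"] by (simp add: g_def[abs_def])
    have cu: "cls u = fst p" by (simp add: u_def)
    have "weak_deriv u g"
      unfolding weak_deriv_iff_inner[OF L2] cg cu
    proof (intro allI impI)
      fix \<phi> \<phi>' assume "test_function \<phi> \<phi>'"
      with p have "h * (fst p \<bullet> cls \<phi>') + fst (snd p) \<bullet> cls \<phi> = 0" by simp
      then show "fst p \<bullet> cls \<phi>' = - ((1 / h) *\<^sub>R fst (snd p) \<bullet> cls \<phi>)" using h by (simp add: field_simps)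
    qed
    have "cls (\<lambda>t. m1 t * rep_rl2 (snd (snd p)) t) = cls (\<lambda>t. m2 t * rep_rl2 (fst p) t)"
      using p by (simp add: M)
    then have "AE t in lborel. m1 t * rep_rl2 (snd (snd p)) t = m2 t * rep_rl2 (fst p) t"
      by (subst (asm) cls_eq_iff) (auto intro: B1(2) B2(2))
    then have ae: "AE t in lborel. rep_rl2 (snd (snd p)) t = sqrt (V t) * u t"
    proof eventually_elim
      fix t assume "m1 t * rep_rl2 (snd (snd p)) t = m2 t * rep_rl2 (fst p) t"
      then show "rep_rl2 (snd (snd p)) t = sqrt (V t) * u t" using pos[of t] by (simp add: m1_def m2_def u_def)
    qed
    have L2V: "(\<lambda>x. sqrt (V x) * u x) \<in> real_L2"
      by (rule real_L2_cong_AE[OF _ _ ae]) auto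
    then have "snd (snd p) = cls (\<lambda>x. sqrt (V x) * u x)"
      using cls_eq_iff[OF rep_in_L2 L2V, of "snd (snd p)"] ae by simp
    then have "p = (cls u, h *\<^sub>R cls g, cls (\<lambda>x. sqrt (V x) * u x))"
      using h by (simp add: prod_eq_iff cu cg)
    then show "p \<in> form_graph h V" unfolding form_graph_def using \<open>weak_deriv u g\<close> L2V by blast
  qed
qed

lemma constraint_closed_subspace:
  fixes M1 M2 :: "rl2 \<Rightarrow> rl2" and h :: real
  assumes M: "bounded_linear M1" "bounded_linear M2"
  defines "C \<equiv> {p. (\<forall>\<phi> \<phi>'. test_function \<phi> \<phi>' \<longrightarrow>
      h * (fst p \<bullet> cls \<phi>') + fst (snd p) \<bullet> cls \<phi> = 0) \<and> M1 (snd (snd p)) - M2 (fst p) = 0}"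
  shows "subspace C" "closed C"
proof -
  interpret M1: bounded_linear M1 by (rule M(1))
  interpret M2: bounded_linear M2 by (rule M(2))
  show "subspace C"
    unfolding subspace_def
  proof (intro conjI ballI allI)
    show "0 \<in> C" by (simp add: C_def M1.zero M2.zero)
  next
    fix p q assume "p \<in> C" "q \<in> C"
    then have *: "M1 (snd (snd p)) = M2 (fst p)" "M1 (snd (snd q)) = M2 (fst q)"
      "\<And>\<phi> \<phi>'. test_function \<phi> \<phi>' \<Longrightarrow> h * (fst p \<bullet> cls \<phi>') + fst (snd p) \<bullet> cls \<phi> = 0"
      "\<And>\<phi> \<phi>'. test_function \<phi> \<phi>' \<Longrightarrow> h * (fst q \<bullet> cls \<phi>') + fst (snd q) \<bullet> cls \<phi> = 0"
      by (auto simp: C_def)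
    have "h * (fst (p + q) \<bullet> cls \<phi>') + fst (snd (p + q)) \<bullet> cls \<phi> = 0" if "test_function \<phi> \<phi>'" for \<phi> \<phi>'
      using *(3)[OF that] *(4)[OF that] by (simp add: inner_add_left algebra_simps)
    then show "p + q \<in> C" using *(1,2) by (simp add: C_def M1.add M2.add)
  next
    fix c :: real and p assume "p \<in> C"
    then have *: "M1 (snd (snd p)) = M2 (fst p)"
      "\<And>\<phi> \<phi>'. test_function \<phi> \<phi>' \<Longrightarrow> h * (fst p \<bullet> cls \<phi>') + fst (snd p) \<bullet> cls \<phi> = 0"
      by (auto simp: C_def)
    have "h * (fst (c *\<^sub>R p) \<bullet> cls \<phi>') + fst (snd (c *\<^sub>R p)) \<bullet> cls \<phi> = 0" if "test_function \<phi> \<phi>'" for \<phi> \<phi>'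
    proof -
      have "c * (h * (fst p \<bullet> cls \<phi>') + fst (snd p) \<bullet> cls \<phi>) = 0" using *(2)[OF that] by simp
      then show ?thesis by (simp only: fst_scaleR snd_scaleR inner_scaleR_left) (simp add: algebra_simps)
    qed
    then show "c *\<^sub>R p \<in> C" using *(1) by (simp add: C_def M1.scaleR M2.scaleR)
  qed
  show "closed C"
    unfolding C_def
    by (intro closed_Collect_conj closed_Collect_all closed_Collect_imp open_Collect_const closed_Collect_eq
        continuous_intros M1.continuous_on M2.continuous_on)
qed

lemma form_graph_closed_subspace:
  assumes V: "continuous_on UNIV V" and nn: "\<And>x. 0 \<le> V x" and h: "h > 0"
  shows "subspace (form_graph h V)" "closed (form_graph h V)"
  unfolding form_graph_eq(1)[OF assms]
  by (rule constraint_closed_subspace[OF form_graph_eq(2,3)[OF assms]])+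

section \<open>Two-sided form bounds for a potential well\<close>

lemma real_L2_set_integrable_square: "u \<in> real_L2 \<Longrightarrow> set_integrable lborel {a..b} (\<lambda>t. (u t)\<^sup>2)"
  unfolding set_integrable_def
  by (intro integrable_mult_indicator real_L2_integrable_square) auto

text \<open>
  Picone's inequality with \<open>\<phi> t = cos (\<Omega> (t - m))\<close>, where \<open>m\<close> is the midpoint; the assumption on the angle keeps \<open>\<phi>\<close>
  positive on the closed interval. Since \<open>p' - p\<^sup>2\<close> is the constant \<open>\<Omega>\<^sup>2\<close>, only values at the end points are lost.
\<close>

lemma energy_nodal_interval:
  assumes wd: "weak_deriv u g" and d: "0 \<le> d" and \<Omega>: "0 < \<Omega>" and angle: "\<Omega> * d / 2 < pi / 2"
  defines "v \<equiv> point_value u g" and "\<kappa> \<equiv> \<Omega> * tan (\<Omega> * d / 2)"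
  shows "\<Omega>\<^sup>2 * (LINT t:{c..c+d}|lborel. (u t)\<^sup>2) - \<kappa> * ((v c)\<^sup>2 + (v (c + d))\<^sup>2) \<le> (LINT t:{c..c+d}|lborel. (g t)\<^sup>2)"
proof -
  define m where "m = c + d / 2"
  define p where "p t = \<Omega> * tan (\<Omega> * (t - m))" for t
  define p' where "p' t = \<Omega>\<^sup>2 * (1 + (tan (\<Omega> * (t - m)))\<^sup>2)" for t
  have cos: "cos (\<Omega> * (t - m)) > 0" if "t \<in> {c..c+d}" for t
  proof -
    have "\<bar>t - m\<bar> \<le> d / 2" using that unfolding m_def abs_le_iff by (auto simp: field_simps)
    then have "\<bar>\<Omega> * (t - m)\<bar> \<le> \<Omega> * (d / 2)" using \<Omega> by (simp add: abs_mult)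
    also have "\<dots> < pi / 2" using angle by simp
    finally show ?thesis by (intro cos_gt_zero_pi) linarith+
  qed
  have der: "(p has_real_derivative p' t) (at t)" if "t \<in> {c..c+d}" for t
  proof -
    have "cos (\<Omega> * (t - m)) \<noteq> 0" using cos[OF that] by simp
    then have "(p has_real_derivative \<Omega> * (inverse ((cos (\<Omega> * (t - m)))\<^sup>2) * \<Omega>)) (at t)"
      unfolding p_def by (auto intro!: derivative_eq_intros)
    moreover have "\<Omega> * (inverse ((cos (\<Omega> * (t - m)))\<^sup>2) * \<Omega>) = p' t"
      unfolding p'_def using tan_sec[OF \<open>cos (\<Omega> * (t - m)) \<noteq> 0\<close>] by (simp add: power2_eq_square)
    ultimately show ?thesis by simp
  qed
  have cont: "continuous_on {c..c+d} p'"
    unfolding p'_def using cos by (intro continuous_intros) force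
  have pp: "p' t - (p t)\<^sup>2 = \<Omega>\<^sup>2" for t
    by (simp add: p_def p'_def power_mult_distrib algebra_simps)
  have ends: "p (c + d) = \<kappa>" "p c = - \<kappa>"
  proof -
    have "\<Omega> * (c + d - m) = \<Omega> * d / 2" "\<Omega> * (c - m) = - (\<Omega> * d / 2)" by (simp_all add: m_def field_simps)
    then show "p (c + d) = \<kappa>" "p c = - \<kappa>" unfolding p_def \<kappa>_def by (simp_all only: tan_minus mult_minus_right)
  qed
  show ?thesis
    using Picone_inequality(2)[OF wd _ der cont] d unfolding pp ends v_def by (simp add: algebra_simps)
qed

lemma energy_nodal_intervals:
  assumes wd: "weak_deriv u g" and d: "0 \<le> d" and \<Omega>: "0 < \<Omega>" and angle: "\<Omega> * d / 2 < pi / 2"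
  defines "v \<equiv> point_value u g" and "\<kappa> \<equiv> \<Omega> * tan (\<Omega> * d / 2)"
  shows "\<Omega>\<^sup>2 * (LINT t:{c..c+real n * d}|lborel. (u t)\<^sup>2) -
      \<kappa> * (\<Sum>j<n. (v (c + real j * d))\<^sup>2 + (v (c + real (Suc j) * d))\<^sup>2) \<le> (LINT t:{c..c+real n * d}|lborel. (g t)\<^sup>2)"
proof (induction n)
  case 0
  have null: "(LINT t:{c..c}|lborel. f t) = 0" for f :: "real \<Rightarrow> real"
  proof -
    have "AE t in lborel. t \<noteq> c" by (rule AE_lborel_singleton)
    then have "AE t in lborel. indicator {c..c} t *\<^sub>R f t = 0" by eventually_elim auto
    then show ?thesis unfolding set_lebesgue_integral_def by (rule integral_eq_zero_AE)
  qed
  show ?case using null[of "\<lambda>t. (u t)\<^sup>2"] null[of "\<lambda>t. (g t)\<^sup>2"] by simp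
next
  case (Suc n)
  have L2: "u \<in> real_L2" "g \<in> real_L2" using wd by (auto simp: weak_deriv_def)
  let ?a = "c + real n * d"
  have eq: "c + real (Suc n) * d = ?a + d" by (simp add: algebra_simps)
  have split: "(LINT t:{c..?a + d}|lborel. (w t)\<^sup>2) = (LINT t:{c..?a}|lborel. (w t)\<^sup>2) + (LINT t:{?a..?a + d}|lborel. (w t)\<^sup>2)"
    if "w \<in> real_L2" for w
    using that d by (intro set_integral_Icc_split real_L2_set_integrable_square) auto
  have "\<Omega>\<^sup>2 * (LINT t:{?a..?a + d}|lborel. (u t)\<^sup>2) - \<kappa> * ((v ?a)\<^sup>2 + (v (?a + d))\<^sup>2) \<le> (LINT t:{?a..?a + d}|lborel. (g t)\<^sup>2)"
    unfolding v_def \<kappa>_def by (rule energy_nodal_interval[OF wd d \<Omega> angle])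
  then show ?case
    using Suc.IH unfolding eq split[OF L2(1)] split[OF L2(2)] sum.lessThan_Suc by (simp add: distrib_left)
qed

text \<open>
  A value at the edge of the well is controlled by the energy in a layer of width \<open>1 / \<kappa>\<close> outside of it. The
  function \<open>p\<close> is linear, of modulus \<open>\<kappa>\<close> at the edge and zero at the far end of the layer, so that no
  information at the far end is needed.
\<close>

lemma energy_boundary_layer:
  assumes wd: "weak_deriv u g" and \<kappa>: "0 < \<kappa>"
  defines "v \<equiv> point_value u g"
  shows "\<kappa> * (v b)\<^sup>2 - 2 * \<kappa>\<^sup>2 * (LINT t:{b..b+1/\<kappa>}|lborel. (u t)\<^sup>2) \<le> (LINT t:{b..b+1/\<kappa>}|lborel. (g t)\<^sup>2)" (is ?right)
    "\<kappa> * (v a)\<^sup>2 - 2 * \<kappa>\<^sup>2 * (LINT t:{a-1/\<kappa>..a}|lborel. (u t)\<^sup>2) \<le> (LINT t:{a-1/\<kappa>..a}|lborel. (g t)\<^sup>2)" (is ?left)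
proof -
  have L2: "u \<in> real_L2" "g \<in> real_L2" using wd by (auto simp: weak_deriv_def)
  have est: "- 2 * \<kappa>\<^sup>2 * (LINT t:{x..y}|lborel. (u t)\<^sup>2) \<le> (LINT t:{x..y}|lborel. (- \<kappa>\<^sup>2 - (p t)\<^sup>2) * (u t)\<^sup>2)"
    if si: "set_integrable lborel {x..y} (\<lambda>t. (- \<kappa>\<^sup>2 - (p t)\<^sup>2) * (u t)\<^sup>2)" and p: "\<And>t. t \<in> {x..y} \<Longrightarrow> \<bar>p t\<bar> \<le> \<kappa>" for x y p
  proof -
    have "(LINT t:{x..y}|lborel. (- 2 * \<kappa>\<^sup>2) * (u t)\<^sup>2) \<le> (LINT t:{x..y}|lborel. (- \<kappa>\<^sup>2 - (p t)\<^sup>2) * (u t)\<^sup>2)"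
    proof (rule set_integral_mono[OF _ si])
      show "set_integrable lborel {x..y} (\<lambda>t. (- 2 * \<kappa>\<^sup>2) * (u t)\<^sup>2)"
        by (intro set_integrable_mult_right real_L2_set_integrable_square L2)
      fix t assume "t \<in> {x..y}"
      from power_mono[OF p[OF this], of 2] have "(p t)\<^sup>2 \<le> \<kappa>\<^sup>2" by simp
      then show "(- 2 * \<kappa>\<^sup>2) * (u t)\<^sup>2 \<le> (- \<kappa>\<^sup>2 - (p t)\<^sup>2) * (u t)\<^sup>2" by (intro mult_right_mono) auto
    qed
    then show ?thesis by (subst (asm) set_integral_mult_right) simp
  qed
  have len: "0 < 1 / \<kappa>" using \<kappa> by simp
  show ?right
  proof -
    define p where "p t = \<kappa>\<^sup>2 * (b + 1/\<kappa> - t)" for t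
    have der: "(p has_real_derivative - \<kappa>\<^sup>2) (at t)" for t
      unfolding p_def by (auto intro!: derivative_eq_intros)
    have ends: "p b = \<kappa>" "p (b + 1/\<kappa>) = 0" using \<kappa> by (simp_all add: p_def power2_eq_square)
    have bd: "\<bar>p t\<bar> \<le> \<kappa>" if "t \<in> {b..b+1/\<kappa>}" for t
    proof -
      have "0 \<le> p t" using that by (simp add: p_def)
      moreover have "p t \<le> \<kappa>\<^sup>2 * (1/\<kappa>)" unfolding p_def using that by (intro mult_left_mono) auto
      ultimately show ?thesis using \<kappa> by (simp add: power2_eq_square)
    qed
    note P = Picone_inequality[OF wd _ der continuous_on_const, of b "b + 1/\<kappa>"]
    show ?thesis using P(2) est[OF P(1) bd] len ends unfolding v_def by (simp add: algebra_simps)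
  qed
  show ?left
  proof -
    define p where "p t = - \<kappa>\<^sup>2 * (t - (a - 1/\<kappa>))" for t
    have der: "(p has_real_derivative - \<kappa>\<^sup>2) (at t)" for t
      unfolding p_def by (auto intro!: derivative_eq_intros)
    have ends: "p a = - \<kappa>" "p (a - 1/\<kappa>) = 0" using \<kappa> by (simp_all add: p_def power2_eq_square)
    have bd: "\<bar>p t\<bar> \<le> \<kappa>" if "t \<in> {a-1/\<kappa>..a}" for t
    proof -
      have "\<kappa>\<^sup>2 * (t - (a - 1/\<kappa>)) \<le> \<kappa>\<^sup>2 * (1/\<kappa>)" using that by (intro mult_left_mono) auto
      moreover have "0 \<le> \<kappa>\<^sup>2 * (t - (a - 1/\<kappa>))" using that by (intro mult_nonneg_nonneg) auto
      ultimately show ?thesis using \<kappa> by (simp add: p_def power2_eq_square)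
    qed
    note P = Picone_inequality[OF wd _ der continuous_on_const, of "a - 1/\<kappa>" a]
    show ?thesis using P(2) est[OF P(1) bd] len ends unfolding v_def by (simp add: algebra_simps)
  qed
qed

text \<open>
  The sum of the previous estimates: \<open>Suc m\<close> equal subintervals of the well and a layer on each side. The
  terms at the two ends of the well cancel, while each of the \<open>m\<close> nodes occurs twice.
\<close>

lemma energy_lower_bound:
  assumes wd: "weak_deriv u g" and ab: "a < b" and \<Omega>: "0 < \<Omega>" and angle: "\<Omega> * (b - a) < real (Suc m) * pi"
  defines "v \<equiv> point_value u g" and "d \<equiv> (b - a) / real (Suc m)"
  defines "\<kappa> \<equiv> \<Omega> * tan (\<Omega> * d / 2)"
  shows "\<Omega>\<^sup>2 * (LINT t:{a..b}|lborel. (u t)\<^sup>2) - 2 * \<kappa>\<^sup>2 * ((LINT t|lborel. (u t)\<^sup>2) - (LINT t:{a..b}|lborel. (u t)\<^sup>2))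
     - 2 * \<kappa> * (\<Sum>j<m. (v (a + real (Suc j) * d))\<^sup>2) \<le> (LINT t|lborel. (g t)\<^sup>2)"
proof -
  have L2: "u \<in> real_L2" "g \<in> real_L2" using wd by (auto simp: weak_deriv_def)
  have d: "0 < d" using ab by (simp add: d_def)
  have ang: "\<Omega> * d / 2 < pi / 2" using angle by (simp add: d_def field_simps)
  have "0 < \<Omega> * d / 2" using \<Omega> d by simp
  then have \<kappa>: "0 < \<kappa>" unfolding \<kappa>_def using \<Omega> ang by (intro mult_pos_pos tan_gt_zero)
  have ad: "a + real (Suc m) * d = b" by (simp add: d_def field_simps)
  have "0 < 1 / \<kappa>" using \<kappa> by simp
  define I where "I w x y = (LINT t:{x..y}|lborel. (w t)\<^sup>2)" for w :: "real \<Rightarrow> real" and x y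
  have split: "I w (a - 1/\<kappa>) (b + 1/\<kappa>) = I w (a - 1/\<kappa>) a + I w a b + I w b (b + 1/\<kappa>)" if "w \<in> real_L2" for w
  proof -
    have "I w (a - 1/\<kappa>) (b + 1/\<kappa>) = I w (a - 1/\<kappa>) a + I w a (b + 1/\<kappa>)"
      unfolding I_def using that ab \<open>0 < 1 / \<kappa>\<close> by (intro set_integral_Icc_split real_L2_set_integrable_square) linarith+
    also have "I w a (b + 1/\<kappa>) = I w a b + I w b (b + 1/\<kappa>)"
      unfolding I_def using that ab \<open>0 < 1 / \<kappa>\<close> by (intro set_integral_Icc_split real_L2_set_integrable_square) linarith+
    finally show ?thesis by simp
  qed
  have le: "I w x y \<le> (LINT t|lborel. (w t)\<^sup>2)" if "w \<in> real_L2" for w x y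
    unfolding I_def set_lebesgue_integral_def using real_L2_integrable_square[OF that]
    by (intro integral_mono integrable_mult_indicator) (auto simp: indicator_def)
  have mid: "\<Omega>\<^sup>2 * I u a b - \<kappa> * (\<Sum>j<Suc m. (v (a + real j * d))\<^sup>2 + (v (a + real (Suc j) * d))\<^sup>2) \<le> I g a b"
    using energy_nodal_intervals[OF wd less_imp_le[OF d] \<Omega> ang, of a "Suc m"]
    unfolding ad I_def v_def \<kappa>_def by simp
  have sum: "(\<Sum>j<Suc m. (v (a + real j * d))\<^sup>2 + (v (a + real (Suc j) * d))\<^sup>2) =
     (v a)\<^sup>2 + (v b)\<^sup>2 + 2 * (\<Sum>j<m. (v (a + real (Suc j) * d))\<^sup>2)"
  proof -
    have "(\<Sum>j<Suc m. (v (a + real j * d))\<^sup>2) = (v a)\<^sup>2 + (\<Sum>j<m. (v (a + real (Suc j) * d))\<^sup>2)"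
      by (subst sum.lessThan_Suc_shift) simp
    moreover have "(\<Sum>j<Suc m. (v (a + real (Suc j) * d))\<^sup>2) = (\<Sum>j<m. (v (a + real (Suc j) * d))\<^sup>2) + (v b)\<^sup>2"
      unfolding sum.lessThan_Suc ad ..
    ultimately show ?thesis by (simp only: sum.distrib)
  qed
  have left: "\<kappa> * (v a)\<^sup>2 - 2 * \<kappa>\<^sup>2 * I u (a - 1/\<kappa>) a \<le> I g (a - 1/\<kappa>) a"
    and right: "\<kappa> * (v b)\<^sup>2 - 2 * \<kappa>\<^sup>2 * I u b (b + 1/\<kappa>) \<le> I g b (b + 1/\<kappa>)"
    unfolding I_def v_def using energy_boundary_layer[OF wd \<kappa>] by auto
  have "2 * \<kappa>\<^sup>2 * (I u (a - 1/\<kappa>) a + I u b (b + 1/\<kappa>)) \<le> 2 * \<kappa>\<^sup>2 * ((LINT t|lborel. (u t)\<^sup>2) - I u a b)"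
    using le[OF L2(1), of "a - 1/\<kappa>" "b + 1/\<kappa>"] unfolding split[OF L2(1)] by (intro mult_left_mono) auto
  moreover have "I g (a - 1/\<kappa>) a + I g a b + I g b (b + 1/\<kappa>) \<le> (LINT t|lborel. (g t)\<^sup>2)"
    using le[OF L2(2), of "a - 1/\<kappa>" "b + 1/\<kappa>"] unfolding split[OF L2(2)] .
  ultimately show ?thesis
    using mid left right unfolding sum unfolding I_def[symmetric] by (simp add: algebra_simps)
qed

definition point_functional :: "real \<Rightarrow> real \<Rightarrow> rl2 \<times> rl2 \<times> rl2 \<Rightarrow> real" where
  "point_functional h x p = fst p \<bullet> cls (\<lambda>t. indicator {x-1..x} t) +
     1 / h * (fst (snd p) \<bullet> cls (\<lambda>t. indicator {x-1..x} t * (t - x + 1)))"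

lemma bounded_linear_point_functional: "bounded_linear (point_functional h x)"
  unfolding point_functional_def
  by (intro bounded_linear_add bounded_linear_const_mult
      bounded_linear_inner_left_comp bounded_linear_fst bounded_linear_compose[OF bounded_linear_fst bounded_linear_snd])

lemma point_functional_eq:
  assumes wd: "weak_deriv u g" and h: "h \<noteq> 0"
  shows "point_functional h x (cls u, h *\<^sub>R cls g, z) = point_value u g x"
proof -
  have L2: "u \<in> real_L2" "g \<in> real_L2" using wd by (auto simp: weak_deriv_def)
  have w: "(\<lambda>t. indicator {x-1..x} t * (t - x + 1)) \<in> real_L2"
    by (rule real_L2_bounded_support[where C = 1 and a = "x-1" and b = x]) (auto simp: indicator_def)
  have "point_functional h x (cls u, h *\<^sub>R cls g, z) =
     (LINT t|lborel. u t * indicator {x-1..x} t) + (LINT t|lborel. g t * (indicator {x-1..x} t * (t - x + 1)))"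
    using h by (simp add: point_functional_def inner_cls L2 w real_L2_indicator)
  also have "\<dots> = (LINT t|lborel. u t * indicator {x-1..x} t + g t * (indicator {x-1..x} t * (t - x + 1)))"
    by (intro Bochner_Integration.integral_add[symmetric] real_L2_integrable_mult L2 w real_L2_indicator)
  also have "\<dots> = point_value u g x"
    unfolding point_value_def set_lebesgue_integral_def
    by (intro Bochner_Integration.integral_cong) (auto simp: algebra_simps)
  finally show ?thesis .
qed

lemma form_graph_norms:
  assumes "weak_deriv u g" "(\<lambda>x. sqrt (V x) * u x) \<in> real_L2" "\<And>x. 0 \<le> V x"
  shows "(norm (cls u))\<^sup>2 = (LINT t|lborel. (u t)\<^sup>2)"
    "(norm (h *\<^sub>R cls g, cls (\<lambda>x. sqrt (V x) * u x)))\<^sup>2 = h\<^sup>2 * (LINT t|lborel. (g t)\<^sup>2) + (LINT t|lborel. V t * (u t)\<^sup>2)"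
    "integrable lborel (\<lambda>t. V t * (u t)\<^sup>2)"
proof -
  have L2: "u \<in> real_L2" "g \<in> real_L2" using assms by (auto simp: weak_deriv_def)
  have sq: "(sqrt (V t) * u t)\<^sup>2 = V t * (u t)\<^sup>2" for t using assms(3)[of t] by (simp add: power_mult_distrib)
  show "(norm (cls u))\<^sup>2 = (LINT t|lborel. (u t)\<^sup>2)" by (rule norm_sq_cls[OF L2(1)])
  show "(norm (h *\<^sub>R cls g, cls (\<lambda>x. sqrt (V x) * u x)))\<^sup>2 = h\<^sup>2 * (LINT t|lborel. (g t)\<^sup>2) + (LINT t|lborel. V t * (u t)\<^sup>2)"
    using norm_sq_cls[OF L2(2)] norm_sq_cls[OF assms(2)] by (simp add: norm_Pair power_mult_distrib assms(3))
  show "integrable lborel (\<lambda>t. V t * (u t)\<^sup>2)" using real_L2_integrable_square[OF assms(2)] by (simp add: sq)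
qed

text \<open>
  The potential outside the well is chosen large enough to absorb the mass in the boundary layers and to
  leave \<open>h\<^sup>2 \<Omega>\<^sup>2\<close> there.
\<close>

lemma form_ge_modulo_well:
  assumes nn: "\<And>x. 0 \<le> V x" and h: "0 < h" and ab: "a < b"
    and \<Omega>: "0 < \<Omega>" and angle: "\<Omega> * (b - a) < real (Suc m) * pi"
    and outside: "\<And>x. x \<notin> {a..b} \<Longrightarrow> h\<^sup>2 * (2 * (\<Omega> * tan (\<Omega> * ((b - a) / real (Suc m)) / 2))\<^sup>2 + \<Omega>\<^sup>2) \<le> V x"
  shows "form_ge_modulo (form_graph h V) (h\<^sup>2 * \<Omega>\<^sup>2) m"
proof -
  define d where "d = (b - a) / real (Suc m)"
  define \<kappa> where "\<kappa> = \<Omega> * tan (\<Omega> * d / 2)"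
  have "h\<^sup>2 * \<Omega>\<^sup>2 * (norm (fst y))\<^sup>2 \<le> (norm (snd y))\<^sup>2 + h\<^sup>2 * 2 * \<kappa> * (\<Sum>j<m. (point_functional h (a + real (Suc j) * d) y)\<^sup>2)"
    if y: "y \<in> form_graph h V" for y
  proof -
    obtain u g where ug: "weak_deriv u g" "(\<lambda>x. sqrt (V x) * u x) \<in> real_L2"
      and y: "y = (cls u, h *\<^sub>R cls g, cls (\<lambda>x. sqrt (V x) * u x))" using y by (auto simp: form_graph_def)
    have L2: "u \<in> real_L2" "g \<in> real_L2" using ug by (auto simp: weak_deriv_def)
    define v where "v = point_value u g"
    have pf: "point_functional h x y = v x" for x unfolding y v_def using h by (intro point_functional_eq[OF ug(1)]) simp
    define K where "K = h\<^sup>2 * (2 * \<kappa>\<^sup>2 + \<Omega>\<^sup>2)"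
    have [measurable]: "u \<in> borel_measurable borel" using L2 by (auto dest: real_L2_measurable)
    have potential: "K * ((LINT t|lborel. (u t)\<^sup>2) - (LINT t:{a..b}|lborel. (u t)\<^sup>2)) \<le> (LINT t|lborel. V t * (u t)\<^sup>2)"
    proof -
      have i: "integrable lborel (\<lambda>t. indicator {a..b} t *\<^sub>R (u t)\<^sup>2)"
        using real_L2_set_integrable_square[OF L2(1)] by (simp add: set_integrable_def)
      have "K * ((LINT t|lborel. (u t)\<^sup>2) - (LINT t:{a..b}|lborel. (u t)\<^sup>2)) = (LINT t|lborel. K * ((u t)\<^sup>2 - indicator {a..b} t *\<^sub>R (u t)\<^sup>2))"
        unfolding set_lebesgue_integral_def using i real_L2_integrable_square[OF L2(1)] by simp
      also have "\<dots> \<le> (LINT t|lborel. V t * (u t)\<^sup>2)"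
      proof (rule integral_mono)
        show "integrable lborel (\<lambda>t. K * ((u t)\<^sup>2 - indicator {a..b} t *\<^sub>R (u t)\<^sup>2))"
          using i real_L2_integrable_square[OF L2(1)] by (intro integrable_mult_right Bochner_Integration.integrable_diff)
        show "integrable lborel (\<lambda>t. V t * (u t)\<^sup>2)" by (rule form_graph_norms(3)[OF ug nn])
        fix t
        show "K * ((u t)\<^sup>2 - indicator {a..b} t *\<^sub>R (u t)\<^sup>2) \<le> V t * (u t)\<^sup>2"
          using outside[of t] nn[of t]
          by (cases "t \<in> {a..b}") (auto simp: K_def \<kappa>_def d_def intro!: mult_right_mono)
      qed
      finally show ?thesis .
    qed
    have "\<Omega>\<^sup>2 * (LINT t:{a..b}|lborel. (u t)\<^sup>2) - 2 * \<kappa>\<^sup>2 * ((LINT t|lborel. (u t)\<^sup>2) - (LINT t:{a..b}|lborel. (u t)\<^sup>2))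
     - 2 * \<kappa> * (\<Sum>j<m. (v (a + real (Suc j) * d))\<^sup>2) \<le> (LINT t|lborel. (g t)\<^sup>2)"
      unfolding v_def \<kappa>_def d_def by (rule energy_lower_bound[OF ug(1) ab \<Omega> angle])
    from mult_left_mono[OF this, of "h\<^sup>2"] potential
    show ?thesis unfolding pf unfolding y fst_conv snd_conv form_graph_norms(1,2)[OF ug nn] K_def
      by (simp add: algebra_simps)
  qed
  then show ?thesis
    unfolding form_ge_modulo_def
    by (intro exI[of _ "h\<^sup>2 * 2 * \<kappa>"] exI[of _ "\<lambda>j. point_functional h (a + real (Suc j) * d)"])
      (auto intro: bounded_linear_point_functional)
qed

lemma bump_product_zero:
  assumes "d \<le> c' \<or> d' \<le> c"
  shows "bump c d x * bump c' d' x = 0" "bump_deriv c d x * bump_deriv c' d' x = 0"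
  using assms by (auto simp: bump_def bump_deriv_def indicator_def)

text \<open>
  A bump on an interval of length \<open>(b - a) / k\<close> has kinetic energy \<open>h\<^sup>2 (k \<pi> / (b - a))\<^sup>2\<close> per unit of mass; bumps on different
  subintervals are orthogonal because they and their derivatives vanish outside disjoint half-open intervals.
\<close>

lemma orthogonal_trials_well:
  assumes V: "continuous_on UNIV V" and nn: "\<And>x. 0 \<le> V x" and h: "0 < h" and ab: "a < b"
    and inside: "\<And>x. x \<in> {a..b} \<Longrightarrow> V x \<le> W" and k: "0 < k"
  shows "orthogonal_trials (form_graph h V) (h\<^sup>2 * (real k * pi / (b - a))\<^sup>2 + W) k"
proof -
  have [measurable]: "V \<in> borel_measurable borel" using V by (rule borel_measurable_continuous_onI)
  define d where "d = (b - a) / real k"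
  have d: "0 < d" using ab k by (simp add: d_def)
  \<comment> \<open>the nodes; the bump with index \<open>j\<close> lives between \<open>x j\<close> and \<open>x (Suc j)\<close>\<close>
  define x where "x j = a + real j * d" for j
  have step: "x (Suc j) - x j = d" for j by (simp add: x_def algebra_simps)
  have xlt: "x j < x (Suc j)" for j using step[of j] d by linarith
  have mono: "x i \<le> x j" if "i \<le> j" for i j using that d by (simp add: x_def)
  have range: "{x j..<x (Suc j)} \<subseteq> {a..b}" if "j < k" for j
  proof -
    have "x (Suc j) \<le> x k" using that by (intro mono) auto
    moreover have "x k = b" using k by (simp add: x_def d_def)
    moreover have "a \<le> x j" using mono[of 0 j] by (simp add: x_def)
    ultimately show ?thesis by auto
  qed
  define u where "u j = bump (x j) (x (Suc j))" for j
  define g where "g j = bump_deriv (x j) (x (Suc j))" for j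
  define y where "y j = (cls (u j), h *\<^sub>R cls (g j), cls (\<lambda>t. sqrt (V t) * u j t))" for j
  have wd: "weak_deriv (u j) (g j)" for j unfolding u_def g_def by (rule weak_deriv_bump[OF xlt])
  have L2: "u j \<in> real_L2" "g j \<in> real_L2" for j unfolding u_def g_def by (rule bump_L2)+
  have W0: "0 \<le> W" using inside[of a] nn[of a] ab by simp
  have L2V: "(\<lambda>t. sqrt (V t) * u j t) \<in> real_L2" if "j < k" for j
  proof (rule real_L2_dominated[OF real_L2_scale[OF L2(1)[of j], of "sqrt W"]])
    show "(\<lambda>t. sqrt (V t) * u j t) \<in> borel_measurable borel"
      using real_L2_measurable[OF L2(1)] by measurable
    fix t
    show "\<bar>sqrt (V t) * u j t\<bar> \<le> \<bar>sqrt W * u j t\<bar>"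
    proof (cases "t \<in> {x j..<x (Suc j)}")
      case True
      then have "V t \<le> W" using inside range[OF that] by blast
      then have "sqrt (V t) \<le> sqrt W" by simp
      then show ?thesis using nn[of t] by (auto simp: abs_mult intro!: mult_right_mono)
    next
      case False then show ?thesis by (simp add: u_def bump_def)
    qed
  qed
  have yG: "y j \<in> form_graph h V" if "j < k" for j
    unfolding form_graph_def y_def using wd L2V[OF that] by blast
  have n1: "(LINT t|lborel. (u j t)\<^sup>2) = d / 2" and n2: "(LINT t|lborel. (g j t)\<^sup>2) = (pi / d)\<^sup>2 * (d / 2)" for j
    unfolding u_def g_def using bump_norms[OF xlt[of j]] by (simp_all add: step)
  have pd: "pi / d = real k * pi / (b - a)" using k by (simp add: d_def)
  have en: "fst (y j) \<noteq> 0 \<and> (norm (snd (y j)))\<^sup>2 \<le> (h\<^sup>2 * (real k * pi / (b - a))\<^sup>2 + W) * (norm (fst (y j)))\<^sup>2"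
    if "j < k" for j
  proof -
    note N = form_graph_norms[OF wd L2V[OF that] nn]
    have "(norm (fst (y j)))\<^sup>2 = d / 2" by (simp add: y_def N(1) n1)
    moreover have "(LINT t|lborel. V t * (u j t)\<^sup>2) \<le> (LINT t|lborel. W * (u j t)\<^sup>2)"
    proof (rule integral_mono[OF N(3)])
      show "integrable lborel (\<lambda>t. W * (u j t)\<^sup>2)" using real_L2_integrable_square[OF L2(1)] by simp
      show "V t * (u j t)\<^sup>2 \<le> W * (u j t)\<^sup>2" for t
      proof (cases "t \<in> {x j..<x (Suc j)}")
        case True
        then have "V t \<le> W" using inside range[OF that] by blast
        then show ?thesis by (intro mult_right_mono) auto
      next
        case False then show ?thesis by (simp add: u_def bump_def)
      qed
    qed
    then have "(norm (snd (y j)))\<^sup>2 \<le> h\<^sup>2 * ((pi / d)\<^sup>2 * (d / 2)) + W * (d / 2)"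
      unfolding y_def snd_conv N(2) n2 by (simp add: n1)
    ultimately show ?thesis using d by (auto simp: pd algebra_simps)
  qed
  have orth: "fst (y i) \<bullet> fst (y j) = 0 \<and> snd (y i) \<bullet> snd (y j) = 0" if ij: "i < k" "j < k" "i \<noteq> j" for i j
  proof -
    have "x (Suc i) \<le> x j \<or> x (Suc j) \<le> x i"
      using mono[of "Suc i" j] mono[of "Suc j" i] ij by (cases "i < j") auto
    then have z: "u i t * u j t = 0" "g i t * g j t = 0" for t
      unfolding u_def g_def by (rule bump_product_zero)+
    have z': "sqrt (V t) * u i t * (sqrt (V t) * u j t) = 0" for t using z(1)[of t] by auto
    show ?thesis
      by (simp add: y_def inner_cls L2 L2V ij z z')
  qed
  show ?thesis unfolding orthogonal_trials_def using yG en orth by blast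
qed

section \<open>Complex functions as pairs of real ones\<close>

definition re_class :: "(real \<Rightarrow> complex) \<Rightarrow> rl2" where "re_class U = cls (\<lambda>x. Re (U x))"
definition im_class :: "(real \<Rightarrow> complex) \<Rightarrow> rl2" where "im_class U = cls (\<lambda>x. Im (U x))"

lemma L2_iff: "U \<in> L2 \<longleftrightarrow> (\<lambda>x. Re (U x)) \<in> real_L2 \<and> (\<lambda>x. Im (U x)) \<in> real_L2"
proof
  assume U: "U \<in> L2"
  then have [measurable]: "U \<in> borel_measurable borel" and i: "integrable lborel (\<lambda>x. (cmod (U x))\<^sup>2)" by (auto simp: L2_def)
  have "integrable lborel (\<lambda>x. (Re (U x))\<^sup>2)" "integrable lborel (\<lambda>x. (Im (U x))\<^sup>2)"
    by (rule Bochner_Integration.integrable_bound[OF i]; auto simp: cmod_power2)+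
  then show "(\<lambda>x. Re (U x)) \<in> real_L2 \<and> (\<lambda>x. Im (U x)) \<in> real_L2" by (simp add: real_L2_def)
next
  assume "(\<lambda>x. Re (U x)) \<in> real_L2 \<and> (\<lambda>x. Im (U x)) \<in> real_L2"
  then show "U \<in> L2" by (auto simp: L2_def real_L2_def cmod_power2 borel_measurable_complex_iff)
qed

lemma L2_parts: "U \<in> L2 \<Longrightarrow> (\<lambda>x. Re (U x)) \<in> real_L2" "U \<in> L2 \<Longrightarrow> (\<lambda>x. Im (U x)) \<in> real_L2"
  by (auto simp: L2_iff)

lemma l2_norm_sq:
  assumes "U \<in> L2" shows "l2_norm U = sqrt ((norm (re_class U))\<^sup>2 + (norm (im_class U))\<^sup>2)"
  using L2_parts[OF assms]
  by (simp add: l2_norm_def re_class_def im_class_def norm_sq_cls cmod_power2 real_L2_integrable_square)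

lemma l2_inner_eq:
  assumes "U \<in> L2" "W \<in> L2"
  shows "l2_inner U W = Complex (re_class U \<bullet> re_class W + im_class U \<bullet> im_class W) (im_class U \<bullet> re_class W - re_class U \<bullet> im_class W)"
proof -
  note L = L2_parts[OF assms(1)] L2_parts[OF assms(2)]
  note I = real_L2_integrable_mult[OF L(1) L(3)] real_L2_integrable_mult[OF L(2) L(4)]
    real_L2_integrable_mult[OF L(2) L(3)] real_L2_integrable_mult[OF L(1) L(4)]
  have eq: "U x * cnj (W x) = complex_of_real (Re (U x) * Re (W x) + Im (U x) * Im (W x)) +
      \<i> * complex_of_real (Im (U x) * Re (W x) - Re (U x) * Im (W x))" for x
    by (simp add: complex_eq_iff)
  have ri: "integrable lborel (\<lambda>x. complex_of_real (Re (U x) * Re (W x) + Im (U x) * Im (W x)))"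
     "integrable lborel (\<lambda>x. complex_of_real (Im (U x) * Re (W x) - Re (U x) * Im (W x)))"
    by (intro integrable_of_real Bochner_Integration.integrable_add Bochner_Integration.integrable_diff I)+
  have "l2_inner U W = complex_of_real (LINT x|lborel. Re (U x) * Re (W x) + Im (U x) * Im (W x)) +
     \<i> * complex_of_real (LINT x|lborel. Im (U x) * Re (W x) - Re (U x) * Im (W x))"
    unfolding l2_inner_def eq using ri by (subst Bochner_Integration.integral_add) (auto simp del: of_real_add of_real_diff of_real_mult)
  also have "\<dots> = Complex (re_class U \<bullet> re_class W + im_class U \<bullet> im_class W) (im_class U \<bullet> re_class W - re_class U \<bullet> im_class W)"
    using I L by (simp add: re_class_def im_class_def inner_cls complex_eq_iff)
  finally show ?thesis .
qed

text \<open>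
  Multiplication by a complex number acts on a pair of real classes as a rotation and dilation; with \<open>- z\<close>
  in place of \<open>z\<close> the lemma also covers \<open>F - z U\<close>.
\<close>

lemma class_add_scaled:
  assumes "F \<in> L2" "U \<in> L2"
  shows "(\<lambda>x. F x + z * U x) \<in> L2"
    "re_class (\<lambda>x. F x + z * U x) = re_class F + Re z *\<^sub>R re_class U - Im z *\<^sub>R im_class U"
    "im_class (\<lambda>x. F x + z * U x) = im_class F + Re z *\<^sub>R im_class U + Im z *\<^sub>R re_class U"
proof -
  note L = L2_parts[OF assms(1)] L2_parts[OF assms(2)]
  have R: "(\<lambda>x. Re (F x) + Re z * Re (U x)) \<in> real_L2" "(\<lambda>x. Im (F x) + Re z * Im (U x)) \<in> real_L2"
    using L by (auto intro: real_L2_add real_L2_scale)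
  have eq: "(\<lambda>x. Re (F x + z * U x)) = (\<lambda>x. (Re (F x) + Re z * Re (U x)) - Im z * Im (U x))"
    "(\<lambda>x. Im (F x + z * U x)) = (\<lambda>x. (Im (F x) + Re z * Im (U x)) + Im z * Re (U x))"
    by (auto simp: fun_eq_iff)
  show "(\<lambda>x. F x + z * U x) \<in> L2"
    unfolding L2_iff eq using R L by (auto intro: real_L2_add real_L2_scale real_L2_diff)
  show "re_class (\<lambda>x. F x + z * U x) = re_class F + Re z *\<^sub>R re_class U - Im z *\<^sub>R im_class U"
    unfolding re_class_def im_class_def eq using L R by (simp add: cls_add cls_diff cls_scaleR real_L2_scale)
  show "im_class (\<lambda>x. F x + z * U x) = im_class F + Re z *\<^sub>R im_class U + Im z *\<^sub>R re_class U"
    unfolding re_class_def im_class_def eq using L R by (simp add: cls_add cls_diff cls_scaleR real_L2_scale)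
qed

definition of_parts :: "rl2 \<Rightarrow> rl2 \<Rightarrow> real \<Rightarrow> complex" where
  "of_parts a b x = Complex (rep_rl2 a x) (rep_rl2 b x)"

lemma of_parts: "of_parts a b \<in> L2" "re_class (of_parts a b) = a" "im_class (of_parts a b) = b"
  by (simp_all add: L2_iff re_class_def im_class_def of_parts_def)

lemma has_weak_derivative_iff:
  "has_weak_derivative U G \<longleftrightarrow>
     weak_deriv (\<lambda>x. Re (U x)) (\<lambda>x. Re (G x)) \<and> weak_deriv (\<lambda>x. Im (U x)) (\<lambda>x. Im (G x))"
proof (cases "U \<in> L2 \<and> G \<in> L2")
  case False
  then show ?thesis unfolding has_weak_derivative_def weak_deriv_def L2_iff by blast
next
  case True
  then have LU: "(\<lambda>x. Re (U x)) \<in> real_L2" "(\<lambda>x. Im (U x)) \<in> real_L2"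
    and LG: "(\<lambda>x. Re (G x)) \<in> real_L2" "(\<lambda>x. Im (G x)) \<in> real_L2" by (auto simp: L2_iff)
  have int: "(LINT x|lborel. W x * complex_of_real (\<phi> x)) = Complex (LINT x|lborel. Re (W x) * \<phi> x) (LINT x|lborel. Im (W x) * \<phi> x)"
    if W: "(\<lambda>x. Re (W x)) \<in> real_L2" "(\<lambda>x. Im (W x)) \<in> real_L2" and \<phi>: "\<phi> \<in> real_L2" for W \<phi>
  proof -
    have eq: "W x * complex_of_real (\<phi> x) = complex_of_real (Re (W x) * \<phi> x) + \<i> * complex_of_real (Im (W x) * \<phi> x)" for x
      by (simp add: complex_eq_iff)
    have i: "integrable lborel (\<lambda>x. complex_of_real (Re (W x) * \<phi> x))" "integrable lborel (\<lambda>x. complex_of_real (Im (W x) * \<phi> x))"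
      by (intro integrable_of_real real_L2_integrable_mult W \<phi>)+
    show ?thesis
      unfolding eq using i by (subst Bochner_Integration.integral_add) (auto simp del: of_real_mult simp: complex_eq_iff)
  qed
  have "(LINT x|lborel. U x * complex_of_real (\<phi>' x)) = - (LINT x|lborel. G x * complex_of_real (\<phi> x)) \<longleftrightarrow>
     (LINT x|lborel. Re (U x) * \<phi>' x) = - (LINT x|lborel. Re (G x) * \<phi> x) \<and>
     (LINT x|lborel. Im (U x) * \<phi>' x) = - (LINT x|lborel. Im (G x) * \<phi> x)"
    if "test_function \<phi> \<phi>'" for \<phi> \<phi>'
    using int[OF LU test_function_L2(2)[OF that]] int[OF LG test_function_L2(1)[OF that]] by (simp add: complex_eq_iff)
  then show ?thesis
    unfolding has_weak_derivative_def weak_deriv_def test_function_def[symmetric] using True LU LG by blast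
qed

lemma weak_deriv_cong_AE:
  assumes "weak_deriv u g" "v \<in> real_L2" "AE x in lborel. u x = v x"
  shows "weak_deriv v g"
proof -
  have L: "u \<in> real_L2" "g \<in> real_L2" using assms by (auto simp: weak_deriv_def)
  have "cls u = cls v" using cls_eq_iff[OF L(1) assms(2)] assms(3) by simp
  then show ?thesis using assms(1) L assms(2) by (simp add: weak_deriv_iff_inner)
qed

text \<open>
  The remaining components of a point of the graph are determined by the first one; this makes the
  choice in \<open>weak_derivative\<close> harmless.
\<close>

lemma form_graph_functional:
  assumes "x \<in> form_graph h V" "y \<in> form_graph h V" "fst x = fst y" and V: "continuous_on UNIV V"
  shows "x = y"
proof -
  obtain u g where u: "weak_deriv u g" "(\<lambda>x. sqrt (V x) * u x) \<in> real_L2"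
      "x = (cls u, h *\<^sub>R cls g, cls (\<lambda>x. sqrt (V x) * u x))" using assms(1) by (auto simp: form_graph_def)
  obtain v k where v: "weak_deriv v k" "(\<lambda>x. sqrt (V x) * v x) \<in> real_L2"
      "y = (cls v, h *\<^sub>R cls k, cls (\<lambda>x. sqrt (V x) * v x))" using assms(2) by (auto simp: form_graph_def)
  have L: "u \<in> real_L2" "g \<in> real_L2" "v \<in> real_L2" "k \<in> real_L2" using u v by (auto simp: weak_deriv_def)
  have ae: "AE x in lborel. u x = v x" using assms(3) u(3) v(3) cls_eq_iff[OF L(1,3)] by simp
  have "cls g = cls k" using weak_deriv_unique[OF u(1) v(1) ae] cls_eq_iff[OF L(2,4)] by simp
  moreover have "cls (\<lambda>x. sqrt (V x) * u x) = cls (\<lambda>x. sqrt (V x) * v x)"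
    using ae by (subst cls_eq_iff[OF u(2) v(2)]) auto
  ultimately show ?thesis using u(3) v(3) assms(3) by simp
qed

lemma form_graph_representative:
  assumes x: "x \<in> form_graph h V" and u: "u \<in> real_L2" "fst x = cls u" and V: "continuous_on UNIV V"
  shows "\<exists>g. weak_deriv u g" "(\<lambda>t. sqrt (V t) * u t) \<in> real_L2"
proof -
  have [measurable]: "V \<in> borel_measurable borel" using V by (rule borel_measurable_continuous_onI)
  obtain v g where v: "weak_deriv v g" "(\<lambda>x. sqrt (V x) * v x) \<in> real_L2" "fst x = cls v"
    using x by (auto simp: form_graph_def)
  have vL: "v \<in> real_L2" using v(1) by (simp add: weak_deriv_def)
  have "cls v = cls u" using v(3) u(2) by simp
  then have ae: "AE t in lborel. v t = u t" by (simp only: cls_eq_iff[OF vL u(1)])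
  show "\<exists>g. weak_deriv u g" using weak_deriv_cong_AE[OF v(1) u(1) ae] by blast
  have "AE t in lborel. sqrt (V t) * v t = sqrt (V t) * u t" using ae by eventually_elim simp
  then show "(\<lambda>t. sqrt (V t) * u t) \<in> real_L2"
    by (rule real_L2_cong_AE[OF v(2), rotated]) (use real_L2_measurable[OF u(1)] in measurable)
qed

definition real_graph_point :: "real \<Rightarrow> (real \<Rightarrow> real) \<Rightarrow> (real \<Rightarrow> complex) \<Rightarrow> rl2 \<times> rl2 \<times> rl2" where
  "real_graph_point h V U = (re_class U, h *\<^sub>R re_class (weak_derivative U), re_class (\<lambda>x. of_real (sqrt (V x)) * U x))"

definition imag_graph_point :: "real \<Rightarrow> (real \<Rightarrow> real) \<Rightarrow> (real \<Rightarrow> complex) \<Rightarrow> rl2 \<times> rl2 \<times> rl2" where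
  "imag_graph_point h V U = (im_class U, h *\<^sub>R im_class (weak_derivative U), im_class (\<lambda>x. of_real (sqrt (V x)) * U x))"

lemma form_domain_has_weak_derivative:
  assumes "U \<in> form_domain V" shows "has_weak_derivative U (weak_derivative U)"
  using assms someI_ex[of "has_weak_derivative U"] unfolding form_domain_def H1_def weak_derivative_def by blast

lemma graph_points:
  assumes "U \<in> form_domain V"
  shows "real_graph_point h V U \<in> form_graph h V" "imag_graph_point h V U \<in> form_graph h V"
proof -
  have w: "(\<lambda>x. of_real (sqrt (V x)) * U x) \<in> L2" using assms by (simp add: form_domain_def)
  note d = form_domain_has_weak_derivative[OF assms, unfolded has_weak_derivative_iff]
  show "real_graph_point h V U \<in> form_graph h V" "imag_graph_point h V U \<in> form_graph h V"
    unfolding real_graph_point_def imag_graph_point_def form_graph_def re_class_def im_class_def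
    using d L2_parts[OF w] by auto
qed

lemma graph_points_fst [simp]: "fst (real_graph_point h V U) = re_class U" "fst (imag_graph_point h V U) = im_class U"
  by (simp_all add: real_graph_point_def imag_graph_point_def)

lemma form_domain_L2: "U \<in> form_domain V \<Longrightarrow> U \<in> L2"
  using form_domain_has_weak_derivative by (auto simp: has_weak_derivative_def)

lemma form_domainI:
  assumes U: "U \<in> L2" and V: "continuous_on UNIV V"
    and x: "x \<in> form_graph h V" "fst x = re_class U" and y: "y \<in> form_graph h V" "fst y = im_class U"
  shows "U \<in> form_domain V"
proof -
  obtain g1 where g1: "weak_deriv (\<lambda>x. Re (U x)) g1"
    using form_graph_representative(1)[OF x(1) L2_parts(1)[OF U] _ V] x(2) by (auto simp: re_class_def)
  obtain g2 where g2: "weak_deriv (\<lambda>x. Im (U x)) g2"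
    using form_graph_representative(1)[OF y(1) L2_parts(2)[OF U] _ V] y(2) by (auto simp: im_class_def)
  have "has_weak_derivative U (\<lambda>x. Complex (g1 x) (g2 x))"
    unfolding has_weak_derivative_iff using g1 g2 by simp
  then have "U \<in> H1" by (auto simp: H1_def)
  moreover have "(\<lambda>x. of_real (sqrt (V x)) * U x) \<in> L2"
    using form_graph_representative(2)[OF x(1) L2_parts(1)[OF U] _ V] x(2)
      form_graph_representative(2)[OF y(1) L2_parts(2)[OF U] _ V] y(2)
    by (simp add: L2_iff re_class_def im_class_def)
  ultimately show ?thesis by (simp add: form_domain_def)
qed

lemma schroedinger_form_eq:
  fixes h :: real
  assumes U: "U \<in> form_domain V" and W: "W \<in> form_domain V"
  defines "ru \<equiv> snd (real_graph_point h V U)" and "iu \<equiv> snd (imag_graph_point h V U)"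
    and "rw \<equiv> snd (real_graph_point h V W)" and "iw \<equiv> snd (imag_graph_point h V W)"
  shows "schroedinger_form h V U W = Complex (ru \<bullet> rw + iu \<bullet> iw) (iu \<bullet> rw - ru \<bullet> iw)"
proof -
  have dU: "weak_derivative U \<in> L2" and dW: "weak_derivative W \<in> L2"
    using form_domain_has_weak_derivative U W by (auto simp: has_weak_derivative_def)
  have vU: "(\<lambda>x. of_real (sqrt (V x)) * U x) \<in> L2" and vW: "(\<lambda>x. of_real (sqrt (V x)) * W x) \<in> L2"
    using U W by (auto simp: form_domain_def)
  show ?thesis
    unfolding schroedinger_form_def l2_inner_eq[OF dU dW] l2_inner_eq[OF vU vW]
      ru_def iu_def rw_def iw_def real_graph_point_def imag_graph_point_def
    by (simp add: complex_eq_iff power2_eq_square algebra_simps)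
qed

text \<open>
  The coefficients of the operator are real: testing with real functions separates the real and the
  imaginary part of the equation, and conversely a complex test function is a combination of two real
  ones.
\<close>

lemma schroedinger_iff:
  assumes V: "continuous_on UNIV V" and nn: "\<And>x. 0 \<le> V x" and h: "0 < h"
  shows "(U, F) \<in> schroedinger h V \<longleftrightarrow> U \<in> L2 \<and> F \<in> L2 \<and>
     (re_class U, re_class F) \<in> form_operator (form_graph h V) \<and> (im_class U, im_class F) \<in> form_operator (form_graph h V)"
proof
  assume "(U, F) \<in> schroedinger h V"
  then have U: "U \<in> form_domain V" and F: "F \<in> L2"
    and eq: "\<And>W. W \<in> form_domain V \<Longrightarrow> schroedinger_form h V U W = l2_inner F W" by (auto simp: schroedinger_def)
  have *: "snd (real_graph_point h V U) \<bullet> snd y = re_class F \<bullet> fst y \<and> snd (imag_graph_point h V U) \<bullet> snd y = im_class F \<bullet> fst y"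
    if y: "y \<in> form_graph h V" for y
  proof -
    \<comment> \<open>a real test function, whose imaginary graph point vanishes\<close>
    define W where "W = of_parts (fst y) 0"
    have z: "0 \<in> form_graph h V" using form_graph_closed_subspace(1)[OF V nn h] by (rule subspace_0)
    have W: "W \<in> form_domain V"
      by (rule form_domainI[OF _ V y _ z]) (simp_all add: W_def of_parts)
    have r: "real_graph_point h V W = y"
      by (rule form_graph_functional[OF graph_points(1)[OF W] y _ V]) (simp add: W_def of_parts)
    have i: "imag_graph_point h V W = 0"
      by (rule form_graph_functional[OF graph_points(2)[OF W] z _ V]) (simp add: W_def of_parts)
    have "re_class W = fst y" "im_class W = 0" by (simp_all add: W_def of_parts)
    then show ?thesis
      using eq[OF W] unfolding schroedinger_form_eq[OF U W] l2_inner_eq[OF F form_domain_L2[OF W]] r i by simp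
  qed
  show "U \<in> L2 \<and> F \<in> L2 \<and> (re_class U, re_class F) \<in> form_operator (form_graph h V) \<and> (im_class U, im_class F) \<in> form_operator (form_graph h V)"
    unfolding mem_form_operator fst_conv snd_conv
    using * F form_domain_L2[OF U] graph_points[OF U, of h] graph_points_fst by metis
next
  assume *: "U \<in> L2 \<and> F \<in> L2 \<and>
     (re_class U, re_class F) \<in> form_operator (form_graph h V) \<and> (im_class U, im_class F) \<in> form_operator (form_graph h V)"
  then have UF: "U \<in> L2" "F \<in> L2" by auto
  obtain x y where x: "x \<in> form_graph h V" "fst x = re_class U" "\<And>z. z \<in> form_graph h V \<Longrightarrow> snd x \<bullet> snd z = re_class F \<bullet> fst z"
    and y: "y \<in> form_graph h V" "fst y = im_class U" "\<And>z. z \<in> form_graph h V \<Longrightarrow> snd y \<bullet> snd z = im_class F \<bullet> fst z"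
    using * unfolding mem_form_operator fst_conv snd_conv by blast
  have U: "U \<in> form_domain V" by (rule form_domainI[OF UF(1) V x(1,2) y(1,2)])
  have r: "real_graph_point h V U = x" using form_graph_functional[OF graph_points(1)[OF U] x(1) _ V] x(2) by simp
  have i: "imag_graph_point h V U = y" using form_graph_functional[OF graph_points(2)[OF U] y(1) _ V] y(2) by simp
  have "schroedinger_form h V U W = l2_inner F W" if W: "W \<in> form_domain V" for W
    unfolding schroedinger_form_eq[OF U W] l2_inner_eq[OF UF(2) form_domain_L2[OF W]] r i
    using x(3)[OF graph_points(1)[OF W]] x(3)[OF graph_points(2)[OF W]] y(3)[OF graph_points(1)[OF W]] y(3)[OF graph_points(2)[OF W]]
    by simp
  then show "(U, F) \<in> schroedinger h V" using U UF by (simp add: schroedinger_def)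
qed

section \<open>Spectrum and counted eigenvalues below a gap\<close>

text \<open>
  The situation produced by \<open>exact_eigen_system\<close>: finitely many eigenvectors below \<open>s\<close>, and a form that is at
  least \<open>s\<close> on their orthogonal complement.
\<close>

locale low_spectrum =
  fixes h :: real and V :: "real \<Rightarrow> real" and n :: nat and e :: "nat \<Rightarrow> rl2 \<times> rl2 \<times> rl2"
    and lam :: "nat \<Rightarrow> real" and s :: real
  assumes V: "continuous_on UNIV V" and nn: "\<And>x. 0 \<le> V x" and h: "0 < h"
    and sys: "eigen_system (form_graph h V) n e lam"
    and ge: "form_ge_on (eigen_complement (form_graph h V) n e) s"
    and below: "\<And>i. i < n \<Longrightarrow> lam i < s"
begin

abbreviation "T \<equiv> schroedinger h V"
abbreviation "G \<equiv> form_graph h V"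

lemma G: "subspace G" "closed G"
  using form_graph_closed_subspace[OF V nn h] by auto

lemmas T_iff = schroedinger_iff[OF V nn h]

lemma T_shift_iff:
  assumes "U \<in> L2" "F \<in> L2"
  shows "(U, \<lambda>x. F x + z * U x) \<in> T \<longleftrightarrow>
    (re_class U, re_class F + Re z *\<^sub>R re_class U - Im z *\<^sub>R im_class U) \<in> form_operator G \<and>
    (im_class U, im_class F + Re z *\<^sub>R im_class U + Im z *\<^sub>R re_class U) \<in> form_operator G"
  unfolding T_iff using assms class_add_scaled[OF assms(2,1), of z] by simp

lemma resolvent_setI:
  assumes z: "\<bar>Im z\<bar> < s - Re z" "\<And>i. i < n \<Longrightarrow> z \<noteq> of_real (lam i)"
  shows "z \<in> resolvent_set T"
proof -
  have z': "Complex (Re z) (Im z) \<noteq> of_real (lam i)" if "i < n" for i using z(2)[OF that] by simp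
  have "\<exists>U. (U, \<lambda>x. F x + z * U x) \<in> T" if F: "F \<in> L2" for F
  proof -
    obtain u1 u2 where u: "(u1, re_class F + Re z *\<^sub>R u1 - Im z *\<^sub>R u2) \<in> form_operator G"
      "(u2, im_class F + Re z *\<^sub>R u2 + Im z *\<^sub>R u1) \<in> form_operator G"
      using complex_resolvent_onto[OF G sys ge z(1) z', of "re_class F" "im_class F"] by blast
    then have "(of_parts u1 u2, \<lambda>x. F x + z * of_parts u1 u2 x) \<in> T"
      unfolding T_shift_iff[OF of_parts(1) F] by (simp add: of_parts)
    then show ?thesis by blast
  qed
  moreover have "\<exists>C. \<forall>(U, F) \<in> T. l2_norm U \<le> C * l2_norm (\<lambda>x. F x - z * U x)"
  proof -
    obtain C where C: "C \<ge> 0" "\<And>u1 g1 u2 g2. (u1, g1) \<in> form_operator G \<Longrightarrow> (u2, g2) \<in> form_operator G \<Longrightarrow>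
     (norm u1)\<^sup>2 + (norm u2)\<^sup>2 \<le> C\<^sup>2 * ((norm (g1 - Re z *\<^sub>R u1 + Im z *\<^sub>R u2))\<^sup>2 + (norm (g2 - Re z *\<^sub>R u2 - Im z *\<^sub>R u1))\<^sup>2)"
      using complex_resolvent_bounded[OF G(1) sys ge z(1) z'] by blast
    have "l2_norm U \<le> C * l2_norm (\<lambda>x. F x - z * U x)" if UF: "(U, F) \<in> T" for U F
    proof -
      have L: "U \<in> L2" "F \<in> L2" and op: "(re_class U, re_class F) \<in> form_operator G" "(im_class U, im_class F) \<in> form_operator G"
        using UF unfolding T_iff by auto
      have R: "re_class (\<lambda>x. F x - z * U x) = re_class F - Re z *\<^sub>R re_class U + Im z *\<^sub>R im_class U"
        "im_class (\<lambda>x. F x - z * U x) = im_class F - Re z *\<^sub>R im_class U - Im z *\<^sub>R re_class U" "(\<lambda>x. F x - z * U x) \<in> L2"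
        using class_add_scaled[OF L(2,1), of "- z"] by simp_all
      have "l2_norm U \<le> sqrt (C\<^sup>2 * ((norm (re_class F - Re z *\<^sub>R re_class U + Im z *\<^sub>R im_class U))\<^sup>2 + (norm (im_class F - Re z *\<^sub>R im_class U - Im z *\<^sub>R re_class U))\<^sup>2))"
        unfolding l2_norm_sq[OF L(1)] by (intro real_sqrt_le_mono C(2) op)
      also have "\<dots> = C * l2_norm (\<lambda>x. F x - z * U x)"
        unfolding l2_norm_sq[OF R(3)] R(1,2) using C(1) by (simp add: real_sqrt_mult)
      finally show ?thesis .
    qed
    then show ?thesis by blast
  qed
  ultimately show ?thesis unfolding resolvent_set_def by blast
qed

lemma eigenspace_iff:
  "U \<in> eigenspace T (of_real t) \<longleftrightarrow> U \<in> L2 \<and>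
     (re_class U, t *\<^sub>R re_class U) \<in> form_operator G \<and> (im_class U, t *\<^sub>R im_class U) \<in> form_operator G"
proof (cases "U \<in> L2")
  case True
  have z: "(\<lambda>x. 0) \<in> L2" by (simp add: L2_iff)
  have z0: "re_class (\<lambda>x. 0) = 0" "im_class (\<lambda>x. 0) = 0" by (simp_all add: re_class_def im_class_def zero_rl2_def)
  show ?thesis using T_shift_iff[OF True z, of "of_real t"] True by (simp add: eigenspace_def z0)
qed (simp add: eigenspace_def T_iff)

definition eigenfunction :: "nat \<Rightarrow> real \<Rightarrow> complex" where
  "eigenfunction i = of_parts (fst (e i)) 0"

lemma eigenfunction:
  assumes "i < n"
  shows "eigenfunction i \<in> eigenspace T (of_real (lam i))" "re_class (eigenfunction i) = fst (e i)" "im_class (eigenfunction i) = 0"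
proof -
  show p: "re_class (eigenfunction i) = fst (e i)" "im_class (eigenfunction i) = 0"
    by (simp_all add: eigenfunction_def of_parts)
  have "(0, 0) \<in> form_operator G" using subspace_0[OF form_operator_subspace[OF G(1)]] by (simp add: zero_prod_def)
  then show "eigenfunction i \<in> eigenspace T (of_real (lam i))"
    unfolding eigenspace_iff p using eigenvector_form_operator[OF sys assms] by (simp add: eigenfunction_def of_parts)
qed

text \<open>
  An eigenfunction has norm one but is mapped to zero by \<open>T - lam i\<close>, against the resolvent estimate.
\<close>

lemma eigenvalue_in_spectrum:
  assumes i: "i < n" shows "of_real (lam i) \<in> op_spectrum T"
proof -
  have "\<not> (\<exists>C. \<forall>(U, F) \<in> T. l2_norm U \<le> C * l2_norm (\<lambda>x. F x - of_real (lam i) * U x))"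
  proof
    assume "\<exists>C. \<forall>(U, F) \<in> T. l2_norm U \<le> C * l2_norm (\<lambda>x. F x - of_real (lam i) * U x)"
    then obtain C where C: "\<And>U F. (U, F) \<in> T \<Longrightarrow> l2_norm U \<le> C * l2_norm (\<lambda>x. F x - of_real (lam i) * U x)" by blast
    have "(eigenfunction i, \<lambda>x. of_real (lam i) * eigenfunction i x) \<in> T"
      using eigenfunction(1)[OF i] by (simp add: eigenspace_def)
    from C[OF this] have "l2_norm (eigenfunction i) \<le> 0" by (simp add: l2_norm_def)
    moreover have "eigenfunction i \<in> L2" using eigenfunction(1)[OF i] by (simp add: eigenspace_iff)
    ultimately have "norm (fst (e i)) \<le> 0" by (simp add: l2_norm_sq eigenfunction[OF i])
    moreover have "fst (e i) \<bullet> fst (e i) = 1" using eigen_systemD(3)[OF sys i i] by simp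
    ultimately show False by simp
  qed
  then show ?thesis unfolding op_spectrum_def resolvent_set_def by blast
qed

lemma class_sum:
  assumes "finite J" "\<And>j. j \<in> J \<Longrightarrow> f j \<in> L2"
  shows "(\<lambda>x. \<Sum>j\<in>J. c j * f j x) \<in> L2 \<and>
    re_class (\<lambda>x. \<Sum>j\<in>J. c j * f j x) = (\<Sum>j\<in>J. Re (c j) *\<^sub>R re_class (f j) - Im (c j) *\<^sub>R im_class (f j)) \<and>
    im_class (\<lambda>x. \<Sum>j\<in>J. c j * f j x) = (\<Sum>j\<in>J. Re (c j) *\<^sub>R im_class (f j) + Im (c j) *\<^sub>R re_class (f j))"
  using assms
proof (induction J rule: finite_induct)
  case empty
  show ?case by (simp add: L2_iff re_class_def im_class_def zero_rl2_def)
next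
  case (insert a J)
  then have IH: "(\<lambda>x. \<Sum>j\<in>J. c j * f j x) \<in> L2"
    "re_class (\<lambda>x. \<Sum>j\<in>J. c j * f j x) = (\<Sum>j\<in>J. Re (c j) *\<^sub>R re_class (f j) - Im (c j) *\<^sub>R im_class (f j))"
    "im_class (\<lambda>x. \<Sum>j\<in>J. c j * f j x) = (\<Sum>j\<in>J. Re (c j) *\<^sub>R im_class (f j) + Im (c j) *\<^sub>R re_class (f j))" by auto
  have fa: "f a \<in> L2" using insert by simp
  have eq: "(\<lambda>x. \<Sum>j\<in>insert a J. c j * f j x) = (\<lambda>x. (\<Sum>j\<in>J. c j * f j x) + c a * f a x)"
    using insert by (simp add: fun_eq_iff add.commute)
  show ?case
    unfolding eq using class_add_scaled[OF IH(1) fa, of "c a"] insert IH(2,3) by (simp add: algebra_simps)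
qed

text \<open>
  Real and imaginary parts of an eigenfunction for a real eigenvalue are combinations of the real
  eigenvectors, so the complex dimension of the eigenspace is the number of these.
\<close>

lemma eig_mult_eq:
  assumes t: "t < s"
  shows "eig_mult T (of_real t) = enat (card {i. i < n \<and> lam i = t})"
proof -
  define I where "I = {i. i < n \<and> lam i = t}"
  have fin: "finite I" by (simp add: I_def)
  have upper: "m \<le> card I" if f: "\<forall>j<m. f j \<in> eigenspace T (of_real t)" "l2_independent m f" for m f
  proof (rule ccontr)
    assume "\<not> m \<le> card I"
    then have "card I < card {..<m}" by simp
    from underdetermined_system_nontrivial_solution[OF fin _ this, of "\<lambda>j i. Complex (re_class (f j) \<bullet> fst (e i)) (im_class (f j) \<bullet> fst (e i))"]
    obtain c where c: "\<exists>j\<in>{..<m}. c j \<noteq> 0"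
      "\<And>i. i \<in> I \<Longrightarrow> (\<Sum>j<m. c j * Complex (re_class (f j) \<bullet> fst (e i)) (im_class (f j) \<bullet> fst (e i))) = 0" by auto
    have fL: "f j \<in> L2" "(re_class (f j), t *\<^sub>R re_class (f j)) \<in> form_operator G" "(im_class (f j), t *\<^sub>R im_class (f j)) \<in> form_operator G"
      if "j < m" for j using f(1) that by (auto simp: eigenspace_iff)
    define U where "U x = (\<Sum>j<m. c j * f j x)" for x
    have U: "U \<in> L2" "re_class U = (\<Sum>j<m. Re (c j) *\<^sub>R re_class (f j) - Im (c j) *\<^sub>R im_class (f j))"
      "im_class U = (\<Sum>j<m. Re (c j) *\<^sub>R im_class (f j) + Im (c j) *\<^sub>R re_class (f j))"
      using class_sum[of "{..<m}" f c] fL(1) by (auto simp: U_def[abs_def])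
    note opS = form_operator_subspace[OF G(1)]
    have "(\<Sum>j<m. Re (c j) *\<^sub>R (re_class (f j), t *\<^sub>R re_class (f j)) - Im (c j) *\<^sub>R (im_class (f j), t *\<^sub>R im_class (f j))) \<in> form_operator G"
      using fL by (intro subspace_sum[OF opS] subspace_diff[OF opS] subspace_scale[OF opS]) auto
    also have "(\<Sum>j<m. Re (c j) *\<^sub>R (re_class (f j), t *\<^sub>R re_class (f j)) - Im (c j) *\<^sub>R (im_class (f j), t *\<^sub>R im_class (f j))) = (re_class U, t *\<^sub>R re_class U)"
      unfolding U by (simp add: prod_eq_iff fst_sum snd_sum scaleR_sum_right algebra_simps)
    finally have R: "(re_class U, t *\<^sub>R re_class U) \<in> form_operator G" .
    have "(\<Sum>j<m. Re (c j) *\<^sub>R (im_class (f j), t *\<^sub>R im_class (f j)) + Im (c j) *\<^sub>R (re_class (f j), t *\<^sub>R re_class (f j))) \<in> form_operator G"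
      using fL by (intro subspace_sum[OF opS] subspace_add[OF opS] subspace_scale[OF opS]) auto
    also have "(\<Sum>j<m. Re (c j) *\<^sub>R (im_class (f j), t *\<^sub>R im_class (f j)) + Im (c j) *\<^sub>R (re_class (f j), t *\<^sub>R re_class (f j))) = (im_class U, t *\<^sub>R im_class U)"
      unfolding U by (simp add: prod_eq_iff fst_sum snd_sum scaleR_sum_right algebra_simps)
    finally have M: "(im_class U, t *\<^sub>R im_class U) \<in> form_operator G" .
    have z: "re_class U \<bullet> fst (e i) = 0" "im_class U \<bullet> fst (e i) = 0" if "i \<in> I" for i
      using c(2)[OF that] unfolding U by (simp_all add: complex_eq_iff inner_sum_left inner_diff_left inner_add_left)
    have "re_class U = 0" using eigenvector_in_span[OF G(1) sys ge t R] z by (simp add: I_def)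
    moreover have "im_class U = 0" using eigenvector_in_span[OF G(1) sys ge t M] z by (simp add: I_def)
    ultimately have "(AE x in lborel. Re (U x) = 0) \<and> (AE x in lborel. Im (U x) = 0)"
      using cls_eq_iff[OF L2_parts(1)[OF U(1)] real_L2_zero] cls_eq_iff[OF L2_parts(2)[OF U(1)] real_L2_zero]
      by (simp add: re_class_def im_class_def zero_rl2_def)
    then have "AE x in lborel. U x = 0" by (auto simp: complex_eq_iff)
    then have "AE x in lborel. (\<Sum>j<m. c j * f j x) = 0" by (simp add: U_def)
    then have "\<forall>j<m. c j = 0" using f(2) unfolding l2_independent_def by blast
    with c(1) show False by auto
  qed
  have lower: "\<exists>f. (\<forall>j<card I. f j \<in> eigenspace T (of_real t)) \<and> l2_independent (card I) f"
  proof -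
    obtain idx where idx: "bij_betw idx {..<card I} I" using ex_bij_betw_nat_finite[OF fin] by (auto simp: atLeast0LessThan)
    define f where "f j = eigenfunction (idx j)" for j
    have idxI: "idx j < n" "lam (idx j) = t" if "j < card I" for j
      using bij_betwE[OF idx] that by (auto simp: I_def)
    have f: "f j \<in> eigenspace T (of_real t)" "re_class (f j) = fst (e (idx j))" "im_class (f j) = 0" if "j < card I" for j
      using eigenfunction[OF idxI(1)[OF that]] idxI(2)[OF that] by (auto simp: f_def)
    have "l2_independent (card I) f"
      unfolding l2_independent_def
    proof (intro allI impI)
      fix c i assume ae: "AE x in lborel. (\<Sum>j<card I. c j * f j x) = 0" and i: "i < card I"
      define U where "U x = (\<Sum>j<card I. c j * f j x)" for x
      have fL: "f j \<in> L2" if "j < card I" for j using f(1)[OF that] by (simp add: eigenspace_iff)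
      have U: "U \<in> L2" "re_class U = (\<Sum>j<card I. Re (c j) *\<^sub>R fst (e (idx j)))" "im_class U = (\<Sum>j<card I. Im (c j) *\<^sub>R fst (e (idx j)))"
        using class_sum[of "{..<card I}" f c] fL by (auto simp: U_def[abs_def] f)
      have "AE x in lborel. U x = 0" using ae by (simp add: U_def)
      then have "AE x in lborel. Re (U x) = 0" "AE x in lborel. Im (U x) = 0" by (auto elim: eventually_mono)
      then have "re_class U = 0" "im_class U = 0"
        using cls_eq_iff[OF L2_parts(1)[OF U(1)] real_L2_zero] cls_eq_iff[OF L2_parts(2)[OF U(1)] real_L2_zero]
        by (simp_all add: re_class_def im_class_def zero_rl2_def)
      moreover have "(\<Sum>j<card I. a j *\<^sub>R fst (e (idx j))) \<bullet> fst (e (idx i)) = a i" for a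
      proof -
        have "idx j = idx i \<longleftrightarrow> j = i" if "j < card I" for j
          using idx i that by (auto simp: bij_betw_def inj_on_def)
        then have "(\<Sum>j<card I. a j *\<^sub>R fst (e (idx j))) \<bullet> fst (e (idx i)) = (\<Sum>j<card I. if j = i then a j else 0)"
          unfolding inner_sum_left using eigen_systemD(3)[OF sys] idxI i by (intro sum.cong) auto
        then show ?thesis using i by simp
      qed
      ultimately have "Re (c i) = 0" "Im (c i) = 0" using U by (metis inner_zero_left)+
      then show "c i = 0" by (simp add: complex_eq_iff)
    qed
    then show ?thesis using f(1) by blast
  qed
  show ?thesis
    unfolding eig_mult_def I_def[symmetric]
  proof (rule antisym)
    show "Sup {enat m |m. \<exists>f. (\<forall>i<m. f i \<in> eigenspace T (of_real t)) \<and> l2_independent m f} \<le> enat (card I)"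
      using upper by (intro Sup_least) auto
    show "enat (card I) \<le> Sup {enat m |m. \<exists>f. (\<forall>i<m. f i \<in> eigenspace T (of_real t)) \<and> l2_independent m f}"
      using lower by (intro Sup_upper) blast
  qed
qed

text \<open>
  On the real line to the left of \<open>s\<close> the spectrum is the finite set of the \<open>lam i\<close>. The radius \<open>R\<close> keeps the disc away from the other
  eigenvalues and inside the region \<open>\<bar>Im z\<bar> < s - Re z\<close> where the resolvent is available.
\<close>

lemma not_essential:
  assumes t: "t < s" shows "complex_of_real t \<notin> essential_spectrum T"
proof (cases "\<exists>i<n. lam i = t")
  case False
  then have "of_real t \<in> resolvent_set T" using t by (intro resolvent_setI) auto
  then show ?thesis by (simp add: essential_spectrum_def op_spectrum_def)
next
  case True
  then obtain i where i: "i < n" "lam i = t" by blast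
  define R where "R = Min (insert ((s - t) / 2) ((\<lambda>j. \<bar>lam j - t\<bar>) ` {j. j < n \<and> lam j \<noteq> t}))"
  have R: "R > 0" "R \<le> (s - t) / 2" "\<And>j. j < n \<Longrightarrow> lam j \<noteq> t \<Longrightarrow> R \<le> \<bar>lam j - t\<bar>"
  proof -
    show "R > 0" using t unfolding R_def by auto
    show "R \<le> (s - t) / 2" unfolding R_def by (intro Min_le) auto
    show "R \<le> \<bar>lam j - t\<bar>" if "j < n" "lam j \<noteq> t" for j unfolding R_def using that by (intro Min_le) auto
  qed
  have near: "z \<in> resolvent_set T" if z: "z \<in> ball (of_real t) R" "z \<noteq> of_real t" for z
  proof (rule resolvent_setI)
    have c: "cmod (z - of_real t) < R" using z(1) by (simp add: dist_norm norm_minus_commute)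
    have "\<bar>Im z\<bar> \<le> cmod (z - of_real t)" "\<bar>Re z - t\<bar> \<le> cmod (z - of_real t)"
      using abs_Im_le_cmod[of "z - of_real t"] abs_Re_le_cmod[of "z - of_real t"] by auto
    then have "\<bar>Im z\<bar> < R" "Re z - t < R" using c by linarith+
    then show "\<bar>Im z\<bar> < s - Re z" using R(2) by (simp add: field_simps)
    fix j assume j: "j < n"
    show "z \<noteq> of_real (lam j)"
    proof
      assume zj: "z = of_real (lam j)"
      then have "lam j \<noteq> t" using z(2) by auto
      then have "R \<le> \<bar>lam j - t\<bar>" using R(3)[OF j] by simp
      moreover have "cmod (z - of_real t) = \<bar>lam j - t\<bar>" unfolding zj by (metis norm_of_real of_real_diff)
      ultimately show False using c by simp
    qed
  qed
  have "ball (of_real t) R \<inter> op_spectrum T = {of_real t}"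
  proof (intro equalityI subsetI)
    fix z assume "z \<in> ball (of_real t) R \<inter> op_spectrum T"
    then show "z \<in> {of_real t}" using near[of z] by (auto simp: op_spectrum_def)
  qed (use eigenvalue_in_spectrum[OF i(1)] i(2) R(1) in auto)
  then have "(of_real t :: complex) isolated_in op_spectrum T"
    unfolding isolated_in_def using eigenvalue_in_spectrum[OF i(1)] i(2) by (metis open_ball)
  moreover have "0 < card {i. i < n \<and> lam i = t}" using i by (auto simp: card_gt_0_iff)
  ultimately have "of_real t \<in> discrete_spectrum T"
    unfolding discrete_spectrum_def by (simp add: eig_mult_eq[OF t] zero_enat_def)
  then show ?thesis by (simp add: essential_spectrum_def)
qed

lemma ess_bottom_ge: "ereal s \<le> ess_bottom T"
  unfolding ess_bottom_def using not_essential by (intro Inf_greatest) (force simp: not_less)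

lemma low_eigenvalues_iff:
  assumes "t < s" shows "t \<in> low_eigenvalues T \<longleftrightarrow> (\<exists>i<n. lam i = t)"
proof -
  have "ereal t < ess_bottom T" using assms ess_bottom_ge by (meson ereal_less_eq(3) less_ereal.simps(1) less_le_trans)
  then show ?thesis
    unfolding low_eigenvalues_def using eig_mult_eq[OF assms] by (auto simp: zero_enat_def card_gt_0_iff)
qed

lemma eig_count_eq:
  assumes "t < s" shows "eig_count T t = enat (card {i. i < n \<and> lam i \<le> t})"
proof -
  define S where "S = {r \<in> low_eigenvalues T. r \<le> t}"
  have S: "S = lam ` {i. i < n \<and> lam i \<le> t}"
    using low_eigenvalues_iff assms by (force simp: S_def)
  have "eig_count T t = (\<Sum>r\<in>S. enat (card {i. i < n \<and> lam i = r}))"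
    unfolding eig_count_def S_def[symmetric] using assms by (intro sum.cong refl eig_mult_eq) (auto simp: S_def)
  also have "\<dots> = enat (\<Sum>r\<in>S. card {i. i < n \<and> lam i = r})"
    by (induction S rule: infinite_finite_induct) (auto simp: zero_enat_def)
  also have "(\<Sum>r\<in>S. card {i. i < n \<and> lam i = r}) = card (\<Union>r\<in>S. {i. i < n \<and> lam i = r})"
    by (rule card_UN_disjoint[symmetric]) (auto simp: S)
  also have "(\<Union>r\<in>S. {i. i < n \<and> lam i = r}) = {i. i < n \<and> lam i \<le> t}" by (auto simp: S)
  finally show ?thesis .
qed

text \<open>
  Up to any \<open>t\<close> below the maximum fewer than \<open>n\<close> of the \<open>n\<close> eigenvalues are counted.
\<close>

lemma lambda_k_eq_Max:
  assumes "0 < n" shows "lambda_k n T = ereal (Max (lam ` {..<n}))"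
proof -
  define M where "M = Max (lam ` {..<n})"
  have ne: "lam ` {..<n} \<noteq> {}" using assms by auto
  have "M \<in> lam ` {..<n}" unfolding M_def using ne by (intro Max_in) auto
  then obtain i where i: "i < n" "lam i = M" by auto
  have le: "lam j \<le> M" if "j < n" for j unfolding M_def using that by (intro Max_ge) auto
  have Ms: "M < s" using below[OF i(1)] i(2) by simp
  have "{j. j < n \<and> lam j \<le> M} = {..<n}" using le by auto
  then have M: "M \<in> low_eigenvalues T \<and> enat n \<le> eig_count T M"
    using i Ms by (auto simp: low_eigenvalues_iff eig_count_eq)
  have least: "M \<le> t" if t: "t \<in> low_eigenvalues T \<and> enat n \<le> eig_count T t" for t
  proof (rule ccontr)
    assume "\<not> M \<le> t"
    then have tM: "t < M" by simp
    then have "{j. j < n \<and> lam j \<le> t} \<subseteq> {..<n} - {i}" using i by auto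
    then have "card {j. j < n \<and> lam j \<le> t} \<le> card ({..<n} - {i})" by (intro card_mono) auto
    also have "\<dots> < n" using i(1) by simp
    finally show False using t tM Ms by (simp add: eig_count_eq)
  qed
  have "(LEAST t. t \<in> low_eigenvalues T \<and> enat n \<le> eig_count T t) = M"
    using M least by (rule Least_equality)
  then show ?thesis using M unfolding lambda_k_def M_def[symmetric] by auto
qed

end

theorem lambda_k_bounds:
  assumes V: "continuous_on UNIV V" and nn: "\<And>x. 0 \<le> V x" and h: "0 < h" and k: "0 < k"
    and above: "form_ge_modulo (form_graph h V) s k" and below: "form_ge_modulo (form_graph h V) r (k - 1)"
    and trials: "orthogonal_trials (form_graph h V) T k" and T: "T < s"
  shows "\<exists>t. lambda_k k (schroedinger h V) = ereal t \<and> r \<le> t \<and> t \<le> T"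
proof -
  obtain e lam where es: "eigen_system (form_graph h V) k e lam" "\<forall>i<k. lam i \<le> T" "\<exists>i<k. r \<le> lam i"
    "form_ge_on (eigen_complement (form_graph h V) k e) s"
    using exact_eigen_system[OF form_graph_closed_subspace[OF V nn h] k above below trials T] by blast
  interpret low_spectrum h V k e lam s
    by unfold_locales (use V nn h es T in \<open>auto intro: le_less_trans\<close>)
  have "r \<le> Max (lam ` {..<k})" using es(3) by (subst Max_ge_iff) auto
  moreover have "Max (lam ` {..<k}) \<le> T" using es(2) k by (subst Max_le_iff) auto
  ultimately show ?thesis using lambda_k_eq_Max[OF k] by blast
qed

section \<open>The shape of a flat well\<close>

locale flat_well =
  fixes V :: "real \<Rightarrow> real"
  assumes nonneg: "\<And>x. 0 \<le> V x"
    and cont: "continuous_on UNIV V"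
    and liminf_pos: "0 < Liminf at_infinity (\<lambda>x. ereal (V x))"
    and zero_set: "V -` {0} = {0}"
    and mono: "\<And>n::nat. \<exists>r>0. strict_mono_on {0<..<r} (\<lambda>x. V x / \<bar>x\<bar> ^ n) \<and>
                               strict_antimono_on {-r<..<0} (\<lambda>x. V x / \<bar>x\<bar> ^ n)"
begin

lemma V_zero: "V x = 0 \<longleftrightarrow> x = 0"
  using zero_set by auto

lemma V_pos: "x \<noteq> 0 \<Longrightarrow> 0 < V x"
  using nonneg[of x] V_zero[of x] by linarith

lemma V_bounded_below_away:
  assumes "0 < r" shows "\<exists>c>0. \<forall>x. r \<le> \<bar>x\<bar> \<longrightarrow> c \<le> V x"
proof -
  obtain l where l: "0 < ereal l" "ereal l < Liminf at_infinity (\<lambda>x. ereal (V x))"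
    using ereal_dense2[OF liminf_pos] by auto
  have "\<forall>\<^sub>F x in at_infinity. ereal l < ereal (V x)"
    using l(2) by (rule less_LiminfD)
  then obtain B where B: "\<And>x. B \<le> \<bar>x\<bar> \<Longrightarrow> l < V x"
    by (auto simp: eventually_at_infinity)
  define K where "K = {-max r B..-r} \<union> {r..max r B}"
  have "compact K" "K \<noteq> {}" by (auto simp: K_def)
  then obtain x0 where x0: "x0 \<in> K" "\<And>y. y \<in> K \<Longrightarrow> V x0 \<le> V y"
    using continuous_attains_inf[of K V] continuous_on_subset[OF cont] by blast
  have "x0 \<noteq> 0" using x0(1) assms by (auto simp: K_def)
  then have pos: "0 < min l (V x0)" using V_pos l(1) by simp
  have "min l (V x0) \<le> V x" if "r \<le> \<bar>x\<bar>" for x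
  proof (cases "B \<le> \<bar>x\<bar>")
    case True then show ?thesis using B[of x] by simp
  next
    case False
    then have "x \<in> K" using that by (auto simp: K_def abs_if split: if_splits)
    then show ?thesis using x0(2) by (simp add: min.coboundedI2)
  qed
  then show ?thesis using pos by blast
qed

lemma well_endsD:
  assumes "well_ends V h a b"
  shows "a < 0" "0 < b" "V a = h\<^sup>2 / (b - a)\<^sup>2" "V b = h\<^sup>2 / (b - a)\<^sup>2" "0 < b - a"
  using assms by (auto simp: well_ends_def)

text \<open>
  An end at distance at least \<open>r\<close> from \<open>0\<close> would force \<open>h\<^sup>2 = V b (b - a)\<^sup>2\<close> (or the same with \<open>V a\<close>) to be at least a positive
  constant. Note that the ends are not assumed to lie near \<open>0\<close>.
\<close>

lemma well_ends_small:
  assumes "0 < r" shows "\<exists>h0>0. \<forall>h a b. 0 < h \<longrightarrow> h < h0 \<longrightarrow> well_ends V h a b \<longrightarrow> -r < a \<and> b < r"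
proof -
  obtain c where c: "c > 0" "\<And>x. r \<le> \<bar>x\<bar> \<Longrightarrow> c \<le> V x" using V_bounded_below_away[OF assms] by blast
  have "-r < a \<and> b < r" if h: "0 < h" "h < r * sqrt c" and w: "well_ends V h a b" for h a b
  proof (rule ccontr)
    assume neg: "\<not> (-r < a \<and> b < r)"
    note W = well_endsD[OF w]
    have "c \<le> h\<^sup>2 / (b - a)\<^sup>2" using neg c(2)[of a] c(2)[of b] W assms by (auto simp: not_less)
    then have "c * (b - a)\<^sup>2 \<le> h\<^sup>2" using W(5) by (simp add: field_simps)
    moreover have "r\<^sup>2 \<le> (b - a)\<^sup>2" using neg W assms by (intro power_mono) auto
    then have "c * r\<^sup>2 \<le> c * (b - a)\<^sup>2" using c(1) by simp
    moreover have "h\<^sup>2 < (r * sqrt c)\<^sup>2" using h by (intro power_strict_mono) auto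
    moreover have "(r * sqrt c)\<^sup>2 = c * r\<^sup>2" using c(1) by (simp add: power_mult_distrib)
    ultimately show False by linarith
  qed
  then show ?thesis using assms c(1) by (intro exI[of _ "r * sqrt c"]) auto
qed

text \<open>
  Quotients are taken of numbers of equal sign, so that no absolute values occur.
\<close>

lemma V_power_growth:
  obtains r where "0 < r"
    "\<And>x y. 0 < x \<Longrightarrow> x \<le> y \<Longrightarrow> y < r \<Longrightarrow> V x \<le> (x / y) ^ n * V y"
    "\<And>x y. x < 0 \<Longrightarrow> y \<le> x \<Longrightarrow> -r < y \<Longrightarrow> V x \<le> (x / y) ^ n * V y"
proof -
  obtain r where r: "r > 0" "strict_mono_on {0<..<r} (\<lambda>x. V x / \<bar>x\<bar> ^ n)"
      "strict_antimono_on {-r<..<0} (\<lambda>x. V x / \<bar>x\<bar> ^ n)" using mono[of n] by blast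
  have ratio: "V x \<le> (\<bar>x\<bar> / \<bar>y\<bar>) ^ n * V y" if "x \<noteq> 0" "y \<noteq> 0" "V x / \<bar>x\<bar> ^ n \<le> V y / \<bar>y\<bar> ^ n" for x y
    using that by (simp add: power_divide field_simps)
  have "V x \<le> (x / y) ^ n * V y" if "0 < x" "x \<le> y" "y < r" for x y
  proof (cases "x = y")
    case False
    then have "V x / \<bar>x\<bar> ^ n < V y / \<bar>y\<bar> ^ n" using that by (intro strict_mono_onD[OF r(2)]) auto
    then show ?thesis using ratio[of x y] that by simp
  qed (use that in simp)
  moreover have "V x \<le> (x / y) ^ n * V y" if "x < 0" "y \<le> x" "-r < y" for x y
  proof (cases "x = y")
    case False
    then have "V x / \<bar>x\<bar> ^ n < V y / \<bar>y\<bar> ^ n" using that r(3) unfolding monotone_on_def by auto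
    then show ?thesis using ratio[of x y] that by simp
  qed (use that in simp)
  ultimately show ?thesis using that r(1) by blast
qed

lemma V_strict_mono:
  obtains r where "0 < r" "\<And>x y. 0 \<le> x \<Longrightarrow> x < y \<Longrightarrow> y < r \<Longrightarrow> V x < V y"
    "\<And>x y. x \<le> 0 \<Longrightarrow> y < x \<Longrightarrow> -r < y \<Longrightarrow> V x < V y"
proof -
  obtain r where r: "r > 0" "strict_mono_on {0<..<r} V" "strict_antimono_on {-r<..<0} V"
    using mono[of 0] by auto
  have "V x < V y" if "0 \<le> x" "x < y" "y < r" for x y
    using that strict_mono_onD[OF r(2), of x y] V_pos[of y] V_zero[of x] by (cases "x = 0") auto
  moreover have "V x < V y" if "x \<le> 0" "y < x" "-r < y" for x y
    using that r(3) V_pos[of y] V_zero[of x] unfolding monotone_on_def by (cases "x = 0") auto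
  ultimately show ?thesis using that r(1) by blast
qed

lemma V_inside_well:
  assumes \<eta>: "0 < \<eta>" "\<eta> < 1"
  shows "\<exists>h0>0. \<forall>h a b x. 0 < h \<longrightarrow> h < h0 \<longrightarrow> well_ends V h a b \<longrightarrow>
     x \<in> {(1 - \<eta>) * a..(1 - \<eta>) * b} \<longrightarrow> V x \<le> (1 - \<eta>) ^ n * (h\<^sup>2 / (b - a)\<^sup>2)"
proof -
  obtain r where r: "0 < r"
    "\<And>x y. 0 < x \<Longrightarrow> x \<le> y \<Longrightarrow> y < r \<Longrightarrow> V x \<le> (x / y) ^ n * V y"
    "\<And>x y. x < 0 \<Longrightarrow> y \<le> x \<Longrightarrow> -r < y \<Longrightarrow> V x \<le> (x / y) ^ n * V y" using V_power_growth[of n] by blast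
  obtain h0 where h0: "h0 > 0" "\<And>h a b. 0 < h \<Longrightarrow> h < h0 \<Longrightarrow> well_ends V h a b \<Longrightarrow> -r < a \<and> b < r"
    using well_ends_small[OF r(1)] by blast
  have "V x \<le> (1 - \<eta>) ^ n * (h\<^sup>2 / (b - a)\<^sup>2)"
    if h: "0 < h" "h < h0" and w: "well_ends V h a b" and x: "x \<in> {(1 - \<eta>) * a..(1 - \<eta>) * b}" for h a b x
  proof -
    note W = well_endsD[OF w]
    have ab: "-r < a" "b < r" using h0(2)[OF h w] by auto
    consider "x = 0" | "0 < x" | "x < 0" by linarith
    then show ?thesis
    proof cases
      case 1
      then show ?thesis using V_zero[of x] \<eta> W(5) by simp
    next
      case 2
      have xb: "x \<le> (1 - \<eta>) * b" using x by simp
      also have "\<dots> \<le> 1 * b" using \<eta> W(2) by (intro mult_right_mono) auto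
      finally have "V x \<le> (x / b) ^ n * V b" using 2 ab by (intro r(2)) auto
      also have "\<dots> \<le> (1 - \<eta>) ^ n * V b"
        using xb W(2) 2 nonneg[of b] by (intro mult_right_mono power_mono) (auto simp: field_simps)
      finally show ?thesis using W(4) by simp
    next
      case 3
      have xa: "(1 - \<eta>) * a \<le> x" using x by simp
      have "1 * a \<le> (1 - \<eta>) * a" using \<eta> W(1) by (intro mult_right_mono_neg) auto
      with xa have "V x \<le> (x / a) ^ n * V a" using 3 ab by (intro r(3)) auto
      also have "\<dots> \<le> (1 - \<eta>) ^ n * V a"
        using xa W(1) 3 nonneg[of a] by (intro mult_right_mono power_mono) (auto simp: field_simps zero_le_divide_iff)
      finally show ?thesis using W(3) by simp
    qed
  qed
  then show ?thesis using h0(1) by blast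
qed

text \<open>
  Close to \<open>0\<close> this is the growth of \<open>V\<close> relative to its value at the ends. Away from \<open>0\<close> the potential is bounded
  below, whereas its value at the ends tends to zero with \<open>h\<close>.
\<close>

lemma V_outside_well:
  assumes \<eta>: "0 < \<eta>" and M: "0 < M"
  shows "\<exists>h0>0. \<forall>h a b x. 0 < h \<longrightarrow> h < h0 \<longrightarrow> well_ends V h a b \<longrightarrow>
     x \<notin> {(1 + \<eta>) * a..(1 + \<eta>) * b} \<longrightarrow> M * (h\<^sup>2 / (b - a)\<^sup>2) \<le> V x"
proof -
  obtain n where n: "M < (1 + \<eta>) ^ n" using real_arch_pow[of "1 + \<eta>" M] \<eta> by auto
  obtain r where r: "0 < r"
    "\<And>x y. 0 < x \<Longrightarrow> x \<le> y \<Longrightarrow> y < r \<Longrightarrow> V x \<le> (x / y) ^ n * V y"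
    "\<And>x y. x < 0 \<Longrightarrow> y \<le> x \<Longrightarrow> -r < y \<Longrightarrow> V x \<le> (x / y) ^ n * V y" using V_power_growth[of n] by blast
  obtain c where c: "c > 0" "\<And>x. r \<le> \<bar>x\<bar> \<Longrightarrow> c \<le> V x" using V_bounded_below_away[OF r(1)] by blast
  have "isCont V 0" using cont by (simp add: continuous_on_eq_continuous_at)
  moreover have "V 0 = 0" using V_zero by simp
  ultimately have "V \<midarrow>0\<rightarrow> 0" by (simp add: isCont_def)
  then have "\<forall>\<^sub>F x in at 0. V x < c / M" using c(1) M by (intro order_tendstoD(2)) auto
  then obtain d where d: "d > 0" "\<And>x. x \<noteq> 0 \<Longrightarrow> \<bar>x\<bar> < d \<Longrightarrow> V x < c / M"
    by (auto simp: eventually_at dist_real_def)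
  obtain h0 where h0: "h0 > 0" "\<And>h a b. 0 < h \<Longrightarrow> h < h0 \<Longrightarrow> well_ends V h a b \<Longrightarrow> - min r d < a \<and> b < min r d"
    using well_ends_small[of "min r d"] r(1) d(1) by auto
  have "M * (h\<^sup>2 / (b - a)\<^sup>2) \<le> V x"
    if h: "0 < h" "h < h0" and w: "well_ends V h a b" and x: "x \<notin> {(1 + \<eta>) * a..(1 + \<eta>) * b}" for h a b x
  proof -
    note W = well_endsD[OF w]
    have ab: "-r < a" "b < r" "-d < a" "b < d" using h0(2)[OF h w] by auto
    show ?thesis
    proof (cases "r \<le> \<bar>x\<bar>")
      case True
      have "V b < c / M" using d(2)[of b] W(2) ab by auto
      then have "M * V b \<le> c" using M by (simp add: field_simps)
      then show ?thesis using c(2)[OF True] W(4) by simp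
    next
      case False
      then consider "(1 + \<eta>) * b < x" "x < r" | "x < (1 + \<eta>) * a" "-r < x" using x by (auto simp: not_le abs_less_iff)
      then show ?thesis
      proof cases
        case 1
        have "1 * b \<le> (1 + \<eta>) * b" using \<eta> W(2) by (intro mult_right_mono) auto
        then have bx: "b \<le> x" using 1 by simp
        have "M * V b \<le> (1 + \<eta>) ^ n * ((b / x) ^ n * V x)"
          using n r(2)[OF W(2) bx 1(2)] M nonneg[of b] \<eta> by (intro mult_mono) auto
        also have "\<dots> = (((1 + \<eta>) * b) / x) ^ n * V x" by (simp add: power_mult_distrib power_divide)
        also have "\<dots> \<le> 1 ^ n * V x"
          using 1 W(2) bx \<eta> nonneg[of x] by (intro mult_right_mono power_mono) (auto simp: field_simps)
        finally show ?thesis using W(4) by simp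
      next
        case 2
        have "(1 + \<eta>) * a \<le> 1 * a" using \<eta> W(1) by (intro mult_right_mono_neg) auto
        then have xa: "x \<le> a" using 2 by simp
        have "M * V a \<le> (1 + \<eta>) ^ n * ((a / x) ^ n * V x)"
          using n r(3)[OF W(1) xa 2(2)] M nonneg[of a] \<eta> by (intro mult_mono) auto
        also have "\<dots> = (((1 + \<eta>) * a) / x) ^ n * V x" by (simp add: power_mult_distrib power_divide)
        also have "\<dots> \<le> 1 ^ n * V x"
        proof (intro mult_right_mono power_mono nonneg)
          show "(1 + \<eta>) * a / x \<le> 1" using 2 W(1) xa by (simp add: divide_le_eq)
          show "0 \<le> (1 + \<eta>) * a / x" using \<eta> W(1) xa by (simp add: zero_le_divide_iff mult_le_0_iff)
        qed
        finally show ?thesis using W(3) by simp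
      qed
    qed
  qed
  then show ?thesis using h0(1) by blast
qed

text \<open>
  Near \<open>0\<close> the two ends are monotone functions of their common height \<open>y\<close>, so that \<open>y (b - a)\<^sup>2\<close> is continuous and
  strictly increasing in \<open>y\<close> and takes the value \<open>h\<^sup>2\<close> exactly once.
\<close>

lemma well_ends_unique_existence: "\<exists>h0>0. \<forall>h. 0 < h \<longrightarrow> h < h0 \<longrightarrow> (\<exists>!d. well_ends V h (fst d) (snd d))"
proof -
  obtain r where r: "0 < r" "\<And>x y. 0 \<le> x \<Longrightarrow> x < y \<Longrightarrow> y < r \<Longrightarrow> V x < V y"
    "\<And>x y. x \<le> 0 \<Longrightarrow> y < x \<Longrightarrow> -r < y \<Longrightarrow> V x < V y" using V_strict_mono by blast
  obtain h1 where h1: "h1 > 0" "\<And>h a b. 0 < h \<Longrightarrow> h < h1 \<Longrightarrow> well_ends V h a b \<Longrightarrow> -r < a \<and> b < r"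
    using well_ends_small[OF r(1)] by blast
  have unique: "a = a' \<and> b = b'"
    if h: "0 < h" "h < h1" and w: "well_ends V h a b" "well_ends V h a' b'" for h a b a' b'
  proof -
    have no: "\<not> V b < V b'" if w: "well_ends V h a b" "well_ends V h a' b'" for a b a' b'
    proof
      assume lt: "V b < V b'"
      note W = well_endsD[OF w(1)] and W' = well_endsD[OF w(2)]
      have ab: "-r < a" "b < r" "-r < a'" "b' < r" using h1(2)[OF h w(1)] h1(2)[OF h w(2)] by auto
      have "b < b'" using lt r(2)[of b' b] W W' ab by (cases b b' rule: linorder_cases) auto
      moreover have "a' < a" using lt r(3)[of a' a] W W' ab by (cases a a' rule: linorder_cases) auto
      ultimately have "(b - a)\<^sup>2 < (b' - a')\<^sup>2" using W(5) by (intro power_strict_mono) auto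
      then have "h\<^sup>2 / (b' - a')\<^sup>2 < h\<^sup>2 / (b - a)\<^sup>2" using h(1) W(5) W'(5) by (intro divide_strict_left_mono mult_pos_pos) auto
      then show False using lt W(4) W'(4) by simp
    qed
    have eq: "V b = V b'" using no[OF w] no[OF w(2,1)] by simp
    note W = well_endsD[OF w(1)] and W' = well_endsD[OF w(2)]
    have ab: "-r < a" "b < r" "-r < a'" "b' < r" using h1(2)[OF h w(1)] h1(2)[OF h w(2)] by auto
    have "b = b'" using eq r(2)[of b' b] r(2)[of b b'] W W' ab by (cases b b' rule: linorder_cases) auto
    moreover have "a = a'" using eq r(3)[of a' a] r(3)[of a a'] W W' ab by (cases a a' rule: linorder_cases) auto
    ultimately show ?thesis by simp
  qed
  define \<rho> where "\<rho> = r / 2"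
  have \<rho>: "0 < \<rho>" "\<rho> < r" using r(1) by (auto simp: \<rho>_def)
  have injR: "inj_on V {0..\<rho>}"
  proof (rule inj_onI)
    fix x y assume "x \<in> {0..\<rho>}" "y \<in> {0..\<rho>}" "V x = V y"
    then show "x = y" using r(2)[of x y] r(2)[of y x] \<rho> by (cases x y rule: linorder_cases) auto
  qed
  have injL: "inj_on V {-\<rho>..0}"
  proof (rule inj_onI)
    fix x y assume "x \<in> {-\<rho>..0}" "y \<in> {-\<rho>..0}" "V x = V y"
    then show "x = y" using r(3)[of x y] r(3)[of y x] \<rho> by (cases x y rule: linorder_cases) auto
  qed
  define E0 where "E0 = min (V \<rho>) (V (-\<rho>))"
  have E0: "0 < E0" using V_pos[of \<rho>] V_pos[of "-\<rho>"] \<rho> by (simp add: E0_def)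
  \<comment> \<open>the right and the left end of the well as functions of the height\<close>
  define f where "f = inv_into {0..\<rho>} V"
  define g where "g = inv_into {-\<rho>..0} V"
  have V0: "V 0 = 0" using V_zero by simp
  have imR: "{0..E0} \<subseteq> V ` {0..\<rho>}"
  proof
    fix y assume y: "y \<in> {0..E0}"
    have "\<exists>x\<ge>0. x \<le> \<rho> \<and> V x = y"
      by (rule IVT') (use y V0 \<rho> continuous_on_subset[OF cont] in \<open>auto simp: E0_def\<close>)
    then show "y \<in> V ` {0..\<rho>}" by auto
  qed
  have imL: "{0..E0} \<subseteq> V ` {-\<rho>..0}"
  proof
    fix y assume y: "y \<in> {0..E0}"
    have "\<exists>x\<ge>-\<rho>. x \<le> 0 \<and> V x = y"
      by (rule IVT2') (use y V0 \<rho> continuous_on_subset[OF cont] in \<open>auto simp: E0_def\<close>)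
    then show "y \<in> V ` {-\<rho>..0}" by auto
  qed
  have f: "continuous_on {0..E0} f" "\<And>y. y \<in> {0..E0} \<Longrightarrow> f y \<in> {0..\<rho>} \<and> V (f y) = y"
  proof -
    have "continuous_on (V ` {0..\<rho>}) f"
      by (rule continuous_on_inv) (auto simp: f_def injR intro: continuous_on_subset[OF cont])
    then show "continuous_on {0..E0} f" using imR by (rule continuous_on_subset)
    fix y assume "y \<in> {0..E0}"
    then have "y \<in> V ` {0..\<rho>}" using imR by blast
    then show "f y \<in> {0..\<rho>} \<and> V (f y) = y" unfolding f_def by (metis inv_into_into f_inv_into_f)
  qed
  have g: "continuous_on {0..E0} g" "\<And>y. y \<in> {0..E0} \<Longrightarrow> g y \<in> {-\<rho>..0} \<and> V (g y) = y"
  proof -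
    have "continuous_on (V ` {-\<rho>..0}) g"
      by (rule continuous_on_inv) (auto simp: g_def injL intro: continuous_on_subset[OF cont])
    then show "continuous_on {0..E0} g" using imL by (rule continuous_on_subset)
    fix y assume "y \<in> {0..E0}"
    then have "y \<in> V ` {-\<rho>..0}" using imL by blast
    then show "g y \<in> {-\<rho>..0} \<and> V (g y) = y" unfolding g_def by (metis inv_into_into f_inv_into_f)
  qed
  define \<Phi> where "\<Phi> y = y * (f y - g y)\<^sup>2" for y
  have pos: "0 < f y" "g y < 0" if "y \<in> {0..E0}" "0 < y" for y
  proof -
    have "f y \<noteq> 0" "g y \<noteq> 0" using f(2)[OF that(1)] g(2)[OF that(1)] that(2) V0 by auto
    then show "0 < f y" "g y < 0" using f(2)[OF that(1)] g(2)[OF that(1)] by auto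
  qed
  have \<Phi>E0: "0 < \<Phi> E0"
  proof -
    have "0 < f E0 - g E0" using pos[of E0] E0 by simp
    then show ?thesis using E0 by (simp add: \<Phi>_def)
  qed
  have exist: "\<exists>a b. well_ends V h a b" if h: "0 < h" "h < sqrt (\<Phi> E0)" for h
  proof -
    have "h\<^sup>2 < (sqrt (\<Phi> E0))\<^sup>2" using h by (intro power_strict_mono) auto
    then have "h\<^sup>2 \<le> \<Phi> E0" using \<Phi>E0 by simp
    then have "\<exists>y\<ge>0. y \<le> E0 \<and> \<Phi> y = h\<^sup>2"
      by (intro IVT') (use E0 in \<open>auto simp: \<Phi>_def intro!: continuous_intros f(1) g(1)\<close>)
    then obtain y where y: "0 \<le> y" "y \<le> E0" "\<Phi> y = h\<^sup>2" by blast
    have "y \<noteq> 0" using y(3) h(1) by (auto simp: \<Phi>_def)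
    then have p: "0 < f y" "g y < 0" using pos[of y] y by auto
    have "y = h\<^sup>2 / (f y - g y)\<^sup>2" using y(3) p by (simp add: \<Phi>_def field_simps)
    then have "well_ends V h (g y) (f y)"
      unfolding well_ends_def using p f(2)[of y] g(2)[of y] y by simp
    then show ?thesis by blast
  qed
  define h0 where "h0 = min h1 (sqrt (\<Phi> E0))"
  have "\<exists>!d. well_ends V h (fst d) (snd d)" if h: "0 < h" "h < h0" for h
  proof -
    obtain a b where ab: "well_ends V h a b" using exist[of h] h by (auto simp: h0_def)
    show ?thesis
    proof (rule ex1I[of _ "(a, b)"])
      show "d = (a, b)" if "well_ends V h (fst d) (snd d)" for d
        using unique[OF h(1) _ that ab] h(2) by (simp add: h0_def prod_eq_iff)
    qed (use ab in simp)
  qed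
  moreover have "0 < h0" using h1(1) \<Phi>E0 by (simp add: h0_def)
  ultimately show ?thesis by blast
qed

section \<open>Asymptotics of the eigenvalues\<close>

text \<open>
  The frequency \<open>\<omega> / (b - a)\<close> with \<open>\<omega> = sqrt (1 - \<tau>) j \<pi>\<close> is chosen to give the constant of the conclusion; the stretching \<open>\<eta>\<close>
  is small enough for the angle condition on the stretched well. Then \<open>M\<close>, the height needed outside in
  units of \<open>h\<^sup>2 / (b - a)\<^sup>2\<close>, does not depend on \<open>h\<close>.
\<close>

lemma form_lower_bound:
  assumes \<tau>: "0 < \<tau>" "\<tau> < 1" and j: "0 < j"
  shows "\<exists>h0>0. \<forall>h a b. 0 < h \<longrightarrow> h < h0 \<longrightarrow> well_ends V h a b \<longrightarrow>
    form_ge_modulo (form_graph h V) ((1 - \<tau>) * (pi\<^sup>2 * h\<^sup>2 * (real j)\<^sup>2 / (b - a)\<^sup>2)) (j - 1)"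
proof -
  define q where "q = sqrt (1 - \<tau>)"
  have q: "0 < q" "q < 1" "q\<^sup>2 = 1 - \<tau>" using \<tau> by (auto simp: q_def)
  define \<eta> where "\<eta> = (1 / q - 1) / 2"
  have \<eta>: "0 < \<eta>" "q * (1 + \<eta>) < 1" using q by (auto simp: \<eta>_def field_simps)
  define \<omega> where "\<omega> = q * (real j * pi)"
  have \<omega>: "0 < \<omega>" using q j by (simp add: \<omega>_def)
  define M where "M = 2 * (\<omega> * tan (\<omega> * (1 + \<eta>) / (2 * real j)))\<^sup>2 + \<omega>\<^sup>2"
  have M: "0 < M" using \<omega> by (simp add: M_def add_nonneg_pos)
  obtain h0 where h0: "h0 > 0" "\<And>h a b x. 0 < h \<Longrightarrow> h < h0 \<Longrightarrow> well_ends V h a b \<Longrightarrow>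
     x \<notin> {(1 + \<eta>) * a..(1 + \<eta>) * b} \<Longrightarrow> M * (h\<^sup>2 / (b - a)\<^sup>2) \<le> V x"
    using V_outside_well[OF \<eta>(1) M] by blast
  have "form_ge_modulo (form_graph h V) ((1 - \<tau>) * (pi\<^sup>2 * h\<^sup>2 * (real j)\<^sup>2 / (b - a)\<^sup>2)) (j - 1)"
    if h: "0 < h" "h < h0" and w: "well_ends V h a b" for h a b
  proof -
    note W = well_endsD[OF w]
    define \<Omega> where "\<Omega> = \<omega> / (b - a)"
    have \<Omega>: "0 < \<Omega>" using \<omega> W(5) by (simp add: \<Omega>_def)
    have len: "(1 + \<eta>) * b - (1 + \<eta>) * a = (1 + \<eta>) * (b - a)" by (simp add: algebra_simps)
    have S: "real (Suc (j - 1)) = real j" using j by simp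
    have "form_ge_modulo (form_graph h V) (h\<^sup>2 * \<Omega>\<^sup>2) (j - 1)"
    proof (rule form_ge_modulo_well[OF nonneg h(1) _ \<Omega>])
      show "(1 + \<eta>) * a < (1 + \<eta>) * b" using W \<eta> by simp
      have "\<Omega> * ((1 + \<eta>) * b - (1 + \<eta>) * a) = q * (1 + \<eta>) * (real j * pi)"
        unfolding len using W(5) by (simp add: \<Omega>_def \<omega>_def)
      also have "\<dots> < 1 * (real j * pi)" using \<eta>(2) j by (intro mult_strict_right_mono) auto
      finally show "\<Omega> * ((1 + \<eta>) * b - (1 + \<eta>) * a) < real (Suc (j - 1)) * pi" unfolding S by simp
      fix x assume x: "x \<notin> {(1 + \<eta>) * a..(1 + \<eta>) * b}"
      have "\<Omega> * (((1 + \<eta>) * b - (1 + \<eta>) * a) / real (Suc (j - 1))) / 2 = \<omega> * (1 + \<eta>) / (2 * real j)"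
        unfolding len S using W(5) j by (simp add: \<Omega>_def field_simps)
      then have "h\<^sup>2 * (2 * (\<Omega> * tan (\<Omega> * (((1 + \<eta>) * b - (1 + \<eta>) * a) / real (Suc (j - 1))) / 2))\<^sup>2 + \<Omega>\<^sup>2) =
         M * (h\<^sup>2 / (b - a)\<^sup>2)"
        using W(5) by (simp add: M_def \<Omega>_def power_mult_distrib power_divide field_simps)
      then show "h\<^sup>2 * (2 * (\<Omega> * tan (\<Omega> * (((1 + \<eta>) * b - (1 + \<eta>) * a) / real (Suc (j - 1))) / 2))\<^sup>2 + \<Omega>\<^sup>2) \<le> V x"
        using h0(2)[OF h w x] by simp
    qed
    moreover have "h\<^sup>2 * \<Omega>\<^sup>2 = (1 - \<tau>) * (pi\<^sup>2 * h\<^sup>2 * (real j)\<^sup>2 / (b - a)\<^sup>2)"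
      unfolding \<Omega>_def \<omega>_def q(3)[symmetric] by (simp add: power_mult_distrib power_divide mult_ac)
    ultimately show ?thesis by simp
  qed
  then show ?thesis using h0(1) by blast
qed

text \<open>
  Half of \<open>\<tau>\<close> is spent on shrinking the well by \<open>q\<close>, the other half on the potential, which is at most \<open>q ^ n\<close> times
  \<open>h\<^sup>2 / (b - a)\<^sup>2\<close> in the shrunk well.
\<close>

lemma form_upper_bound:
  assumes \<tau>: "0 < \<tau>" and k: "0 < k"
  shows "\<exists>h0>0. \<forall>h a b. 0 < h \<longrightarrow> h < h0 \<longrightarrow> well_ends V h a b \<longrightarrow>
    orthogonal_trials (form_graph h V) ((1 + \<tau>) * (pi\<^sup>2 * h\<^sup>2 * (real k)\<^sup>2 / (b - a)\<^sup>2)) k"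
proof -
  define q where "q = 1 / sqrt (1 + \<tau> / 2)"
  have q: "0 < q" "q < 1" using \<tau> by (auto simp: q_def)
  have q2: "1 / q\<^sup>2 = 1 + \<tau> / 2" using \<tau> by (simp add: q_def power_divide)
  obtain n where n: "q ^ n < \<tau> / 2" using real_arch_pow_inv[of "\<tau> / 2" q] \<tau> q by auto
  obtain h0 where h0: "h0 > 0" "\<And>h a b x. 0 < h \<Longrightarrow> h < h0 \<Longrightarrow> well_ends V h a b \<Longrightarrow>
     x \<in> {q * a..q * b} \<Longrightarrow> V x \<le> q ^ n * (h\<^sup>2 / (b - a)\<^sup>2)"
    using V_inside_well[of "1 - q" n] q by auto
  have "orthogonal_trials (form_graph h V) ((1 + \<tau>) * (pi\<^sup>2 * h\<^sup>2 * (real k)\<^sup>2 / (b - a)\<^sup>2)) k"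
    if h: "0 < h" "h < h0" and w: "well_ends V h a b" for h a b
  proof -
    note W = well_endsD[OF w]
    define E where "E = h\<^sup>2 / (b - a)\<^sup>2"
    have E: "0 \<le> E" by (simp add: E_def)
    have "orthogonal_trials (form_graph h V) (h\<^sup>2 * (real k * pi / (q * b - q * a))\<^sup>2 + q ^ n * E) k"
      by (rule orthogonal_trials_well[OF cont nonneg h(1)]) (use W q k h0(2)[OF h w] in \<open>auto simp: E_def\<close>)
    moreover have "h\<^sup>2 * (real k * pi / (q * b - q * a))\<^sup>2 + q ^ n * E \<le> (1 + \<tau>) * (pi\<^sup>2 * h\<^sup>2 * (real k)\<^sup>2 / (b - a)\<^sup>2)"
    proof -
      have "h\<^sup>2 * (real k * pi / (q * b - q * a))\<^sup>2 = (1 / q\<^sup>2) * ((real k * pi)\<^sup>2 * E)"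
        by (simp add: E_def power_divide power_mult_distrib flip: right_diff_distrib)
      then have "h\<^sup>2 * (real k * pi / (q * b - q * a))\<^sup>2 = (1 + \<tau> / 2) * ((real k * pi)\<^sup>2 * E)" unfolding q2 .
      moreover have "q ^ n * E \<le> \<tau> / 2 * ((real k * pi)\<^sup>2 * E)"
      proof -
        have "1 \<le> real k * pi"
          using k pi_gt3 mult_mono[of 1 "real k" 1 pi] by simp
        then have "1 \<le> (real k * pi)\<^sup>2" by (rule one_le_power)
        then have "1 * E \<le> (real k * pi)\<^sup>2 * E" using E by (intro mult_right_mono)
        then show ?thesis using n q E \<tau> by (intro mult_mono) auto
      qed
      moreover have "(1 + \<tau>) * (pi\<^sup>2 * h\<^sup>2 * (real k)\<^sup>2 / (b - a)\<^sup>2) = (1 + \<tau>) * ((real k * pi)\<^sup>2 * E)"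
        by (simp add: E_def power_mult_distrib mult_ac)
      ultimately show ?thesis by (simp add: algebra_simps)
    qed
    ultimately show ?thesis by (rule orthogonal_trials_mono)
  qed
  then show ?thesis using h0(1) by blast
qed

text \<open>
  The parameter \<open>\<tau>\<close> is small enough to keep the upper bound for \<open>k\<close> below the lower bound for \<open>k + 1\<close>.
\<close>

lemma eigenvalue_estimate:
  assumes \<epsilon>: "0 < \<epsilon>" and k: "1 \<le> k"
  shows "\<exists>h0>0. \<forall>h a b. 0 < h \<longrightarrow> h < h0 \<longrightarrow> well_ends V h a b \<longrightarrow>
    (\<exists>t. lambda_k k (schroedinger h V) = ereal t \<and> \<bar>t / (pi\<^sup>2 * h\<^sup>2 * (real k)\<^sup>2 / (b - a)\<^sup>2) - 1\<bar> < \<epsilon>)"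
proof -
  \<comment> \<open>the second bound on \<open>\<tau>\<close> gives \<open>(1 + \<tau>) k\<^sup>2 < (1 - \<tau>) (k + 1)\<^sup>2\<close>\<close>
  define \<tau> where "\<tau> = min (\<epsilon> / 2) (1 / (2 * (real k + 1)\<^sup>2))"
  have \<tau>: "0 < \<tau>" "\<tau> < \<epsilon>" using \<epsilon> by (auto simp: \<tau>_def)
  have \<tau>k: "\<tau> * (2 * (real k + 1)\<^sup>2) \<le> 1"
  proof -
    have "\<tau> \<le> 1 / (2 * (real k + 1)\<^sup>2)" by (simp add: \<tau>_def)
    moreover have "0 < 2 * (real k + 1)\<^sup>2" by simp
    ultimately show ?thesis by (simp add: pos_le_divide_eq del: power2_sum)
  qed
  have "1 \<le> (real k + 1)\<^sup>2" by (simp add: one_le_power)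
  then have "\<tau> * 2 \<le> \<tau> * (2 * (real k + 1)\<^sup>2)" using \<tau>(1) by simp
  then have \<tau>1: "\<tau> < 1" using \<tau>k \<tau>(1) by linarith
  have gap: "(1 + \<tau>) * (real k)\<^sup>2 < (1 - \<tau>) * (real (k + 1))\<^sup>2"
  proof -
    have "\<tau> * (real k)\<^sup>2 \<le> \<tau> * (real k + 1)\<^sup>2" using \<tau>(1) by (intro mult_left_mono power_mono) auto
    then have "\<tau> * (real k)\<^sup>2 + \<tau> * (real k + 1)\<^sup>2 \<le> 1" using \<tau>k by linarith
    moreover have "(real k + 1)\<^sup>2 - (real k)\<^sup>2 = 2 * real k + 1" by (simp add: power2_eq_square algebra_simps)
    moreover have "1 < 2 * real k + 1" using k by simp
    ultimately have "\<tau> * (real k)\<^sup>2 + \<tau> * (real k + 1)\<^sup>2 < (real k + 1)\<^sup>2 - (real k)\<^sup>2" by linarith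
    moreover have "(1 + \<tau>) * A < (1 - \<tau>) * B" if "\<tau> * A + \<tau> * B < B - A" for A B :: real
      using that by (simp add: algebra_simps)
    moreover have "real (k + 1) = real k + 1" by simp
    ultimately show ?thesis by metis
  qed
  obtain h1 where h1: "h1 > 0" "\<And>h a b. 0 < h \<Longrightarrow> h < h1 \<Longrightarrow> well_ends V h a b \<Longrightarrow>
    form_ge_modulo (form_graph h V) ((1 - \<tau>) * (pi\<^sup>2 * h\<^sup>2 * (real k)\<^sup>2 / (b - a)\<^sup>2)) (k - 1)"
    using form_lower_bound[OF \<tau>(1) \<tau>1, of k] k by auto
  obtain h2 where h2: "h2 > 0" "\<And>h a b. 0 < h \<Longrightarrow> h < h2 \<Longrightarrow> well_ends V h a b \<Longrightarrow>
    form_ge_modulo (form_graph h V) ((1 - \<tau>) * (pi\<^sup>2 * h\<^sup>2 * (real (k + 1))\<^sup>2 / (b - a)\<^sup>2)) k"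
    using form_lower_bound[OF \<tau>(1) \<tau>1, of "k + 1"] by auto
  obtain h3 where h3: "h3 > 0" "\<And>h a b. 0 < h \<Longrightarrow> h < h3 \<Longrightarrow> well_ends V h a b \<Longrightarrow>
    orthogonal_trials (form_graph h V) ((1 + \<tau>) * (pi\<^sup>2 * h\<^sup>2 * (real k)\<^sup>2 / (b - a)\<^sup>2)) k"
    using form_upper_bound[OF \<tau>(1), of k] k by auto
  define h0 where "h0 = min h1 (min h2 h3)"
  have "\<exists>t. lambda_k k (schroedinger h V) = ereal t \<and> \<bar>t / (pi\<^sup>2 * h\<^sup>2 * (real k)\<^sup>2 / (b - a)\<^sup>2) - 1\<bar> < \<epsilon>"
    if h: "0 < h" "h < h0" and w: "well_ends V h a b" for h a b
  proof -
    have hs: "h < h1" "h < h2" "h < h3" using h(2) by (auto simp: h0_def)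
    note W = well_endsD[OF w]
    define E where "E = pi\<^sup>2 * h\<^sup>2 / (b - a)\<^sup>2"
    have E: "0 < E" using h(1) W(5) by (simp add: E_def)
    define \<mu> where "\<mu> = pi\<^sup>2 * h\<^sup>2 * (real k)\<^sup>2 / (b - a)\<^sup>2"
    have \<mu>E: "\<mu> = E * (real k)\<^sup>2" by (simp add: \<mu>_def E_def)
    have \<mu>: "0 < \<mu>" using E k by (simp add: \<mu>E)
    have lt: "(1 + \<tau>) * \<mu> < (1 - \<tau>) * (pi\<^sup>2 * h\<^sup>2 * (real (k + 1))\<^sup>2 / (b - a)\<^sup>2)"
    proof -
      have "E * ((1 + \<tau>) * (real k)\<^sup>2) < E * ((1 - \<tau>) * (real (k + 1))\<^sup>2)" using gap E by (intro mult_strict_left_mono)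
      moreover have "(1 + \<tau>) * \<mu> = E * ((1 + \<tau>) * (real k)\<^sup>2)" by (simp add: \<mu>E)
      moreover have "(1 - \<tau>) * (pi\<^sup>2 * h\<^sup>2 * (real (k + 1))\<^sup>2 / (b - a)\<^sup>2) = E * ((1 - \<tau>) * (real (k + 1))\<^sup>2)"
        by (simp add: E_def)
      ultimately show ?thesis by metis
    qed
    have "\<exists>t. lambda_k k (schroedinger h V) = ereal t \<and> (1 - \<tau>) * \<mu> \<le> t \<and> t \<le> (1 + \<tau>) * \<mu>"
      by (rule lambda_k_bounds[OF cont nonneg h(1) _ h2(2)[OF h(1) hs(2) w] h1(2)[OF h(1) hs(1) w, folded \<mu>_def]
            h3(2)[OF h(1) hs(3) w, folded \<mu>_def] lt]) (use k in simp)
    then obtain t where t: "lambda_k k (schroedinger h V) = ereal t" "(1 - \<tau>) * \<mu> \<le> t" "t \<le> (1 + \<tau>) * \<mu>" by blast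
    have "1 - \<tau> \<le> t / \<mu>" "t / \<mu> \<le> 1 + \<tau>" using t(2,3) \<mu> by (simp_all add: field_simps)
    then have "\<bar>t / \<mu> - 1\<bar> < \<epsilon>" using \<tau>(2) by (simp add: abs_less_iff)
    then show ?thesis using t(1) by (auto simp: \<mu>_def)
  qed
  moreover have "0 < h0" using h1(1) h2(1) h3(1) by (simp add: h0_def)
  ultimately show ?thesis by blast
qed

lemma eigenvalue_ratio_tendsto:
  assumes w: "\<forall>\<^sub>F h in at_right 0. well_ends V h (a h) (b h)" and k: "1 \<le> k"
  shows "((\<lambda>h. lambda_k k (schroedinger h V) / ereal (pi\<^sup>2 * h\<^sup>2 * (real k)\<^sup>2 / (b h - a h)\<^sup>2)) \<longlongrightarrow> 1) (at_right 0)"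
proof -
  define \<mu> where "\<mu> h = pi\<^sup>2 * h\<^sup>2 * (real k)\<^sup>2 / (b h - a h)\<^sup>2" for h
  define f where "f h = real_of_ereal (lambda_k k (schroedinger h V)) / \<mu> h" for h
  have ev: "\<forall>\<^sub>F h in at_right 0. (\<exists>t. lambda_k k (schroedinger h V) = ereal t \<and> \<bar>t / \<mu> h - 1\<bar> < \<epsilon>) \<and> \<mu> h \<noteq> 0"
    if \<epsilon>: "0 < \<epsilon>" for \<epsilon>
  proof -
    obtain h0 where h0: "h0 > 0" "\<And>h a b. 0 < h \<Longrightarrow> h < h0 \<Longrightarrow> well_ends V h a b \<Longrightarrow>
      \<exists>t. lambda_k k (schroedinger h V) = ereal t \<and> \<bar>t / (pi\<^sup>2 * h\<^sup>2 * (real k)\<^sup>2 / (b - a)\<^sup>2) - 1\<bar> < \<epsilon>"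
      using eigenvalue_estimate[OF \<epsilon> k] by blast
    have "\<forall>\<^sub>F h in at_right 0. 0 < h \<and> h < h0"
      unfolding eventually_at_right_field using h0(1) by (intro exI[of _ h0]) auto
    with w show ?thesis
    proof eventually_elim
      fix h assume *: "well_ends V h (a h) (b h)" and h: "0 < h \<and> h < h0"
      have "\<mu> h \<noteq> 0" using h k well_endsD(5)[OF *] by (simp add: \<mu>_def)
      then show "(\<exists>t. lambda_k k (schroedinger h V) = ereal t \<and> \<bar>t / \<mu> h - 1\<bar> < \<epsilon>) \<and> \<mu> h \<noteq> 0"
        using h0(2)[OF _ _ *] h by (simp add: \<mu>_def)
    qed
  qed
  have "(f \<longlongrightarrow> 1) (at_right 0)"
  proof (rule tendstoI)
    fix \<epsilon> :: real assume "0 < \<epsilon>"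
    from ev[OF this] show "\<forall>\<^sub>F h in at_right 0. dist (f h) 1 < \<epsilon>"
      by eventually_elim (auto simp: f_def dist_real_def)
  qed
  then have "((\<lambda>h. ereal (f h)) \<longlongrightarrow> ereal 1) (at_right 0)" by simp
  moreover have "\<forall>\<^sub>F h in at_right 0. ereal (f h) = lambda_k k (schroedinger h V) / ereal (\<mu> h)"
    using ev[OF zero_less_one] by eventually_elim (auto simp: f_def)
  ultimately show ?thesis
    unfolding \<mu>_def[symmetric] one_ereal_def by (rule Lim_transform_eventually)
qed

end

theorem theorem3p4:
  fixes V :: "real \<Rightarrow> real"
  assumes nonneg: "\<And>x. 0 \<le> V x"
    and cont: "continuous_on UNIV V"
    and liminf_pos: "0 < Liminf at_infinity (\<lambda>x. ereal (V x))"
    and zero_set: "V -` {0} = {0}"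
    and flat: "\<And>n::nat. V \<in> O[nhds 0](\<lambda>x. \<bar>x\<bar> ^ n)"
    and mono: "\<And>n::nat. \<exists>r>0. strict_mono_on {0<..<r} (\<lambda>x. V x / \<bar>x\<bar> ^ n) \<and>
                               strict_antimono_on {-r<..<0} (\<lambda>x. V x / \<bar>x\<bar> ^ n)"
  shows "(\<forall>\<^sub>F h in at_right 0. \<exists>!d. well_ends V h (fst d) (snd d)) \<and>
         (\<forall>\<delta>\<^sub>m \<delta>\<^sub>p :: real \<Rightarrow> real.
            (\<forall>\<^sub>F h in at_right 0. well_ends V h (\<delta>\<^sub>m h) (\<delta>\<^sub>p h)) \<longrightarrow>
            (\<forall>k::nat. 1 \<le> k \<longrightarrow>
              ((\<lambda>h. lambda_k k (schroedinger h V) /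
                    ereal (pi\<^sup>2 * h\<^sup>2 * (real k)\<^sup>2 / (\<delta>\<^sub>p h - \<delta>\<^sub>m h)\<^sup>2)) \<longlongrightarrow> 1) (at_right 0)))"
proof -
  interpret flat_well V
    by unfold_locales (fact nonneg cont liminf_pos zero_set mono)+
  obtain h0 where "h0 > 0" "\<And>h. 0 < h \<Longrightarrow> h < h0 \<Longrightarrow> \<exists>!d. well_ends V h (fst d) (snd d)"
    using well_ends_unique_existence by blast
  then have "\<forall>\<^sub>F h in at_right 0. \<exists>!d. well_ends V h (fst d) (snd d)"
    unfolding eventually_at_right_field by blast
  then show ?thesis using eigenvalue_ratio_tendsto by blast
qed

end
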